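(* Let $\Bbbk$ be a field of characteristic zero and $\delta\in\Bbbk$. The assignment $\lambda\mapsto R(\lambda)$ gives a bijection between the set of all partitions and the set of all isomorphism classes of nonzero indecomposable objects in $\underline{\mathrm{Rep}}(O_\delta)$.
   Context: A Brauer diagram of type $r\to s$ is a partitioning of $\{1,\dots,r\}\cup\{1',\dots,s'\}$ into disjoint pairs, drawn as strands joining $r$ bottom endpoints and $s$ top endpoints. The Brauer category $\mathcal B(\delta)$ has the nonnegative integers as objects, and $\mathrm{Hom}(r,s)$ is the $\Bbbk$-vector space with basis the Brauer diagrams of type $r\to s$. The composite $h\circ g$ of diagrams is $\delta^{\beta}\,h\star g$, where $h\star g$ is obtained by stacking $h$ on top of $g$ and deleting the $\beta$ closed loops that arise. With $r\otimes s=r+s$, horizontal juxtaposition of diagrams and the obvious braiding, $\mathcal B(\delta)$ is a strict rigid symmetric monoidal category with self-dual objects. $B_r(\delta)=\mathrm{End}_{\mathcal B(\delta)}(r)$ is the Brauer algebra. $\underline{\mathrm{Rep}}(O_\delta)$ is the Karoubi envelope of the additive envelope of $\mathcal B(\delta)$; for an idempotent $e\in B_r(\delta)$, $\mathrm{im}\,e$ denotes the corresponding object. Partitions are of all sizes, including the empty partition $\varnothing$; $|\lambda|$ is the size of $\lambda$. For a partition $\lambda$ with $|\lambda|=r$, let $z_\lambda\in\Bbbk\Sigma_r$ be the primitive idempotent (unique up to conjugation) of the symmetric group algebra corresponding to $\lambda$ (with $(r)$ corresponding to the trivial representation). Here $\Bbbk\Sigma_r\subseteq B_r(\delta)$ is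 spanned by the diagrams all of whose strands join a bottom endpoint to a top endpoint, and $\pi:B_r(\delta)\to\Bbbk\Sigma_r$ is the algebra map which is the identity on $\Bbbk\Sigma_r$ and kills all other diagrams. Write $z_\lambda=e_1+\dots+e_k$ as a sum of mutually orthogonal primitive idempotents of $B_r(\delta)$; there is a unique $i$ with $\pi(e_i)\neq0$, and $e_\lambda:=e_i$ (well defined up to conjugation). Put $R(\lambda)=\mathrm{im}\,e_\lambda$, which is defined up to isomorphism. *)

theory Defs
  imports
    Complex_Main
    "HOL-Library.Disjoint_Sets"
    "HOL-Library.Poly_Mapping"
    "HOL-Library.Function_Algebras"
    "HOL-Combinatorics.Permutations"
begin

section \<open>Preadditive categories and their envelopes\<close>

text \<open>
  Hom-sets are subsets of one type \<open>'m\<close> and need not be disjoint (all of them share the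
  element \<open>0\<close>), so source and target are passed explicitly: \<open>cat_comp C x y z g f\<close> is the
  composite of \<open>f : x \<rightarrow> y\<close> and \<open>g : y \<rightarrow> z\<close>. The addition of morphisms is that of \<open>'m\<close>.
\<close>

record ('o, 'm) cat =
  cat_ob :: "'o set"
  cat_hom :: "'o \<Rightarrow> 'o \<Rightarrow> 'm set"
  cat_id :: "'o \<Rightarrow> 'm"
  cat_comp :: "'o \<Rightarrow> 'o \<Rightarrow> 'o \<Rightarrow> 'm \<Rightarrow> 'm \<Rightarrow> 'm"

definition isomorphic :: "('o, 'm) cat \<Rightarrow> 'o \<Rightarrow> 'o \<Rightarrow> bool" where
  "isomorphic C x y \<longleftrightarrow>
     (\<exists>f \<in> cat_hom C x y. \<exists>g \<in> cat_hom C y x.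
        cat_comp C x y x g f = cat_id C x \<and> cat_comp C y x y f g = cat_id C y)"

definition iso_class :: "('o, 'm) cat \<Rightarrow> 'o \<Rightarrow> 'o set" where
  "iso_class C x = {y \<in> cat_ob C. isomorphic C x y}"

definition zero_object :: "('o, 'm) cat \<Rightarrow> 'o \<Rightarrow> bool" where
  "zero_object C x \<longleftrightarrow>
     (\<forall>y \<in> cat_ob C. (\<exists>!f. f \<in> cat_hom C x y) \<and> (\<exists>!f. f \<in> cat_hom C y x))"

definition is_direct_sum :: "('o, 'm::comm_monoid_add) cat \<Rightarrow> 'o \<Rightarrow> 'o \<Rightarrow> 'o \<Rightarrow> bool" where
  "is_direct_sum C x y z \<longleftrightarrow>
     (\<exists>i \<in> cat_hom C y x. \<exists>j \<in> cat_hom C z x. \<exists>p \<in> cat_hom C x y. \<exists>q \<in> cat_hom C x z.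
        cat_comp C y x y p i = cat_id C y \<and> cat_comp C z x z q j = cat_id C z \<and>
        cat_comp C z x y p j = 0 \<and> cat_comp C y x z q i = 0 \<and>
        cat_comp C x y x i p + cat_comp C x z x j q = cat_id C x)"

text \<open>With this definition a zero object is indecomposable.\<close>

definition indecomposable :: "('o, 'm::comm_monoid_add) cat \<Rightarrow> 'o \<Rightarrow> bool" where
  "indecomposable C x \<longleftrightarrow>
     (\<forall>y \<in> cat_ob C. \<forall>z \<in> cat_ob C.
        is_direct_sum C x y z \<longrightarrow> zero_object C y \<or> zero_object C z)"

text \<open>
  Objects of the additive envelope are finite sequences of objects, thought of as formal direct
  sums. A morphism \<open>M : xs \<rightarrow> ys\<close> is a matrix whose entry \<open>M i j\<close> is a morphism from the \<open>j\<close>-th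
  summand of \<open>xs\<close> to the \<open>i\<close>-th summand of \<open>ys\<close>. Entries outside the matrix are \<open>0\<close>, so that
  equality of matrices is equality of functions.
\<close>

definition additive_envelope ::
    "('o, 'm::comm_monoid_add) cat \<Rightarrow> ('o list, nat \<Rightarrow> nat \<Rightarrow> 'm) cat" where
  "additive_envelope C = \<lparr>
     cat_ob = lists (cat_ob C),
     cat_hom = (\<lambda>xs ys. {M.
        (\<forall>i < length ys. \<forall>j < length xs. M i j \<in> cat_hom C (xs ! j) (ys ! i)) \<and>
        (\<forall>i j. \<not> (i < length ys \<and> j < length xs) \<longrightarrow> M i j = 0)}),
     cat_id = (\<lambda>xs i j. if i = j \<and> i < length xs then cat_id C (xs ! i) else 0),
     cat_comp = (\<lambda>xs ys zs N M i k.
        if i < length zs \<and> k < length xs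
        then (\<Sum>j < length ys. cat_comp C (xs ! k) (ys ! j) (zs ! i) (N i j) (M j k))
        else 0) \<rparr>"

text \<open>The object \<open>(x, e)\<close> of the Karoubi envelope is the image of the idempotent \<open>e : x \<rightarrow> x\<close>.\<close>

definition karoubi_envelope :: "('o, 'm) cat \<Rightarrow> ('o \<times> 'm, 'm) cat" where
  "karoubi_envelope C = \<lparr>
     cat_ob = {(x, e). x \<in> cat_ob C \<and> e \<in> cat_hom C x x \<and> cat_comp C x x x e e = e},
     cat_hom = (\<lambda>(x, e) (y, f).
        {\<phi> \<in> cat_hom C x y. cat_comp C x x y \<phi> e = \<phi> \<and> cat_comp C x y y f \<phi> = \<phi>}),
     cat_id = (\<lambda>(x, e). e),
     cat_comp = (\<lambda>X Y Z. cat_comp C (fst X) (fst Y) (fst Z)) \<rparr>"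


section \<open>The Brauer category\<close>

text \<open>
  The bottom endpoints of a diagram of type \<open>r \<rightarrow> s\<close> are \<open>Bot 1, \<dots>, Bot r\<close> and its top
  endpoints are \<open>Top 1, \<dots>, Top s\<close>. The points \<open>Mid j\<close> occur only when two diagrams are stacked.
\<close>

datatype point = Bot nat | Mid nat | Top nat

type_synonym diagram = "point set set"

definition brauer_diagrams :: "nat \<Rightarrow> nat \<Rightarrow> diagram set" where
  "brauer_diagrams r s =
     {D. partition_on (Bot ` {1..r} \<union> Top ` {1..s}) D \<and> (\<forall>p \<in> D. card p = 2)}"

fun top_to_mid :: "point \<Rightarrow> point" where
  "top_to_mid (Top i) = Mid i"
| "top_to_mid p = p"

fun bot_to_mid :: "point \<Rightarrow> point" where
  "bot_to_mid (Bot i) = Mid i"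
| "bot_to_mid p = p"

text \<open>The strands obtained by putting \<open>H\<close> on top of \<open>G\<close>, before any of them are joined.\<close>

definition stack :: "diagram \<Rightarrow> diagram \<Rightarrow> point set set" where
  "stack H G = (`) top_to_mid ` G \<union> (`) bot_to_mid ` H"

definition components :: "point set set \<Rightarrow> point set set" where
  "components E = \<Union>E // ({(x, y). \<exists>p \<in> E. x \<in> p \<and> y \<in> p}\<^sup>*)"

definition star :: "diagram \<Rightarrow> diagram \<Rightarrow> diagram" where
  "star H G = (\<lambda>c. c - range Mid) ` components (stack H G) - {{}}"

definition loops :: "diagram \<Rightarrow> diagram \<Rightarrow> nat" where
  "loops H G = card {c \<in> components (stack H G). c \<subseteq> range Mid}"

definition id_diagram :: "nat \<Rightarrow> diagram" where
  "id_diagram r = {{Bot i, Top i} | i. i \<in> {1..r}}"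

definition brauer_comp ::
    "'k::field \<Rightarrow> (diagram \<Rightarrow>\<^sub>0 'k) \<Rightarrow> (diagram \<Rightarrow>\<^sub>0 'k) \<Rightarrow> (diagram \<Rightarrow>\<^sub>0 'k)" where
  "brauer_comp \<delta> h g =
     (\<Sum>H \<in> Poly_Mapping.keys h. \<Sum>G \<in> Poly_Mapping.keys g.
        Poly_Mapping.single (star H G)
          (Poly_Mapping.lookup h H * Poly_Mapping.lookup g G * \<delta> ^ loops H G))"

definition brauer_category :: "'k::field \<Rightarrow> (nat, diagram \<Rightarrow>\<^sub>0 'k) cat" where
  "brauer_category \<delta> = \<lparr>
     cat_ob = UNIV,
     cat_hom = (\<lambda>r s. {f. Poly_Mapping.keys f \<subseteq> brauer_diagrams r s}),
     cat_id = (\<lambda>r. Poly_Mapping.single (id_diagram r) 1),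
     cat_comp = (\<lambda>r s t. brauer_comp \<delta>) \<rparr>"

abbreviation brauer_algebra :: "'k::field \<Rightarrow> nat \<Rightarrow> (diagram \<Rightarrow>\<^sub>0 'k) set" where
  "brauer_algebra \<delta> r \<equiv> cat_hom (brauer_category \<delta>) r r"

definition Rep_O ::
    "'k::field \<Rightarrow> (nat list \<times> (nat \<Rightarrow> nat \<Rightarrow> (diagram \<Rightarrow>\<^sub>0 'k)),
                    nat \<Rightarrow> nat \<Rightarrow> (diagram \<Rightarrow>\<^sub>0 'k)) cat" where
  "Rep_O \<delta> = karoubi_envelope (additive_envelope (brauer_category \<delta>))"

text \<open>The object \<open>im e\<close> for an idempotent \<open>e\<close> in the Brauer algebra on \<open>r\<close> strands: \<open>e\<close> becomes a
  1-by-1 matrix.\<close>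

definition im_obj ::
    "nat \<Rightarrow> (diagram \<Rightarrow>\<^sub>0 'k::zero) \<Rightarrow> nat list \<times> (nat \<Rightarrow> nat \<Rightarrow> (diagram \<Rightarrow>\<^sub>0 'k))" where
  "im_obj r e = ([r], \<lambda>i j. if i = 0 \<and> j = 0 then e else 0)"


section \<open>Idempotents\<close>

text \<open>In the next two definitions \<open>A\<close> is the carrier and \<open>m\<close> the multiplication of an algebra.\<close>

definition primitive_idempotent ::
    "('a::comm_monoid_add \<Rightarrow> 'a \<Rightarrow> 'a) \<Rightarrow> 'a set \<Rightarrow> 'a \<Rightarrow> bool" where
  "primitive_idempotent m A e \<longleftrightarrow>
     e \<in> A \<and> m e e = e \<and> e \<noteq> 0 \<and>
     \<not> (\<exists>a \<in> A. \<exists>b \<in> A. a \<noteq> 0 \<and> b \<noteq> 0 \<and> m a a = a \<and> m b b = b \<and>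
          m a b = 0 \<and> m b a = 0 \<and> e = a + b)"

text \<open>Isomorphism of the left modules \<open>A x\<close> and \<open>A y\<close>. Scalars act through \<open>A\<close>.\<close>

definition left_ideals_isomorphic ::
    "('a::comm_monoid_add \<Rightarrow> 'a \<Rightarrow> 'a) \<Rightarrow> 'a set \<Rightarrow> 'a \<Rightarrow> 'a \<Rightarrow> bool" where
  "left_ideals_isomorphic m A x y \<longleftrightarrow>
     (\<exists>\<phi>. bij_betw \<phi> ((\<lambda>a. m a x) ` A) ((\<lambda>a. m a y) ` A) \<and>
          (\<forall>u \<in> (\<lambda>a. m a x) ` A. \<forall>v \<in> (\<lambda>a. m a x) ` A. \<phi> (u + v) = \<phi> u + \<phi> v) \<and>
          (\<forall>b \<in> A. \<forall>u \<in> (\<lambda>a. m a x) ` A. \<phi> (m b u) = m b (\<phi> u)))"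

definition perm_diagrams :: "nat \<Rightarrow> diagram set" where
  "perm_diagrams r = {D \<in> brauer_diagrams r r. \<forall>p \<in> D. \<exists>i j. p = {Bot i, Top j}}"

definition sym_group_algebra :: "nat \<Rightarrow> (diagram \<Rightarrow>\<^sub>0 'k::zero) set" where
  "sym_group_algebra r = {a. Poly_Mapping.keys a \<subseteq> perm_diagrams r}"

definition sym_proj :: "nat \<Rightarrow> (diagram \<Rightarrow>\<^sub>0 'k::comm_monoid_add) \<Rightarrow> (diagram \<Rightarrow>\<^sub>0 'k)" where
  "sym_proj r a =
     (\<Sum>D \<in> Poly_Mapping.keys a \<inter> perm_diagrams r.
        Poly_Mapping.single D (Poly_Mapping.lookup a D))"

definition perm_diagram :: "nat \<Rightarrow> (nat \<Rightarrow> nat) \<Rightarrow> diagram" where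
  "perm_diagram r \<sigma> = {{Bot i, Top (\<sigma> i)} | i. i \<in> {1..r}}"

definition is_partition :: "nat list \<Rightarrow> bool" where
  "is_partition \<mu> \<longleftrightarrow> sorted_wrt (\<ge>) \<mu> \<and> (\<forall>n \<in> set \<mu>. 0 < n)"

text \<open>
  Entries of the tableau of shape \<open>\<mu>\<close> filled with \<open>1, \<dots>, |\<mu>|\<close> row by row; rows \<open>i\<close> and columns
  \<open>j\<close> are numbered from \<open>0\<close>.
\<close>

definition tableau_entry :: "nat list \<Rightarrow> nat \<Rightarrow> nat \<Rightarrow> nat" where
  "tableau_entry \<mu> i j = sum_list (take i \<mu>) + j + 1"

definition tableau_row :: "nat list \<Rightarrow> nat \<Rightarrow> nat set" where
  "tableau_row \<mu> i = {tableau_entry \<mu> i j | j. i < length \<mu> \<and> j < \<mu> ! i}"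

definition tableau_col :: "nat list \<Rightarrow> nat \<Rightarrow> nat set" where
  "tableau_col \<mu> j = {tableau_entry \<mu> i j | i. i < length \<mu> \<and> j < \<mu> ! i}"

text \<open>
  The row symmetrizer times the column antisymmetrizer. It generates the Specht module of \<open>\<mu>\<close> as
  a left ideal of the group algebra. For \<open>\<mu> = [r]\<close> this is the trivial representation.
\<close>

definition young_symmetrizer :: "'k::field \<Rightarrow> nat list \<Rightarrow> (diagram \<Rightarrow>\<^sub>0 'k)" where
  "young_symmetrizer \<delta> \<mu> =
     (let r = sum_list \<mu> in
      brauer_comp \<delta>
        (\<Sum>\<sigma> | \<sigma> permutes {1..r} \<and> (\<forall>i. \<sigma> ` tableau_row \<mu> i = tableau_row \<mu> i).
           Poly_Mapping.single (perm_diagram r \<sigma>) 1)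
        (\<Sum>\<tau> | \<tau> permutes {1..r} \<and> (\<forall>j. \<tau> ` tableau_col \<mu> j = tableau_col \<mu> j).
           Poly_Mapping.single (perm_diagram r \<tau>) (of_int (sign \<tau>))))"

text \<open>
  The possible choices of \<open>z\<^sub>\<mu>\<close>: primitive idempotents of the group algebra whose left ideal is the
  Specht module of \<open>\<mu>\<close>. The parameter \<open>\<delta>\<close> enters only through the ambient Brauer algebra, since
  stacking permutation diagrams produces no loops.
\<close>

definition is_z :: "'k::field \<Rightarrow> nat list \<Rightarrow> (diagram \<Rightarrow>\<^sub>0 'k) \<Rightarrow> bool" where
  "is_z \<delta> \<mu> z \<longleftrightarrow>
     primitive_idempotent (brauer_comp \<delta>) (sym_group_algebra (sum_list \<mu>)) z \<and>
     left_ideals_isomorphic (brauer_comp \<delta>) (sym_group_algebra (sum_list \<mu>))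
       z (young_symmetrizer \<delta> \<mu>)"

text \<open>
  The possible choices of \<open>e\<^sub>\<mu>\<close>: the summand that survives under the projection to the group
  algebra, in some orthogonal decomposition of some \<open>z\<^sub>\<mu>\<close>.
\<close>

definition is_e :: "'k::field \<Rightarrow> nat list \<Rightarrow> (diagram \<Rightarrow>\<^sub>0 'k) \<Rightarrow> bool" where
  "is_e \<delta> \<mu> e \<longleftrightarrow>
     (\<exists>z es i. is_z \<delta> \<mu> z \<and>
        (\<forall>a \<in> set es.
           primitive_idempotent (brauer_comp \<delta>) (brauer_algebra \<delta> (sum_list \<mu>)) a) \<and>
        (\<forall>j < length es. \<forall>k < length es.
           j \<noteq> k \<longrightarrow> brauer_comp \<delta> (es ! j) (es ! k) = 0) \<and>
        sum_list es = z \<and>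
        i < length es \<and> (\<forall>j < length es. sym_proj (sum_list \<mu>) (es ! j) \<noteq> 0 \<longleftrightarrow> j = i) \<and>
        e = es ! i)"

text \<open>
  \<open>R(\<mu>)\<close> is defined up to isomorphism, so it is represented by the set of all objects isomorphic
  to \<open>im e\<^sub>\<mu>\<close>, for any choice of \<open>e\<^sub>\<mu>\<close>. That this is a single isomorphism class
  is equivalent to \<open>R(\<mu>)\<close> being well defined.
\<close>

definition R_class ::
    "'k::field \<Rightarrow> nat list \<Rightarrow> (nat list \<times> (nat \<Rightarrow> nat \<Rightarrow> (diagram \<Rightarrow>\<^sub>0 'k))) set" where
  "R_class \<delta> \<mu> = (\<Union>e \<in> {e. is_e \<delta> \<mu> e}. iso_class (Rep_O \<delta>) (im_obj (sum_list \<mu>) e))"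

end

theory Submission
  imports Defs "HOL-Combinatorics.Orbits"
begin

text \<open>
  Endomorphism algebras in \<open>Rep_O \<delta>\<close> are finite-dimensional, so by Fitting's lemma every element of
  the corner of a primitive idempotent is nilpotent or invertible in that corner. Hence, when a
  primitive idempotent is a sum of composites \<open>v\<^sub>i u\<^sub>i\<close> through objects \<open>y\<^sub>i\<close>, its image is a direct
  summand of some \<open>y\<^sub>i\<close>. This turns an indecomposable object first into the image of a primitive
  \<open>e\<close> in some Brauer algebra, and then into one that survives under the projection to the group
  algebra, since a diagram that is not a permutation factors through a smaller object without
  creating loops. A surviving \<open>e\<close> is determined up to isomorphism by its projection: a composite in
  its corner whose projection is a nonzero idempotent cannot be nilpotent.

  It remains to classify the primitive idempotents of the group algebra of the symmetric group over
  an arbitrary field of characteristic zero. Young symmetrizers of different shapes are orthogonal by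
  the dominance order, and each has a one-dimensional corner. They suffice because their averages
  over conjugation are independent elements of the centre, whose dimension is at most the number of
  cycle types. The argument takes place over the rationals, where positivity of sums of squares
  shows that the relevant products do not vanish.
\<close>

section \<open>Corners of primitive idempotents\<close>

text \<open>The parameter \<delta> may be zero, so a cup and a cap cannot be normalised to an
  idempotent by dividing by the value of a loop. This is why diagrams are factored without loops and
  why locality of endomorphism rings drives the reduction. What Fitting's lemma takes from finite
  dimension is that some power \<open>x^k\<close> equals \<open>x^(k+1)\<close> times an element
  commuting with x. The number r of strands on which a class survives is an invariant because a
  composite through fewer strands projects to zero; for fixed r the projection turns isomorphisms
  into equivalences of idempotents. Together this gives injectivity. The last of them says that
  Young symmetrizers generate the group algebra as an ideal, and it stands in for complete
  reducibility. Algebras are carrier sets with explicit operations because all Hom-sets lie in one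
  type and have different units.\<close>

locale carrier_algebra =
  fixes A :: "'a::ab_group_add set" and mul :: "'a \<Rightarrow> 'a \<Rightarrow> 'a" (infixl "\<odot>" 70) and one :: 'a
  assumes zero_in: "0 \<in> A"
    and add_in: "x \<in> A \<Longrightarrow> y \<in> A \<Longrightarrow> x + y \<in> A"
    and uminus_in: "x \<in> A \<Longrightarrow> - x \<in> A"
    and mul_in: "x \<in> A \<Longrightarrow> y \<in> A \<Longrightarrow> x \<odot> y \<in> A"
    and one_in: "one \<in> A"
    and mul_assoc: "x \<in> A \<Longrightarrow> y \<in> A \<Longrightarrow> z \<in> A \<Longrightarrow> x \<odot> y \<odot> z = x \<odot> (y \<odot> z)"
    and one_mul: "x \<in> A \<Longrightarrow> one \<odot> x = x"
    and mul_one: "x \<in> A \<Longrightarrow> x \<odot> one = x"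
    and distrib_left: "x \<in> A \<Longrightarrow> y \<in> A \<Longrightarrow> z \<in> A \<Longrightarrow> x \<odot> (y + z) = x \<odot> y + x \<odot> z"
    and distrib_right: "x \<in> A \<Longrightarrow> y \<in> A \<Longrightarrow> z \<in> A \<Longrightarrow> (x + y) \<odot> z = x \<odot> z + y \<odot> z"
begin

lemma minus_in: "x \<in> A \<Longrightarrow> y \<in> A \<Longrightarrow> x - y \<in> A"
  using add_in uminus_in by (metis diff_conv_add_uminus)

lemma zero_mul: "x \<in> A \<Longrightarrow> 0 \<odot> x = 0"
  using distrib_right[of 0 0 x] zero_in by simp

lemma mul_zero: "x \<in> A \<Longrightarrow> x \<odot> 0 = 0"
  using distrib_left[of x 0 0] zero_in by simp

lemma uminus_mul: "x \<in> A \<Longrightarrow> y \<in> A \<Longrightarrow> (- x) \<odot> y = - (x \<odot> y)"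
  using distrib_right[of x "- x" y] zero_mul uminus_in by (metis add.right_inverse minus_unique)

lemma mul_uminus: "x \<in> A \<Longrightarrow> y \<in> A \<Longrightarrow> x \<odot> (- y) = - (x \<odot> y)"
  using distrib_left[of x y "- y"] mul_zero uminus_in by (metis add.right_inverse minus_unique)

lemma mul_diff: "x \<in> A \<Longrightarrow> y \<in> A \<Longrightarrow> z \<in> A \<Longrightarrow> x \<odot> (y - z) = x \<odot> y - x \<odot> z"
  using distrib_left[of x y "- z"] mul_uminus uminus_in by simp

lemma diff_mul: "x \<in> A \<Longrightarrow> y \<in> A \<Longrightarrow> z \<in> A \<Longrightarrow> (x - y) \<odot> z = x \<odot> z - y \<odot> z"
  using distrib_right[of x "- y" z] uminus_mul uminus_in by simp

lemma sum_in: "(\<And>i. i \<in> I \<Longrightarrow> f i \<in> A) \<Longrightarrow> sum f I \<in> A"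
  by (induction I rule: infinite_finite_induct) (auto simp: zero_in add_in)

lemma sum_mul: "(\<And>i. i \<in> I \<Longrightarrow> f i \<in> A) \<Longrightarrow> x \<in> A \<Longrightarrow> sum f I \<odot> x = (\<Sum>i\<in>I. f i \<odot> x)"
  by (induction I rule: infinite_finite_induct) (auto simp: zero_mul distrib_right sum_in)

lemma mul_sum: "(\<And>i. i \<in> I \<Longrightarrow> f i \<in> A) \<Longrightarrow> x \<in> A \<Longrightarrow> x \<odot> sum f I = (\<Sum>i\<in>I. x \<odot> f i)"
  by (induction I rule: infinite_finite_induct) (auto simp: mul_zero distrib_left sum_in)

primrec pw :: "'a \<Rightarrow> nat \<Rightarrow> 'a" where
  "pw x 0 = one"
| "pw x (Suc n) = x \<odot> pw x n"

lemma pw_in: "x \<in> A \<Longrightarrow> pw x n \<in> A"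
  by (induction n) (auto simp: one_in mul_in)

lemma pw_add: "x \<in> A \<Longrightarrow> pw x (m + n) = pw x m \<odot> pw x n"
  by (induction m) (auto simp: one_mul pw_in mul_assoc)

lemma pw_comm: "x \<in> A \<Longrightarrow> y \<in> A \<Longrightarrow> x \<odot> y = y \<odot> x \<Longrightarrow> pw x n \<odot> y = y \<odot> pw x n"
proof (induction n)
  case (Suc n)
  have "x \<odot> pw x n \<odot> y = x \<odot> (y \<odot> pw x n)"
    using Suc by (simp add: mul_assoc pw_in)
  also have "\<dots> = y \<odot> (x \<odot> pw x n)"
    using Suc by (metis mul_assoc pw_in)
  finally show ?case by simp
qed (simp add: one_mul mul_one)

text \<open>Since x and y commute the order is a matter of choice; putting the power of y first is
  what the idempotent of Fitting's lemma needs.\<close>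

lemma pw_mul:
  assumes "x \<in> A" "y \<in> A" "x \<odot> y = y \<odot> x"
  shows "pw (x \<odot> y) n = pw y n \<odot> pw x n"
proof (induction n)
  case (Suc n)
  have "pw (x \<odot> y) (Suc n) = y \<odot> (x \<odot> (pw y n \<odot> pw x n))"
    using Suc assms by (simp add: mul_assoc mul_in pw_in)
  also have "\<dots> = y \<odot> (x \<odot> pw y n \<odot> pw x n)"
    using assms by (simp add: mul_assoc pw_in)
  also have "\<dots> = y \<odot> (pw y n \<odot> x \<odot> pw x n)"
    using pw_comm[of y x n] assms by simp
  also have "\<dots> = pw y (Suc n) \<odot> pw x (Suc n)"
    using assms by (simp add: mul_assoc pw_in mul_in)
  finally show ?case .
qed (simp add: one_in one_mul)

lemma primitive_in:
  assumes "primitive_idempotent (\<odot>) A e" shows "e \<in> A" "e \<odot> e = e" "e \<noteq> 0"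
  using assms by (auto simp: primitive_idempotent_def)

text \<open>Otherwise e = f + (e - f) would split e into two nonzero orthogonal idempotents.\<close>

lemma primitive_subidempotent:
  assumes "primitive_idempotent (\<odot>) A e" "f \<in> A" "f \<odot> f = f" "e \<odot> f = f" "f \<odot> e = f" "f \<noteq> 0"
  shows "f = e"
proof (rule ccontr)
  assume ne: "f \<noteq> e"
  note e = primitive_in[OF assms(1)]
  have "(e - f) \<odot> (e - f) = e - f" "f \<odot> (e - f) = 0" "(e - f) \<odot> f = 0"
    using assms e by (auto simp: mul_diff diff_mul minus_in)
  moreover have "e - f \<in> A" "e - f \<noteq> 0" "e = f + (e - f)"
    using e assms ne by (auto simp: minus_in)
  ultimately show False
    using assms unfolding primitive_idempotent_def by blast
qed

text \<open>With c = x w one has \<open>x^K c = x^K\<close>, so \<open>c^K\<close> is the idempotent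
  projecting onto the part where x is invertible. It lies under e, hence is 0 or e by primitivity;
  the first case makes x nilpotent, the second inverts x.\<close>

lemma fitting_dichotomy:
  assumes prim: "primitive_idempotent (\<odot>) A e" and x: "x \<in> A" "e \<odot> x = x" "x \<odot> e = x"
    and w: "w \<in> A" "x \<odot> w = w \<odot> x" "pw x k = pw x (Suc k) \<odot> w"
  shows "(\<exists>n. pw x n = 0) \<or> (\<exists>y\<in>A. e \<odot> y = y \<and> y \<odot> e = y \<and> x \<odot> y = e \<and> y \<odot> x = e)"
proof -
  note e = primitive_in[OF prim]
  define c where "c = x \<odot> w"
  \<comment> \<open>One more than k, so that even for k = 0 the idempotent \<open>f\<close> carries
    a factor x on each side and therefore lies in the corner of e.\<close>
  define K where "K = Suc k"
  have cA: "c \<in> A" using x w by (simp add: c_def mul_in)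
  have xc: "x \<odot> c = c \<odot> x" using x w by (metis c_def mul_assoc)
  have "pw x k \<odot> c = pw x k"
  proof -
    have "pw x k \<odot> c = pw x k \<odot> x \<odot> w" using x w by (simp add: c_def mul_assoc pw_in)
    also have "\<dots> = pw x (Suc k) \<odot> w" using pw_comm[OF x(1) x(1)] by simp
    finally show ?thesis using w(3) by (metis (no_types))
  qed
  then have xK1: "pw x K \<odot> c = pw x K"
    using x cA by (simp add: K_def mul_assoc pw_in)
  have xK: "pw x K \<odot> pw c n = pw x K" for n
  proof (induction n)
    case (Suc n)
    then show ?case using xK1 x cA by (metis mul_assoc pw.simps(2) pw_in)
  qed (simp add: mul_one pw_in x)
  define f where "f = pw c K"
  have fA: "f \<in> A" using cA by (simp add: f_def pw_in)
  have f_eq: "f = pw w K \<odot> pw x K"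
    unfolding f_def c_def using pw_mul x w by simp
  \<comment> \<open>Here \<open>f f = w^K (x^K c^K) = w^K x^K\<close>.\<close>
  have ff: "f \<odot> f = f"
    using f_eq xK[of K] x w by (metis f_def mul_assoc pw_in fA)
  have f1: "f = x \<odot> (w \<odot> pw c k)"
    using x(1) w(1) cA mul_assoc[of x w "pw c k"] by (simp add: f_def K_def c_def pw_in)
  have f2: "f = w \<odot> pw c k \<odot> x"
    using f1 x w cA by (metis c_def mul_assoc pw_comm pw_in xc)
  have ef: "e \<odot> f = f" using f1 x e w cA by (metis mul_assoc mul_in pw_in)
  have fe: "f \<odot> e = f" using f2 x e w cA by (metis mul_assoc mul_in pw_in)
  show ?thesis
  proof (cases "f = 0")
    case True
    then have "pw x K = 0" using xK[of K] x by (simp add: f_def mul_zero pw_in)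
    then show ?thesis by blast
  next
    case False
    then have fe': "f = e" using primitive_subidempotent[OF prim fA ff ef fe] by simp
    \<comment> \<open>Once \<open>f = e\<close>, the element \<open>w c^k\<close> inverts x on both
      sides; compressing it by e puts it into the corner.\<close>
    define y where "y = e \<odot> (w \<odot> pw c k) \<odot> e"
    have gA: "w \<odot> pw c k \<in> A" using w cA by (simp add: mul_in pw_in)
    have yA: "y \<in> A" using gA e by (simp add: y_def mul_in)
    have "e \<odot> y = y" "y \<odot> e = y" using e gA by (simp_all add: y_def mul_in mul_assoc)
       (metis e(1,2) gA mul_assoc mul_in)
    moreover have "x \<odot> y = e"
    proof -
      have "x \<odot> y = x \<odot> e \<odot> (w \<odot> pw c k) \<odot> e"
        using e gA x by (metis (no_types) y_def mul_assoc mul_in)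
      also have "\<dots> = e" using x f1 fe' e by simp
      finally show ?thesis .
    qed
    moreover have "y \<odot> x = e"
    proof -
      have "y \<odot> x = e \<odot> (w \<odot> pw c k \<odot> (e \<odot> x))"
        using e gA x by (simp add: y_def mul_assoc mul_in)
      also have "\<dots> = e" using x f2 fe' e by simp
      finally show ?thesis .
    qed
    ultimately show ?thesis using yA by blast
  qed
qed

text \<open>The inverse is the geometric series in x, which stops because x is nilpotent; e is the
  unit of the corner.\<close>

lemma nilpotent_complement_invertible:
  assumes e: "e \<in> A" "e \<odot> e = e" and x: "x \<in> A" "e \<odot> x = x" "x \<odot> e = x" and nil: "pw x n = 0"
  shows "\<exists>y\<in>A. e \<odot> y = y \<and> y \<odot> e = y \<and> (e - x) \<odot> y = e \<and> y \<odot> (e - x) = e"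
proof -
  \<comment> \<open>The witnesses are partial sums of the series. Each power is multiplied by e
    because the zeroth power is the unit of A, not of the corner.\<close>
  have "\<exists>y\<in>A. e \<odot> y = y \<and> y \<odot> e = y \<and> (e - x) \<odot> y = e - e \<odot> pw x m \<and> y \<odot> (e - x) = e - e \<odot> pw x m" for m
  proof (induction m)
    case 0
    show ?case using e x by (intro bexI[of _ 0]) (auto simp: zero_in zero_mul mul_zero mul_one minus_in)
  next
    case (Suc m)
    then obtain y where y: "y \<in> A" "e \<odot> y = y" "y \<odot> e = y" "(e - x) \<odot> y = e - e \<odot> pw x m"
      "y \<odot> (e - x) = e - e \<odot> pw x m" by blast
    have p: "pw x m \<in> A" using x by (simp add: pw_in)
    have pe: "pw x m \<odot> e = e \<odot> pw x m" using pw_comm[of x e m] x e by simp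
    have px: "pw x m \<odot> x = x \<odot> pw x m" using pw_comm[of x x m] x by simp
    let ?q = "e \<odot> pw x m"
    have q: "?q \<in> A" "e \<odot> ?q = ?q" "?q \<odot> e = ?q"
      using p e pe mul_in[OF e(1) p] by (auto simp: mul_assoc) (metis e p mul_assoc)+
    have xq: "x \<odot> ?q = x \<odot> pw x m" using x e p by (metis mul_assoc)
    have qx: "?q \<odot> x = x \<odot> pw x m"
      using x e p px by (metis mul_assoc)
    have eS: "e \<odot> (x \<odot> pw x m) = x \<odot> pw x m" using x e p by (metis mul_assoc)
    have "y + ?q \<in> A" "e \<odot> (y + ?q) = y + ?q" "(y + ?q) \<odot> e = y + ?q"
      using y q e by (auto simp: distrib_left distrib_right add_in)
    moreover have "(e - x) \<odot> (y + ?q) = (e - x) \<odot> y + (?q - x \<odot> pw x m)"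
      using y q e x xq by (simp add: distrib_left minus_in diff_mul[of e x ?q])
    moreover have "(y + ?q) \<odot> (e - x) = y \<odot> (e - x) + (?q - x \<odot> pw x m)"
      using y q e x qx by (simp add: distrib_right minus_in mul_diff[of ?q e x])
    ultimately show ?case
      using y(4,5) eS by (intro bexI[of _ "y + ?q"]) simp_all
  qed
  from this[of n] show ?thesis using nil e by (simp add: mul_zero)
qed

end

text \<open>Strong pi-regularity: the descending chain of multiples of powers of x becomes
  stationary, with a commuting witness. It isolates what the corner arguments take from finite
  dimension.\<close>

locale fitting_algebra = carrier_algebra +
  assumes strongly_pi_regular: "x \<in> A \<Longrightarrow> \<exists>k. \<exists>w\<in>A. x \<odot> w = w \<odot> x \<and> pw x k = pw x (Suc k) \<odot> w"
begin

lemma corner_nilpotent_or_invertible: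
  assumes "primitive_idempotent (\<odot>) A e" "x \<in> A" "e \<odot> x = x" "x \<odot> e = x"
  obtains (nilpotent) n where "pw x n = 0"
  | (invertible) y where "y \<in> A" "e \<odot> y = y" "y \<odot> e = y" "x \<odot> y = e" "y \<odot> x = e"
proof -
  obtain k w where "w \<in> A" "x \<odot> w = w \<odot> x" "pw x k = pw x (Suc k) \<odot> w"
    using strongly_pi_regular[OF assms(2)] by blast
  from fitting_dichotomy[OF assms this] show thesis using that by blast
qed

text \<open>The corner is a local ring: its non-units are nilpotent, and a sum of non-units cannot
  be a unit.\<close>

lemma sum_has_invertible:
  assumes prim: "primitive_idempotent (\<odot>) A e"
    and "finite I" "\<And>i. i \<in> I \<Longrightarrow> a i \<in> A \<and> e \<odot> a i = a i \<and> a i \<odot> e = a i"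
    and "sum a I = e"
  shows "\<exists>i\<in>I. \<exists>y\<in>A. e \<odot> y = y \<and> y \<odot> e = y \<and> a i \<odot> y = e \<and> y \<odot> a i = e"
proof -
  note e = primitive_in[OF prim]
  let ?inv = "\<lambda>x. \<exists>y\<in>A. e \<odot> y = y \<and> y \<odot> e = y \<and> x \<odot> y = e \<and> y \<odot> x = e"
  \<comment> \<open>The induction needs a unit as the sum rather than e itself, since after removal
    of one summand the rest, multiplied by y, is only known to be a unit.\<close>
  have "?inv (sum a I) \<Longrightarrow> \<exists>i\<in>I. ?inv (a i)"
    using assms(2,3)
  proof (induction I arbitrary: a rule: finite_induct)
    case empty
    then show ?case using e zero_mul by auto
  next
    case (insert j I)
    obtain y where y: "y \<in> A" "e \<odot> y = y" "y \<odot> e = y" "(a j + sum a I) \<odot> y = e" "y \<odot> (a j + sum a I) = e"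
      using insert by auto
    let ?x = "y \<odot> a j"
    have aj: "a j \<in> A" "e \<odot> a j = a j" "a j \<odot> e = a j" using insert(5) by auto
    have x: "?x \<in> A" "e \<odot> ?x = ?x" "?x \<odot> e = ?x"
      using y aj e by (auto simp: mul_in mul_assoc) (metis mul_assoc)
    \<comment> \<open>If y times a summand is a unit with inverse g, then the summand times g is the
      whole sum, of which y is the inverse; so g y inverts the summand on both sides.\<close>
    have inv_of: "?inv (a i)" if i: "i \<in> insert j I" and g: "g \<in> A" "e \<odot> g = g" "g \<odot> e = g" "g \<odot> (y \<odot> a i) = e" "y \<odot> a i \<odot> g = e" for i g
    proof -
      have ai: "a i \<in> A" "e \<odot> a i = a i" "a i \<odot> e = a i" using insert(5) i by auto
      let ?s = "a j + sum a I"
      have s: "?s \<in> A" "?s \<odot> e = ?s" "e \<odot> ?s = ?s"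
        using insert(5) e by (auto intro!: add_in sum_in simp: distrib_left distrib_right sum_in mul_sum sum_mul)
      have gy: "g \<odot> y \<in> A" "e \<odot> (g \<odot> y) = g \<odot> y" "g \<odot> y \<odot> e = g \<odot> y"
        using g y e by (simp_all add: mul_in mul_assoc) (metis mul_assoc e(1))
      have 1: "g \<odot> y \<odot> a i = e" using g y ai by (simp add: mul_assoc)
      have "a i \<odot> g = e \<odot> (a i \<odot> g)" using ai g e by (metis mul_assoc)
      also have "\<dots> = ?s \<odot> (y \<odot> (a i \<odot> g))" using y(4) s ai g y by (metis mul_assoc mul_in)
      also have "\<dots> = ?s" using g(5) s y ai g by (metis mul_assoc)
      finally have "a i \<odot> g = ?s" .
      then have "a i \<odot> (g \<odot> y) = e" using y ai g by (metis mul_assoc)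
      with 1 gy show ?thesis by blast
    qed
    show ?case
    proof (cases rule: corner_nilpotent_or_invertible[OF prim x])
      case (2 g)
      then show ?thesis using inv_of[of j g] by auto
    next
      case (1 n)
      \<comment> \<open>As y inverts the whole sum, the remaining terms add up to e minus a
        nilpotent element, again a unit.\<close>
      have rest: "e - ?x = (\<Sum>i\<in>I. y \<odot> a i)"
      proof -
        have "e = ?x + y \<odot> sum a I" using y aj insert(5) by (metis distrib_left insertCI sum_in)
        then show ?thesis using y insert(5) by (simp add: mul_sum algebra_simps)
      qed
      have "?inv (\<Sum>i\<in>I. y \<odot> a i)"
        using nilpotent_complement_invertible[OF e(1,2) x 1] rest by simp
      moreover have "y \<odot> a i \<in> A \<and> e \<odot> (y \<odot> a i) = y \<odot> a i \<and> y \<odot> a i \<odot> e = y \<odot> a i" if "i \<in> I" for i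
        using that insert(5)[of i] y e by (auto simp: mul_in mul_assoc) (metis mul_assoc)
      ultimately obtain i where i: "i \<in> I" "?inv (y \<odot> a i)"
        using insert(3)[of "\<lambda>i. y \<odot> a i"] by blast
      then show ?thesis using inv_of[of i] by blast
    qed
  qed
  then show ?thesis using assms(4) e by auto
qed

end

section \<open>Finite-dimensional algebras\<close>

locale fd_algebra = carrier_algebra A mul one + vector_space scale
  for A :: "'a::ab_group_add set" and mul (infixl "\<odot>" 70) and one
    and scale :: "'k::field \<Rightarrow> 'a \<Rightarrow> 'a" (infixr "*s" 75) +
  fixes B
  assumes scale_in: "x \<in> A \<Longrightarrow> c *s x \<in> A"
    and mul_scale: "x \<in> A \<Longrightarrow> y \<in> A \<Longrightarrow> x \<odot> (c *s y) = c *s (x \<odot> y)"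
    and scale_mul: "x \<in> A \<Longrightarrow> y \<in> A \<Longrightarrow> (c *s x) \<odot> y = c *s (x \<odot> y)"
    and finite_B: "finite B" and A_span: "A \<subseteq> span B"
begin

text \<open>There is one index more than the spanning set has elements. A repetition in the family
  is handled separately, because dependence of a set does not see it: coefficients 1 and -1 then
  give the relation.\<close>

lemma family_dependent:
  assumes "\<And>n. n \<le> card B \<Longrightarrow> f n \<in> A"
  obtains c where "\<exists>n\<le>card B. c n \<noteq> 0" "(\<Sum>n\<le>card B. c n *s f n) = 0"
proof (cases "inj_on f {..card B}")
  case True
  have "dependent (f ` {..card B})"
  proof (rule ccontr)
    assume "independent (f ` {..card B})"
    then have "card (f ` {..card B}) \<le> card B"
      using independent_span_bound[OF finite_B] assms A_span by blast
    then show False using card_image[OF True] by simp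
  qed
  then obtain u where u: "\<exists>v\<in>f ` {..card B}. u v \<noteq> 0" "(\<Sum>v\<in>f ` {..card B}. u v *s v) = 0"
    by (auto simp: dependent_finite)
  show thesis
    by (rule that[of "\<lambda>n. u (f n)"]) (use u in \<open>auto simp: sum.reindex[OF True]\<close>)
next
  case False
  then obtain i j where ij: "i \<le> card B" "j \<le> card B" "i \<noteq> j" "f i = f j"
    by (auto simp: inj_on_def)
  define c where "c n = (if n = i then 1 else if n = j then -1 else 0 :: 'k)" for n
  have "(\<Sum>n\<le>card B. c n *s f n) = (\<Sum>n\<in>{i,j}. c n *s f n)"
    using ij by (intro sum.mono_neutral_right) (auto simp: c_def)
  also have "\<dots> = 0" using ij by (simp add: c_def)
  finally have "(\<Sum>n\<le>card B. c n *s f n) = 0" .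
  moreover have "c i \<noteq> 0" by (simp add: c_def)
  ultimately show thesis using that[of c] ij(1) by blast
qed

text \<open>The powers of x satisfy a nontrivial linear relation. Its term of lowest degree k can be
  solved for, which writes \<open>x^k\<close> as \<open>x^(k+1)\<close> times a polynomial in
  x.\<close>

lemma strongly_pi_regular_fd:
  assumes x: "x \<in> A"
  shows "\<exists>k. \<exists>w\<in>A. x \<odot> w = w \<odot> x \<and> pw x k = pw x (Suc k) \<odot> w"
proof -
  let ?N = "card B"
  obtain c where c: "\<exists>n\<le>?N. c n \<noteq> 0" "(\<Sum>n\<le>?N. c n *s pw x n) = 0"
    using family_dependent[of "pw x"] pw_in[OF x] by blast
  define k where "k = (LEAST n. n \<le> ?N \<and> c n \<noteq> 0)"
  have k: "k \<le> ?N" "c k \<noteq> 0" using LeastI_ex[OF c(1)] by (auto simp: k_def)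
  have below: "c n = 0" if "n < k" for n
    using that not_less_Least[of n "\<lambda>n. n \<le> ?N \<and> c n \<noteq> 0"] k(1) by (auto simp: k_def)
  have "0 = (\<Sum>n\<in>{k..?N}. c n *s pw x n)"
    unfolding c(2)[symmetric] by (rule sum.mono_neutral_right) (auto simp: below)
  also have "\<dots> = c k *s pw x k + (\<Sum>n\<in>{Suc k..?N}. c n *s pw x n)"
    using k(1) by (simp add: sum.atLeast_Suc_atMost)
  finally have eq: "c k *s pw x k = - (\<Sum>n\<in>{Suc k..?N}. c n *s pw x n)"
    by (simp add: eq_neg_iff_add_eq_0)
  define s where "s = (\<Sum>n\<in>{Suc k..?N}. c n *s pw x (n - Suc k))"
  have sA: "s \<in> A" unfolding s_def by (intro sum_in scale_in pw_in x)
  have xs: "pw x (Suc k) \<odot> s = (\<Sum>n\<in>{Suc k..?N}. c n *s pw x n)"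
  proof -
    have "pw x (Suc k) \<odot> (c n *s pw x (n - Suc k)) = c n *s pw x n" if "n \<in> {Suc k..?N}" for n
      using that x pw_add[OF x, of "Suc k" "n - Suc k"] by (simp add: mul_scale pw_in mul_in)
    then show ?thesis
      unfolding s_def using x by (subst mul_sum) (auto simp: scale_in pw_in mul_in)
  qed
  have comm: "x \<odot> s = s \<odot> x"
  proof -
    have "x \<odot> (c n *s pw x m) = (c n *s pw x m) \<odot> x" for n m
      using x pw_comm[OF x x, of m] by (simp add: mul_scale scale_mul pw_in)
    then show ?thesis
      unfolding s_def using x by (subst mul_sum, auto simp: scale_in pw_in, subst sum_mul) (auto simp: scale_in pw_in)
  qed
  define w where "w = (- inverse (c k)) *s s"
  have "pw x k = inverse (c k) *s (c k *s pw x k)" using k by simp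
  also have "\<dots> = (- inverse (c k)) *s (pw x (Suc k) \<odot> s)" unfolding eq xs by simp
  also have "\<dots> = pw x (Suc k) \<odot> w" unfolding w_def by (rule mul_scale[symmetric]) (use x sA in \<open>auto simp: pw_in mul_in\<close>)
  finally have "pw x k = pw x (Suc k) \<odot> w" .
  moreover have "w \<in> A" "x \<odot> w = w \<odot> x"
    unfolding w_def using sA comm x by (blast intro: scale_in, simp only: mul_scale[OF x sA] scale_mul[OF sA x])
  ultimately show ?thesis by blast
qed

sublocale fitting_algebra
  by unfold_locales (rule strongly_pi_regular_fd)

text \<open>Multiplying a linear relation by one member isolates its coefficient.\<close>

lemma orthogonal_idempotents_independent:
  assumes S: "finite S" "\<And>a. a \<in> S \<Longrightarrow> a \<in> A \<and> a \<odot> a = a \<and> a \<noteq> 0"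
    and orth: "\<And>a b. a \<in> S \<Longrightarrow> b \<in> S \<Longrightarrow> a \<noteq> b \<Longrightarrow> a \<odot> b = 0"
  shows "independent S"
proof -
  have "u v = 0" if u: "(\<Sum>a\<in>S. u a *s a) = 0" and v: "v \<in> S" for u v
  proof -
    have "0 = v \<odot> (\<Sum>a\<in>S. u a *s a)" using u v S by (simp add: mul_zero)
    also have "\<dots> = (\<Sum>a\<in>S. u a *s (v \<odot> a))" using S v by (subst mul_sum) (auto simp: scale_in mul_scale)
    also have "\<dots> = (\<Sum>a\<in>S. if a = v then u v *s v else 0)"
      by (rule sum.cong) (use S orth v in auto)
    also have "\<dots> = u v *s v" using v S by (simp add: sum.delta)
    finally show ?thesis using S(2)[OF v] by (metis scale_eq_0_iff)
  qed
  then show ?thesis using dependent_finite[OF S(1)] by blast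
qed

text \<open>Independence bounds the number of orthogonal nonzero idempotents, so a decomposition
  with the most terms exists; a non-primitive term could be split to give a longer one.\<close>

lemma primitive_decomposition_set:
  assumes z: "z \<in> A" "z \<odot> z = z"
  obtains S where "finite S" "\<And>a. a \<in> S \<Longrightarrow> primitive_idempotent (\<odot>) A a"
    "\<And>a b. a \<in> S \<Longrightarrow> b \<in> S \<Longrightarrow> a \<noteq> b \<Longrightarrow> a \<odot> b = 0" "\<Sum>S = z"
proof -
  define P where "P S \<longleftrightarrow> finite S \<and> (\<forall>a\<in>S. a \<in> A \<and> a \<odot> a = a \<and> a \<noteq> 0) \<and>
     (\<forall>a\<in>S. \<forall>b\<in>S. a \<noteq> b \<longrightarrow> a \<odot> b = 0) \<and> \<Sum>S = z" for S
  have bound: "card S \<le> card B" if "P S" for S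
  proof -
    have "independent S" using that by (intro orthogonal_idempotents_independent) (auto simp: P_def)
    then show ?thesis using independent_span_bound[OF finite_B] A_span that by (auto simp: P_def)
  qed
  \<comment> \<open>The zero idempotent is the empty sum, since terms must be nonzero.\<close>
  have "P (if z = 0 then {} else {z})" using z by (auto simp: P_def)
  then obtain S where S: "P S" and max: "\<And>S'. P S' \<Longrightarrow> card S' \<le> card S"
    using ex_has_greatest_nat[of P "if z = 0 then {} else {z}" card "Suc (card B)"] bound
    by (auto simp: less_Suc_eq_le)
  have "primitive_idempotent (\<odot>) A e" if e: "e \<in> S" for e
  proof (rule ccontr)
    have eA: "e \<in> A" "e \<odot> e = e" "e \<noteq> 0" using S e by (auto simp: P_def)
    assume "\<not> primitive_idempotent (\<odot>) A e"
    then obtain a b where ab: "a \<in> A" "b \<in> A" "a \<noteq> 0" "b \<noteq> 0" "a \<odot> a = a" "b \<odot> b = b"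
      "a \<odot> b = 0" "b \<odot> a = 0" "e = a + b"
      using eA unfolding primitive_idempotent_def by blast
    have ae: "a \<odot> e = a" "e \<odot> a = a" "b \<odot> e = b" "e \<odot> b = b"
      using ab by (auto simp: distrib_left distrib_right)
    have orth: "s \<odot> x = 0 \<and> x \<odot> s = 0" if "s \<in> S - {e}" "x \<in> {a, b}" for s x
    proof -
      have sA: "s \<in> A" "s \<odot> e = 0" "e \<odot> s = 0" using that S e by (auto simp: P_def)
      have xe: "x \<odot> e = x" "e \<odot> x = x" "x \<in> A" using that ae ab by auto
      have "s \<odot> x = s \<odot> e \<odot> x" using sA xe eA by (metis mul_assoc)
      moreover have "x \<odot> s = x \<odot> (e \<odot> s)" using sA xe eA by (metis mul_assoc)
      ultimately show ?thesis using sA xe by (simp add: zero_mul mul_zero)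
    qed
    have notin: "a \<notin> S - {e}" "b \<notin> S - {e}" "a \<noteq> b" using orth ab by force+
    have fin: "finite S" using S by (simp add: P_def)
    have "P (insert a (insert b (S - {e})))"
      unfolding P_def
    proof (intro conjI ballI impI)
      show "finite (insert a (insert b (S - {e})))" using fin by simp
      show "\<Sum> (insert a (insert b (S - {e}))) = z"
        using fin notin ab e S by (simp add: P_def sum.remove[OF fin e] add.assoc)
    next
      fix x assume "x \<in> insert a (insert b (S - {e}))"
      then show "x \<in> A" "x \<odot> x = x" "x \<noteq> 0" using ab S by (auto simp: P_def)
    next
      fix x y assume "x \<in> insert a (insert b (S - {e}))" "y \<in> insert a (insert b (S - {e}))" "x \<noteq> y"
      then show "x \<odot> y = 0" using orth ab S by (auto simp: P_def)
    qed
    from max[OF this] show False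
      using fin notin e card_Suc_Diff1[OF fin e] by simp
  qed
  then show thesis using S by (intro that[of S]) (auto simp: P_def)
qed

end

section \<open>Karoubi envelopes\<close>

locale preadditive_category =
  fixes C :: "('o, 'm::ab_group_add) cat"
  assumes hom_zero: "x \<in> cat_ob C \<Longrightarrow> y \<in> cat_ob C \<Longrightarrow> 0 \<in> cat_hom C x y"
    and hom_add: "x \<in> cat_ob C \<Longrightarrow> y \<in> cat_ob C \<Longrightarrow> f \<in> cat_hom C x y \<Longrightarrow> g \<in> cat_hom C x y \<Longrightarrow>
      f + g \<in> cat_hom C x y"
    and hom_uminus: "x \<in> cat_ob C \<Longrightarrow> y \<in> cat_ob C \<Longrightarrow> f \<in> cat_hom C x y \<Longrightarrow> - f \<in> cat_hom C x y"
    and hom_id: "x \<in> cat_ob C \<Longrightarrow> cat_id C x \<in> cat_hom C x x"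
    and hom_comp: "x \<in> cat_ob C \<Longrightarrow> y \<in> cat_ob C \<Longrightarrow> z \<in> cat_ob C \<Longrightarrow>
      f \<in> cat_hom C x y \<Longrightarrow> g \<in> cat_hom C y z \<Longrightarrow> cat_comp C x y z g f \<in> cat_hom C x z"
    and comp_assoc: "x \<in> cat_ob C \<Longrightarrow> y \<in> cat_ob C \<Longrightarrow> z \<in> cat_ob C \<Longrightarrow> w \<in> cat_ob C \<Longrightarrow>
      f \<in> cat_hom C x y \<Longrightarrow> g \<in> cat_hom C y z \<Longrightarrow> h \<in> cat_hom C z w \<Longrightarrow>
      cat_comp C x y w (cat_comp C y z w h g) f = cat_comp C x z w h (cat_comp C x y z g f)"
    and comp_id_left: "x \<in> cat_ob C \<Longrightarrow> y \<in> cat_ob C \<Longrightarrow> f \<in> cat_hom C x y \<Longrightarrow>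
      cat_comp C x y y (cat_id C y) f = f"
    and comp_id_right: "x \<in> cat_ob C \<Longrightarrow> y \<in> cat_ob C \<Longrightarrow> f \<in> cat_hom C x y \<Longrightarrow>
      cat_comp C x x y f (cat_id C x) = f"
    and comp_add_left: "x \<in> cat_ob C \<Longrightarrow> y \<in> cat_ob C \<Longrightarrow> z \<in> cat_ob C \<Longrightarrow>
      f \<in> cat_hom C x y \<Longrightarrow> g \<in> cat_hom C y z \<Longrightarrow> g' \<in> cat_hom C y z \<Longrightarrow>
      cat_comp C x y z (g + g') f = cat_comp C x y z g f + cat_comp C x y z g' f"
    and comp_add_right: "x \<in> cat_ob C \<Longrightarrow> y \<in> cat_ob C \<Longrightarrow> z \<in> cat_ob C \<Longrightarrow>
      f \<in> cat_hom C x y \<Longrightarrow> f' \<in> cat_hom C x y \<Longrightarrow> g \<in> cat_hom C y z \<Longrightarrow>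
      cat_comp C x y z g (f + f') = cat_comp C x y z g f + cat_comp C x y z g f'"
begin

lemma comp_zero_left: "x \<in> cat_ob C \<Longrightarrow> y \<in> cat_ob C \<Longrightarrow> z \<in> cat_ob C \<Longrightarrow>
    f \<in> cat_hom C x y \<Longrightarrow> cat_comp C x y z 0 f = 0"
  using comp_add_left[of x y z f 0 0] hom_zero by simp

lemma comp_zero_right: "x \<in> cat_ob C \<Longrightarrow> y \<in> cat_ob C \<Longrightarrow> z \<in> cat_ob C \<Longrightarrow>
    g \<in> cat_hom C y z \<Longrightarrow> cat_comp C x y z g 0 = 0"
  using comp_add_right[of x y z 0 0 g] hom_zero by simp

lemma endomorphism_algebra:
  "x \<in> cat_ob C \<Longrightarrow> carrier_algebra (cat_hom C x x) (cat_comp C x x x) (cat_id C x)"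
  by unfold_locales
    (auto simp: hom_zero hom_add hom_uminus hom_id hom_comp comp_assoc comp_id_left comp_id_right
      comp_add_left comp_add_right)

lemma hom_sum: "x \<in> cat_ob C \<Longrightarrow> y \<in> cat_ob C \<Longrightarrow> (\<And>i. i \<in> I \<Longrightarrow> f i \<in> cat_hom C x y) \<Longrightarrow>
    sum f I \<in> cat_hom C x y"
  by (induction I rule: infinite_finite_induct) (auto simp: hom_zero hom_add)

lemma comp_sum_left: "x \<in> cat_ob C \<Longrightarrow> y \<in> cat_ob C \<Longrightarrow> z \<in> cat_ob C \<Longrightarrow>
    f \<in> cat_hom C x y \<Longrightarrow> (\<And>i. i \<in> I \<Longrightarrow> g i \<in> cat_hom C y z) \<Longrightarrow>
    cat_comp C x y z (sum g I) f = (\<Sum>i\<in>I. cat_comp C x y z (g i) f)"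
  by (induction I rule: infinite_finite_induct) (auto simp: comp_zero_left comp_add_left hom_sum)

lemma comp_sum_right: "x \<in> cat_ob C \<Longrightarrow> y \<in> cat_ob C \<Longrightarrow> z \<in> cat_ob C \<Longrightarrow>
    g \<in> cat_hom C y z \<Longrightarrow> (\<And>i. i \<in> I \<Longrightarrow> f i \<in> cat_hom C x y) \<Longrightarrow>
    cat_comp C x y z g (sum f I) = (\<Sum>i\<in>I. cat_comp C x y z g (f i))"
  by (induction I rule: infinite_finite_induct) (auto simp: comp_zero_right comp_add_right hom_sum)

definition idem :: "'o \<Rightarrow> 'm \<Rightarrow> bool" where
  "idem x e \<longleftrightarrow> x \<in> cat_ob C \<and> e \<in> cat_hom C x x \<and> cat_comp C x x x e e = e"

definition kar_iso :: "'o \<Rightarrow> 'm \<Rightarrow> 'o \<Rightarrow> 'm \<Rightarrow> 'm \<Rightarrow> 'm \<Rightarrow> bool" where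
  "kar_iso x e y f u v \<longleftrightarrow> u \<in> cat_hom C x y \<and> v \<in> cat_hom C y x \<and>
     cat_comp C x x y u e = u \<and> cat_comp C x y y f u = u \<and>
     cat_comp C y y x v f = v \<and> cat_comp C y x x e v = v \<and>
     cat_comp C x y x v u = e \<and> cat_comp C y x y u v = f"

abbreviation kar :: "('o \<times> 'm, 'm) cat" where "kar \<equiv> karoubi_envelope C"

lemma kar_ob: "(x, e) \<in> cat_ob kar \<longleftrightarrow> idem x e"
  by (simp add: karoubi_envelope_def idem_def)

lemma isomorphic_kar: "isomorphic kar (x, e) (y, f) \<longleftrightarrow> (\<exists>u v. kar_iso x e y f u v)"
  by (auto simp: isomorphic_def karoubi_envelope_def kar_iso_def)

lemma isomorphic_kar_refl: "idem x e \<Longrightarrow> isomorphic kar (x, e) (x, e)"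
  unfolding isomorphic_kar kar_iso_def idem_def by blast

lemma isomorphic_kar_sym: "isomorphic kar (x, e) (y, f) \<Longrightarrow> isomorphic kar (y, f) (x, e)"
  unfolding isomorphic_kar kar_iso_def by blast

lemma isomorphic_kar_trans:
  assumes "isomorphic kar (x, e) (y, f)" "isomorphic kar (y, f) (z, g)" "idem x e" "idem y f" "idem z g"
  shows "isomorphic kar (x, e) (z, g)"
proof -
  obtain u v where u: "kar_iso x e y f u v" using assms by (auto simp: isomorphic_kar)
  obtain u' v' where v: "kar_iso y f z g u' v'" using assms by (auto simp: isomorphic_kar)
  have ob: "x \<in> cat_ob C" "y \<in> cat_ob C" "z \<in> cat_ob C" using assms by (auto simp: idem_def)
  note h = ob u[unfolded kar_iso_def] v[unfolded kar_iso_def] assms(3-5)[unfolded idem_def]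
  let ?p = "cat_comp C x y z u' u" and ?q = "cat_comp C z y x v v'"
  have "cat_comp C x z x ?q ?p = cat_comp C x y x v (cat_comp C x z y v' ?p)"
    using h by (simp add: comp_assoc hom_comp)
  also have "cat_comp C x z y v' ?p = cat_comp C x y y f u"
    using h comp_assoc[of x y z y u u' v'] by simp
  finally have 1: "cat_comp C x z x ?q ?p = e" using h by simp
  have "cat_comp C z x z ?p ?q = cat_comp C z y z u' (cat_comp C z x y u ?q)"
    using h by (simp add: comp_assoc hom_comp)
  also have "cat_comp C z x y u ?q = cat_comp C z y y f v'"
    using h comp_assoc[of z y x y v' v u] by simp
  finally have 2: "cat_comp C z x z ?p ?q = g" using h by simp
  have "?p \<in> cat_hom C x z" "?q \<in> cat_hom C z x" using h hom_comp[of x y z u u'] hom_comp[of z y x v' v] by simp_all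
  moreover have "cat_comp C x x z ?p e = ?p" using h comp_assoc[of x x y z e u u'] by simp
  moreover have "cat_comp C x z z g ?p = ?p" using h comp_assoc[of x y z z u u' g] by simp
  moreover have "cat_comp C z z x ?q g = ?q" using h comp_assoc[of z z y x g v' v] by metis
  moreover have "cat_comp C z x x e ?q = ?q" using h comp_assoc[of z y x x v' v e] by simp
  ultimately have "kar_iso x e z g ?p ?q"
    unfolding kar_iso_def using 1 2 by blast
  then show ?thesis by (auto simp: isomorphic_kar)
qed

lemma iso_class_kar_eq_iff:
  assumes "idem x e" "idem y f"
  shows "iso_class kar (x, e) = iso_class kar (y, f) \<longleftrightarrow> isomorphic kar (x, e) (y, f)"
proof
  assume "iso_class kar (x, e) = iso_class kar (y, f)"
  moreover have "(y, f) \<in> iso_class kar (y, f)"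
    using assms isomorphic_kar_refl by (simp add: iso_class_def kar_ob)
  ultimately show "isomorphic kar (x, e) (y, f)" by (auto simp: iso_class_def)
next
  assume "isomorphic kar (x, e) (y, f)"
  then show "iso_class kar (x, e) = iso_class kar (y, f)"
    using assms isomorphic_kar_trans[of x e y f] isomorphic_kar_trans[of y f x e] isomorphic_kar_sym[of x e y f]
    by (auto simp: iso_class_def kar_ob)
qed

text \<open>A factorisation e = v u through y makes u v an idempotent on y that splits the same
  object.\<close>

lemma retract_iso:
  assumes "idem x e" "y \<in> cat_ob C" "u \<in> cat_hom C x y" "v \<in> cat_hom C y x"
    "cat_comp C x x y u e = u" "cat_comp C y x x e v = v" "cat_comp C x y x v u = e"
  shows "idem y (cat_comp C y x y u v)" "isomorphic kar (x, e) (y, cat_comp C y x y u v)"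
proof -
  let ?f = "cat_comp C y x y u v"
  note h = assms[unfolded idem_def]
  have 1: "cat_comp C x y y ?f u = u" using h comp_assoc[of x y x y u v u] by simp
  have 2: "cat_comp C y y x v ?f = v" using h comp_assoc[of y x y x v u v] by simp
  have "cat_comp C y y y ?f ?f = ?f"
    using h 2 comp_assoc[of y y x y ?f v u] hom_comp[of y x y v u] by simp
  then show "idem y ?f" using h hom_comp by (simp add: idem_def)
  have "kar_iso x e y ?f u v" using h 1 2 by (simp add: kar_iso_def)
  then show "isomorphic kar (x, e) (y, ?f)" by (auto simp: isomorphic_kar)
qed

abbreviation prim :: "'o \<Rightarrow> 'm \<Rightarrow> bool" where
  "prim x e \<equiv> primitive_idempotent (cat_comp C x x x) (cat_hom C x x) e"

lemma prim_idem: "x \<in> cat_ob C \<Longrightarrow> prim x e \<Longrightarrow> idem x e"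
  by (simp add: primitive_idempotent_def idem_def)

text \<open>Primitivity is a property of the object: the map from a to v a u carries a splitting of
  f to a splitting of e.\<close>

lemma prim_isomorphic:
  assumes "prim x e" "idem x e" "idem y f" "isomorphic kar (x, e) (y, f)"
  shows "prim y f"
proof -
  obtain u v where u: "kar_iso x e y f u v" using assms by (auto simp: isomorphic_kar)
  note h = u[unfolded kar_iso_def] assms(2,3)[unfolded idem_def]
  have conj: "cat_comp C x y x (cat_comp C y y x v a) u \<in> cat_hom C x x" if "a \<in> cat_hom C y y" for a
    using h that hom_comp by meson
  define \<phi> where "\<phi> a = cat_comp C x y x (cat_comp C y y x v a) u" for a
  have \<phi>in: "\<phi> a \<in> cat_hom C x x" if "a \<in> cat_hom C y y" for a
    using conj that by (simp add: \<phi>_def)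
  have \<phi>mul: "cat_comp C x x x (\<phi> a) (\<phi> b) = \<phi> (cat_comp C y y y a b)"
    if "a \<in> cat_hom C y y" "b \<in> cat_hom C y y" "cat_comp C y y y f b = b" for a b
  proof -
    have va: "cat_comp C y y x v a \<in> cat_hom C y x" and vb: "cat_comp C y y x v b \<in> cat_hom C y x"
      using h that hom_comp by blast+
    have "cat_comp C x x x (\<phi> a) (\<phi> b) = cat_comp C x y x (cat_comp C y y x v a) (cat_comp C x x y u (\<phi> b))"
      using h va \<phi>in[OF that(2)] comp_assoc[of x x y x "\<phi> b" u "cat_comp C y y x v a"]
      by (simp add: \<phi>_def[of a])
    also have "cat_comp C x x y u (\<phi> b) = cat_comp C x y y (cat_comp C y x y u (cat_comp C y y x v b)) u"
      unfolding \<phi>_def using h vb by (simp add: comp_assoc)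
    also have "cat_comp C y x y u (cat_comp C y y x v b) = b"
      using h that comp_assoc[of y y x y b v u] by simp
    also have "cat_comp C x y x (cat_comp C y y x v a) (cat_comp C x y y b u) =
      cat_comp C x y x (cat_comp C y y x (cat_comp C y y x v a) b) u"
      using h va that comp_assoc[of x y y x u b "cat_comp C y y x v a"] by simp
    also have "cat_comp C y y x (cat_comp C y y x v a) b = cat_comp C y y x v (cat_comp C y y y a b)"
      using h that by (simp add: comp_assoc)
    finally show ?thesis by (simp add: \<phi>_def)
  qed
  \<comment> \<open>Injectivity holds on the corner of f: multiplying v a u by u on the left and v
    on the right gives back a there.\<close>
  have \<phi>0: "a = 0" if "a \<in> cat_hom C y y" "cat_comp C y y y f a = a" "cat_comp C y y y a f = a" "\<phi> a = 0" for a
  proof -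
    have va: "cat_comp C y y x v a \<in> cat_hom C y x" using h that hom_comp by blast
    have "0 = cat_comp C y x x (\<phi> a) v" using that h by (simp add: comp_zero_left)
    also have "\<dots> = cat_comp C y y x (cat_comp C y y x v a) f"
      unfolding \<phi>_def using h va by (simp add: comp_assoc)
    also have "\<dots> = cat_comp C y y x v a" using h that by (simp add: comp_assoc)
    finally have "0 = cat_comp C y x y u (cat_comp C y y x v a)" using h comp_zero_right by simp
    then show ?thesis using h that comp_assoc[of y y x y a v u] by simp
  qed
  have \<phi>add: "\<phi> (a + b) = \<phi> a + \<phi> b" if "a \<in> cat_hom C y y" "b \<in> cat_hom C y y" for a b
    unfolding \<phi>_def using h that by (simp add: comp_add_left comp_add_right hom_comp)
  have \<phi>f: "\<phi> f = e" unfolding \<phi>_def using h by simp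
  note e = assms(1)[unfolded primitive_idempotent_def]
  have f0: "f \<noteq> 0"
  proof
    assume "f = 0"
    then have "u = 0" using h comp_zero_left[of x y y u] by metis
    then have "e = 0" using h comp_zero_right[of x y x v] by metis
    then show False using e by simp
  qed
  have "\<not> (\<exists>a \<in> cat_hom C y y. \<exists>b \<in> cat_hom C y y. a \<noteq> 0 \<and> b \<noteq> 0 \<and> cat_comp C y y y a a = a \<and>
    cat_comp C y y y b b = b \<and> cat_comp C y y y a b = 0 \<and> cat_comp C y y y b a = 0 \<and> f = a + b)"
  proof safe
    fix a b assume ab: "a \<in> cat_hom C y y" "b \<in> cat_hom C y y" "a \<noteq> 0" "b \<noteq> 0" "cat_comp C y y y a a = a"
      "cat_comp C y y y b b = b" "cat_comp C y y y a b = 0" "cat_comp C y y y b a = 0" "f = a + b"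
    have fa: "cat_comp C y y y f a = a" "cat_comp C y y y a f = a" "cat_comp C y y y f b = b" "cat_comp C y y y b f = b"
      using ab h by (auto simp: comp_add_left comp_add_right)
    have z: "\<phi> 0 = 0" unfolding \<phi>_def using h by (simp add: comp_zero_left comp_zero_right)
    have "\<phi> a \<noteq> 0" "\<phi> b \<noteq> 0" using \<phi>0 ab fa by blast+
    then show False
      using e \<phi>in[OF ab(1)] \<phi>in[OF ab(2)] \<phi>mul[of a a] \<phi>mul[of b b] \<phi>mul[of a b] \<phi>mul[of b a]
        \<phi>add[of a b] \<phi>f ab fa z by metis
  qed
  then show ?thesis using h f0 unfolding primitive_idempotent_def by blast
qed

lemma zero_object_kar: "idem x e \<Longrightarrow> zero_object kar (x, e) \<longleftrightarrow> e = 0"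
proof
  assume x: "idem x e" and "zero_object kar (x, e)"
  then have "\<exists>!f. f \<in> cat_hom kar (x, e) (x, e)" by (simp add: zero_object_def kar_ob)
  moreover have "e \<in> cat_hom kar (x, e) (x, e)" "0 \<in> cat_hom kar (x, e) (x, e)"
    using x by (auto simp: karoubi_envelope_def idem_def hom_zero comp_zero_left comp_zero_right)
  ultimately show "e = 0" by blast
next
  assume x: "idem x e" and e: "e = 0"
  have "f \<in> cat_hom kar (x, e) Y \<longleftrightarrow> f = 0" "f \<in> cat_hom kar Y (x, e) \<longleftrightarrow> f = 0"
    if "Y \<in> cat_ob kar" for Y f
    using that x e unfolding karoubi_envelope_def idem_def
    by (auto simp: hom_zero comp_zero_left comp_zero_right split: prod.splits)
  then show "zero_object kar (x, e)" by (simp add: zero_object_def)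
qed

text \<open>A direct sum decomposition with injections i, j and projections p, q gives the
  orthogonal splitting e = i p + j q; conversely the two idempotents of a splitting serve as their
  own injections and projections.\<close>

lemma indecomposable_kar:
  assumes x: "idem x e" "e \<noteq> 0"
  shows "indecomposable kar (x, e) \<longleftrightarrow> prim x e"
proof
  assume ind: "indecomposable kar (x, e)"
  note h = x[unfolded idem_def]
  show "prim x e"
    unfolding primitive_idempotent_def
  proof (intro conjI notI)
    assume "\<exists>a\<in>cat_hom C x x. \<exists>b\<in>cat_hom C x x. a \<noteq> 0 \<and> b \<noteq> 0 \<and> cat_comp C x x x a a = a \<and>
      cat_comp C x x x b b = b \<and> cat_comp C x x x a b = 0 \<and> cat_comp C x x x b a = 0 \<and> e = a + b"
    then obtain a b where ab: "a \<in> cat_hom C x x" "b \<in> cat_hom C x x" "a \<noteq> 0" "b \<noteq> 0"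
      "cat_comp C x x x a a = a" "cat_comp C x x x b b = b" "cat_comp C x x x a b = 0"
      "cat_comp C x x x b a = 0" "e = a + b" by blast
    have i: "idem x a" "idem x b" using h ab by (auto simp: idem_def)
    have ea: "cat_comp C x x x e a = a" "cat_comp C x x x a e = a" "cat_comp C x x x e b = b" "cat_comp C x x x b e = b"
      using ab h by (auto simp: comp_add_left comp_add_right)
    have "is_direct_sum kar (x, e) (x, a) (x, b)"
      unfolding is_direct_sum_def
      by (rule bexI[of _ a], rule bexI[of _ b], rule bexI[of _ a], rule bexI[of _ b])
        (use ab ea in \<open>auto simp: karoubi_envelope_def\<close>)
    then have "zero_object kar (x, a) \<or> zero_object kar (x, b)"
      using ind i unfolding indecomposable_def by (simp add: kar_ob)
    then show False using zero_object_kar i ab by blast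
  qed (use h in auto)
next
  assume p: "prim x e"
  note h = x[unfolded idem_def]
  show "indecomposable kar (x, e)"
    unfolding indecomposable_def
  proof (intro ballI impI)
    fix Y Z assume Y: "Y \<in> cat_ob kar" and Z: "Z \<in> cat_ob kar" and "is_direct_sum kar (x, e) Y Z"
    obtain y f z g where YZ: "Y = (y, f)" "Z = (z, g)" by fastforce
    have fg: "idem y f" "idem z g" using Y Z YZ by (auto simp: kar_ob)
    obtain i j p' q where ij: "i \<in> cat_hom C y x" "j \<in> cat_hom C z x" "p' \<in> cat_hom C x y" "q \<in> cat_hom C x z"
      "cat_comp C y x x e i = i" "cat_comp C z x x e j = j" "cat_comp C x x y p' e = p'" "cat_comp C x x z q e = q"
      "cat_comp C y y x i f = i" "cat_comp C z z x j g = j" "cat_comp C x y y f p' = p'" "cat_comp C x z z g q = q"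
      "cat_comp C y x y p' i = f" "cat_comp C z x z q j = g" "cat_comp C z x y p' j = 0" "cat_comp C y x z q i = 0"
      "cat_comp C x y x i p' + cat_comp C x z x j q = e"
      using \<open>is_direct_sum kar (x, e) Y Z\<close> YZ by (auto simp: is_direct_sum_def karoubi_envelope_def)
    note k = h ij fg[unfolded idem_def]
    let ?a = "cat_comp C x y x i p'" and ?b = "cat_comp C x z x j q"
    have aA: "?a \<in> cat_hom C x x" "?b \<in> cat_hom C x x" using k hom_comp by blast+
    have pa: "cat_comp C x x y p' ?a = p'" using k comp_assoc[of x y x y p' i p'] by simp
    have qb: "cat_comp C x x z q ?b = q" using k comp_assoc[of x z x z q j q] by simp
    have pb: "cat_comp C x x y p' ?b = 0" using k comp_assoc[of x z x y q j p'] by (simp add: comp_zero_left)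
    have qa: "cat_comp C x x z q ?a = 0" using k comp_assoc[of x y x z p' i q] by (simp add: comp_zero_left)
    have aa: "cat_comp C x x x ?a ?a = ?a" using k pa aA by (simp add: comp_assoc)
    have bb: "cat_comp C x x x ?b ?b = ?b" using k qb aA by (simp add: comp_assoc)
    have ab: "cat_comp C x x x ?a ?b = 0" using k pb aA by (simp add: comp_assoc comp_zero_right)
    have ba: "cat_comp C x x x ?b ?a = 0" using k qa aA by (simp add: comp_assoc comp_zero_right)
    have "?a = 0 \<or> ?b = 0"
      using p aA aa bb ab ba ij(17) unfolding primitive_idempotent_def by metis
    then show "zero_object kar Y \<or> zero_object kar Z"
    proof
      assume "?a = 0"
      then have "p' = 0" using pa k comp_zero_right[of x x y p'] by simp
      then have "f = 0" using k comp_zero_left[of y x y i] by simp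
      then show ?thesis using zero_object_kar fg YZ by blast
    next
      assume "?b = 0"
      then have "q = 0" using qb k comp_zero_right[of x x z q] by simp
      then have "g = 0" using k comp_zero_left[of z x z j] by simp
      then show ?thesis using zero_object_kar fg YZ by blast
    qed
  qed
qed

end

lemma sum_fun_apply: "(sum f I) a = (\<Sum>i\<in>I. f i a)"
  by (induction I rule: infinite_finite_induct) auto

section \<open>Linear categories with finite-dimensional Hom-spaces\<close>

locale linear_category = preadditive_category C + vector_space scale
  for C :: "('o, 'm::ab_group_add) cat"
    and scale :: "'k::field \<Rightarrow> 'm \<Rightarrow> 'm" (infixr "*s" 75) +
  assumes hom_scale: "x \<in> cat_ob C \<Longrightarrow> y \<in> cat_ob C \<Longrightarrow> f \<in> cat_hom C x y \<Longrightarrow> c *s f \<in> cat_hom C x y"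
    and comp_scale_right: "x \<in> cat_ob C \<Longrightarrow> y \<in> cat_ob C \<Longrightarrow> z \<in> cat_ob C \<Longrightarrow>
      f \<in> cat_hom C x y \<Longrightarrow> g \<in> cat_hom C y z \<Longrightarrow> cat_comp C x y z g (c *s f) = c *s cat_comp C x y z g f"
    and comp_scale_left: "x \<in> cat_ob C \<Longrightarrow> y \<in> cat_ob C \<Longrightarrow> z \<in> cat_ob C \<Longrightarrow>
      f \<in> cat_hom C x y \<Longrightarrow> g \<in> cat_hom C y z \<Longrightarrow> cat_comp C x y z (c *s g) f = c *s cat_comp C x y z g f"
    and hom_finite: "x \<in> cat_ob C \<Longrightarrow> y \<in> cat_ob C \<Longrightarrow> \<exists>B. finite B \<and> cat_hom C x y \<subseteq> span B"
begin

lemma fd_endomorphism_algebra: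
  assumes "x \<in> cat_ob C"
  obtains B where "fd_algebra (cat_hom C x x) (cat_comp C x x x) (cat_id C x) scale B"
proof -
  obtain B where B: "finite B" "cat_hom C x x \<subseteq> span B" using hom_finite assms by blast
  interpret carrier_algebra "cat_hom C x x" "cat_comp C x x x" "cat_id C x"
    by (rule endomorphism_algebra[OF assms])
  have "fd_algebra (cat_hom C x x) (cat_comp C x x x) (cat_id C x) scale B"
    by unfold_locales (use assms B in \<open>auto simp: hom_scale comp_scale_left comp_scale_right\<close>)
  then show thesis by (rule that)
qed

lemma prim_decomposition:
  assumes "idem x z"
  obtains S where "finite S" "\<And>a. a \<in> S \<Longrightarrow> prim x a"
    "\<And>a b. a \<in> S \<Longrightarrow> b \<in> S \<Longrightarrow> a \<noteq> b \<Longrightarrow> cat_comp C x x x a b = 0" "\<Sum>S = z"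
proof -
  obtain B where "fd_algebra (cat_hom C x x) (cat_comp C x x x) (cat_id C x) scale B"
    using fd_endomorphism_algebra assms by (auto simp: idem_def)
  then interpret fd_algebra "cat_hom C x x" "cat_comp C x x x" "cat_id C x" scale B .
  show thesis using primitive_decomposition_set[of z] assms that by (auto simp: idem_def)
qed

text \<open>A primitive endomorphism ring is local, so one of the summands factors the identity.\<close>

lemma prim_sum_factors:
  assumes e: "prim x e" "x \<in> cat_ob C" and "finite I"
    and uv: "\<And>i. i \<in> I \<Longrightarrow> y i \<in> cat_ob C \<and> u i \<in> cat_hom C x (y i) \<and> v i \<in> cat_hom C (y i) x"
    and sum: "e = (\<Sum>i\<in>I. cat_comp C x (y i) x (v i) (u i))"
  shows "\<exists>i\<in>I. \<exists>f. idem (y i) f \<and> isomorphic kar (x, e) (y i, f)"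
proof -
  obtain B where "fd_algebra (cat_hom C x x) (cat_comp C x x x) (cat_id C x) scale B"
    using fd_endomorphism_algebra assms by blast
  then interpret fd_algebra "cat_hom C x x" "cat_comp C x x x" "cat_id C x" scale B .
  have eh: "e \<in> cat_hom C x x" "cat_comp C x x x e e = e" using primitive_in[OF e(1)] by auto
  \<comment> \<open>Compressing by e moves all composites into the corner of e, where the local-ring
    argument applies, and their sum is still e.\<close>
  define U where "U i = cat_comp C x x (y i) (u i) e" for i
  define V where "V i = cat_comp C (y i) x x e (v i)" for i
  have U: "U i \<in> cat_hom C x (y i)" "cat_comp C x x (y i) (U i) e = U i" if "i \<in> I" for i
    using uv[OF that] eh e(2) comp_assoc[of x x x "y i" e e "u i"] hom_comp[of x x "y i" e "u i"]
    by (simp_all add: U_def)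
  have V: "V i \<in> cat_hom C (y i) x" "cat_comp C (y i) x x e (V i) = V i" if "i \<in> I" for i
    using uv[OF that] eh e(2) comp_assoc[of "y i" x x x "v i" e e] hom_comp[of "y i" x x "v i" e]
    by (simp_all add: V_def)
  define a where "a i = cat_comp C x (y i) x (V i) (U i)" for i
  have vu: "cat_comp C x (y i) x (v i) (u i) \<in> cat_hom C x x" if "i \<in> I" for i
    using uv[OF that] e(2) hom_comp by blast
  have a_eq: "a i = cat_comp C x x x (cat_comp C x x x e (cat_comp C x (y i) x (v i) (u i))) e" if "i \<in> I" for i
  proof -
    have "a i = cat_comp C x x x (cat_comp C x (y i) x (V i) (u i)) e"
      using uv[OF that] eh e(2) V[OF that] comp_assoc[of x x "y i" x e "u i" "V i"] by (simp add: a_def U_def)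
    also have "cat_comp C x (y i) x (V i) (u i) = cat_comp C x x x e (cat_comp C x (y i) x (v i) (u i))"
      using uv[OF that] eh e(2) comp_assoc[of x "y i" x x "u i" "v i" e] by (simp add: V_def)
    finally show ?thesis .
  qed
  have aI: "a i \<in> cat_hom C x x \<and> cat_comp C x x x e (a i) = a i \<and> cat_comp C x x x (a i) e = a i" if "i \<in> I" for i
    using U[OF that] V[OF that] uv[OF that] e(2) eh hom_comp[of x "y i" x "U i" "V i"]
      comp_assoc[of x x "y i" x e "U i" "V i"] comp_assoc[of x "y i" x x "U i" "V i" e]
    by (simp add: a_def)
  let ?w = "\<lambda>i. cat_comp C x (y i) x (v i) (u i)"
  have "sum a I = (\<Sum>i\<in>I. cat_comp C x x x (cat_comp C x x x e (?w i)) e)"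
    by (rule sum.cong) (auto simp: a_eq)
  also have "\<dots> = cat_comp C x x x (\<Sum>i\<in>I. cat_comp C x x x e (?w i)) e"
    by (rule sum_mul[symmetric]) (use vu eh in \<open>auto simp: mul_in\<close>)
  also have "(\<Sum>i\<in>I. cat_comp C x x x e (?w i)) = cat_comp C x x x e (sum ?w I)"
    by (rule mul_sum[symmetric]) (use vu eh in auto)
  also have "sum ?w I = e" by (simp add: sum)
  finally have "sum a I = e" using eh by simp
  from sum_has_invertible[OF e(1) assms(3) aI this]
  obtain i b where i: "i \<in> I" and b: "b \<in> cat_hom C x x" "cat_comp C x x x e b = b" "cat_comp C x x x b e = b"
    "cat_comp C x x x b (a i) = e" by blast
  note Ui = U[OF i] and Vi = V[OF i] and uvi = uv[OF i]
  \<comment> \<open>The inverse b of the chosen summand is absorbed into V, so that the composite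
    becomes e itself.\<close>
  let ?V = "cat_comp C (y i) x x b (V i)"
  have "?V \<in> cat_hom C (y i) x" using b Vi uvi e(2) hom_comp by blast
  moreover have "cat_comp C (y i) x x e ?V = ?V"
    using b Vi uvi e(2) eh comp_assoc[of "y i" x x x "V i" b e] by simp
  moreover have "cat_comp C x (y i) x ?V (U i) = e"
    using b Vi Ui uvi e(2) comp_assoc[of x "y i" x x "U i" "V i" b] by (simp add: a_def)
  ultimately show ?thesis
    using retract_iso[of x e "y i" "U i" ?V] prim_idem[OF e(2,1)] uvi Ui i by blast
qed

text \<open>The composite v u lies in the corner of e and is not nilpotent, hence a unit there;
  correcting v by its inverse makes e factor through y. The resulting idempotent on y is nonzero and
  lies under f, so primitivity of f identifies it with f.\<close>

lemma prim_non_nilpotent_iso: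
  assumes e: "prim x e" "x \<in> cat_ob C" and f: "prim y f" "y \<in> cat_ob C"
    and u: "u \<in> cat_hom C x y" "cat_comp C x x y u e = u" "cat_comp C x y y f u = u"
    and v: "v \<in> cat_hom C y x" "cat_comp C y y x v f = v" "cat_comp C y x x e v = v"
    and nonnil: "\<And>n. carrier_algebra.pw (cat_comp C x x x) (cat_id C x) (cat_comp C x y x v u) n \<noteq> 0"
  shows "isomorphic kar (x, e) (y, f)"
proof -
  obtain B where "fd_algebra (cat_hom C x x) (cat_comp C x x x) (cat_id C x) scale B"
    using fd_endomorphism_algebra assms by blast
  then interpret fd_algebra "cat_hom C x x" "cat_comp C x x x" "cat_id C x" scale B .
  interpret Y: carrier_algebra "cat_hom C y y" "cat_comp C y y y" "cat_id C y"
    by (rule endomorphism_algebra[OF f(2)])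
  have eh: "e \<in> cat_hom C x x" "cat_comp C x x x e e = e" "e \<noteq> 0" using primitive_in[OF e(1)] by auto
  have fh: "f \<in> cat_hom C y y" using Y.primitive_in[OF f(1)] by auto
  let ?a = "cat_comp C x y x v u"
  have a: "?a \<in> cat_hom C x x" "cat_comp C x x x e ?a = ?a" "cat_comp C x x x ?a e = ?a"
    using u v e(2) f(2) eh hom_comp[of x y x u v] comp_assoc[of x x y x e u v] comp_assoc[of x y x x u v e]
    by simp_all
  obtain b where b: "b \<in> cat_hom C x x" "cat_comp C x x x e b = b" "cat_comp C x x x b e = b"
    "cat_comp C x x x ?a b = e" "cat_comp C x x x b ?a = e"
    using corner_nilpotent_or_invertible[OF e(1) a] nonnil by blast
  let ?v = "cat_comp C y x x b v"
  have V: "?v \<in> cat_hom C y x" "cat_comp C y x x e ?v = ?v" "cat_comp C x y x ?v u = e" "cat_comp C y y x ?v f = ?v"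
    using b u v e(2) f(2) eh fh hom_comp[of y x x v b] comp_assoc[of y x x x v b e]
      comp_assoc[of x y x x u v b] comp_assoc[of y y x x f v b] by simp_all
  let ?f = "cat_comp C y x y u ?v"
  have g: "idem y ?f" "isomorphic kar (x, e) (y, ?f)"
    using retract_iso[of x e y u ?v] prim_idem[OF e(2,1)] f(2) u V by auto
  have "cat_comp C y y y f ?f = ?f" "cat_comp C y y y ?f f = ?f"
    using u V f(2) fh e(2) comp_assoc[of y x y y ?v u f] comp_assoc[of y y x y f ?v u] by simp_all
  moreover have "?f \<noteq> 0"
  proof
    assume 0: "?f = 0"
    have "u = cat_comp C x y y ?f u"
      using u V e(2) f(2) comp_assoc[of x y x y u ?v u] by simp
    then have "u = 0" using 0 comp_zero_left u e(2) f(2) by metis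
    then show False using V(1,3) eh e(2) f(2) comp_zero_right by metis
  qed
  ultimately have "?f = f" using Y.primitive_subidempotent[OF f(1)] g by (auto simp: idem_def)
  then show ?thesis using g by simp
qed

end

section \<open>Additive envelopes\<close>

context preadditive_category begin

abbreviation add :: "('o list, nat \<Rightarrow> nat \<Rightarrow> 'm) cat" where "add \<equiv> additive_envelope C"

lemma add_ob: "xs \<in> cat_ob add \<longleftrightarrow> (\<forall>i<length xs. xs ! i \<in> cat_ob C)"
  by (auto simp: additive_envelope_def lists_eq_set set_conv_nth)

lemma add_hom: "M \<in> cat_hom add xs ys \<longleftrightarrow>
    (\<forall>i<length ys. \<forall>j<length xs. M i j \<in> cat_hom C (xs ! j) (ys ! i)) \<and>
    (\<forall>i j. \<not> (i < length ys \<and> j < length xs) \<longrightarrow> M i j = 0)"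
  by (simp add: additive_envelope_def)

lemma add_comp: "cat_comp add xs ys zs N M i k = (if i < length zs \<and> k < length xs
    then (\<Sum>j < length ys. cat_comp C (xs ! k) (ys ! j) (zs ! i) (N i j) (M j k)) else 0)"
  by (simp add: additive_envelope_def)

lemma add_id: "cat_id add xs i j = (if i = j \<and> i < length xs then cat_id C (xs ! i) else 0)"
  by (simp add: additive_envelope_def)

lemma preadditive_add: "preadditive_category add"
proof
  fix xs ys zs ws :: "'o list" and f g h :: "nat \<Rightarrow> nat \<Rightarrow> 'm"
  assume ob: "xs \<in> cat_ob add" "ys \<in> cat_ob add" "zs \<in> cat_ob add" "ws \<in> cat_ob add"
    and f: "f \<in> cat_hom add xs ys" and g: "g \<in> cat_hom add ys zs" and h: "h \<in> cat_hom add zs ws"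
  show "cat_comp add xs ys ws (cat_comp add ys zs ws h g) f = cat_comp add xs zs ws h (cat_comp add xs ys zs g f)"
  proof (intro ext)
    fix i l
    show "cat_comp add xs ys ws (cat_comp add ys zs ws h g) f i l =
      cat_comp add xs zs ws h (cat_comp add xs ys zs g f) i l"
    proof (cases "i < length ws \<and> l < length xs")
      case True
      have "cat_comp add xs ys ws (cat_comp add ys zs ws h g) f i l =
        (\<Sum>j<length ys. \<Sum>k<length zs. cat_comp C (xs ! l) (ys ! j) (ws ! i)
          (cat_comp C (ys ! j) (zs ! k) (ws ! i) (h i k) (g k j)) (f j l))"
        unfolding add_comp[of xs] using True ob f g h
        by (auto simp: add_comp add_hom add_ob intro!: sum.cong comp_sum_left hom_comp)
      also have "\<dots> = (\<Sum>j<length ys. \<Sum>k<length zs. cat_comp C (xs ! l) (zs ! k) (ws ! i) (h i k)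
          (cat_comp C (xs ! l) (ys ! j) (zs ! k) (g k j) (f j l)))"
        using True ob f g h by (auto simp: add_hom add_ob intro!: sum.cong comp_assoc)
      also have "\<dots> = (\<Sum>k<length zs. \<Sum>j<length ys. cat_comp C (xs ! l) (zs ! k) (ws ! i) (h i k)
          (cat_comp C (xs ! l) (ys ! j) (zs ! k) (g k j) (f j l)))"
        by (rule sum.swap)
      also have "\<dots> = cat_comp add xs zs ws h (cat_comp add xs ys zs g f) i l"
        unfolding add_comp[of xs] using True ob f g h
        by (auto simp: add_comp add_hom add_ob intro!: sum.cong comp_sum_right[symmetric] hom_comp)
      finally show ?thesis .
    qed (auto simp: add_comp)
  qed
next
  fix xs ys zs :: "'o list" and f g :: "nat \<Rightarrow> nat \<Rightarrow> 'm"
  assume ob: "xs \<in> cat_ob add" "ys \<in> cat_ob add" "zs \<in> cat_ob add"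
    and f: "f \<in> cat_hom add xs ys" and g: "g \<in> cat_hom add ys zs"
  show "cat_comp add xs ys zs g f \<in> cat_hom add xs zs"
    using ob f g by (auto simp: add_hom add_ob add_comp intro!: hom_sum hom_comp)
next
  fix xs ys :: "'o list" and f g :: "nat \<Rightarrow> nat \<Rightarrow> 'm"
  assume ob: "xs \<in> cat_ob add" "ys \<in> cat_ob add" and f: "f \<in> cat_hom add xs ys" 
  show "cat_comp add xs ys ys (cat_id add ys) f = f"
  proof (intro ext)
    fix i k
    show "cat_comp add xs ys ys (cat_id add ys) f i k = f i k"
    proof (cases "i < length ys \<and> k < length xs")
      case True
      have "cat_comp add xs ys ys (cat_id add ys) f i k = (\<Sum>j<length ys. if j = i then f i k else 0)"
        unfolding add_comp if_P[OF True] using True ob f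
        by (intro sum.cong) (auto simp: add_id add_hom add_ob comp_id_left comp_zero_left)
      then show ?thesis using True by (simp add: sum.delta)
    qed (use f in \<open>auto simp: add_comp add_hom\<close>)
  qed
  show "cat_comp add xs xs ys f (cat_id add xs) = f"
  proof (intro ext)
    fix i k
    show "cat_comp add xs xs ys f (cat_id add xs) i k = f i k"
    proof (cases "i < length ys \<and> k < length xs")
      case True
      have "cat_comp add xs xs ys f (cat_id add xs) i k = (\<Sum>j<length xs. if j = k then f i k else 0)"
        unfolding add_comp if_P[OF True] using True ob f
        by (intro sum.cong) (auto simp: add_id add_hom add_ob comp_id_right comp_zero_right)
      then show ?thesis using True by (simp add: sum.delta)
    qed (use f in \<open>auto simp: add_comp add_hom\<close>)
  qed
next
  fix xs ys zs :: "'o list" and f g g' :: "nat \<Rightarrow> nat \<Rightarrow> 'm"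
  assume ob: "xs \<in> cat_ob add" "ys \<in> cat_ob add" "zs \<in> cat_ob add"
    and f: "f \<in> cat_hom add xs ys" and g: "g \<in> cat_hom add ys zs" "g' \<in> cat_hom add ys zs"
  show "cat_comp add xs ys zs (g + g') f = cat_comp add xs ys zs g f + cat_comp add xs ys zs g' f"
    using ob f g
    by (auto simp: fun_eq_iff add_hom add_ob add_comp comp_add_left sum.distrib[symmetric] intro!: sum.cong)
next
  fix xs ys zs :: "'o list" and f f' g :: "nat \<Rightarrow> nat \<Rightarrow> 'm"
  assume ob: "xs \<in> cat_ob add" "ys \<in> cat_ob add" "zs \<in> cat_ob add"
    and f: "f \<in> cat_hom add xs ys" "f' \<in> cat_hom add xs ys" and g: "g \<in> cat_hom add ys zs"
  show "cat_comp add xs ys zs g (f + f') = cat_comp add xs ys zs g f + cat_comp add xs ys zs g f'"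
    using ob f g
    by (auto simp: fun_eq_iff add_hom add_ob add_comp comp_add_right sum.distrib[symmetric] intro!: sum.cong)
qed (auto simp: add_hom add_ob add_id hom_zero hom_add hom_uminus hom_id)

end

lemma (in linear_category) linear_add:
  "linear_category add (\<lambda>c M i j. c *s M i j)"
proof -
  interpret A: preadditive_category add by (rule preadditive_add)
  interpret V: vector_space "\<lambda>c (M :: nat \<Rightarrow> nat \<Rightarrow> 'm) i j. c *s M i j"
    by unfold_locales (auto simp: fun_eq_iff scale_right_distrib scale_left_distrib)
  show ?thesis
  proof unfold_locales
    fix xs ys assume ob: "xs \<in> cat_ob add" "ys \<in> cat_ob add"
    \<comment> \<open>The matrix with the single entry d in position (i, j). Letting d run through
      spanning sets of the entry spaces gives a finite spanning set of matrices.\<close>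
    define E where "E i j d = (\<lambda>i' j'. if i' = i \<and> j' = j then d else 0 :: 'm)" for i j :: nat and d
    have "\<exists>B. finite B \<and> cat_hom C (xs ! j) (ys ! i) \<subseteq> span B" if "i < length ys" "j < length xs" for i j
      using that ob hom_finite by (simp add: add_ob)
    then obtain B where B: "\<And>i j. i < length ys \<Longrightarrow> j < length xs \<Longrightarrow> finite (B i j) \<and> cat_hom C (xs ! j) (ys ! i) \<subseteq> span (B i j)"
      by metis
    define BB where "BB = (\<Union>i<length ys. \<Union>j<length xs. E i j ` B i j)"
    have "finite BB" using B by (auto simp: BB_def)
    moreover have "M \<in> V.span BB" if M: "M \<in> cat_hom add xs ys" for M
    proof -
      have lin: "E i j d \<in> V.span BB" if ij: "i < length ys" "j < length xs" "d \<in> span (B i j)" for i j d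
        using ij(3)
      proof (induction rule: span_induct_alt)
        case base
        have "E i j 0 = 0" by (auto simp: E_def fun_eq_iff)
        then show ?case using V.span_zero by metis
      next
        case (step c x y)
        have "E i j (c *s x + y) = (\<lambda>a b. c *s E i j x a b) + E i j y"
          by (auto simp: E_def fun_eq_iff)
        moreover have "E i j x \<in> BB" using step ij by (auto simp: BB_def)
        ultimately show ?case using step V.span_add V.span_scale V.span_base by metis
      qed
      have "M = (\<Sum>i<length ys. \<Sum>j<length xs. E i j (M i j))"
      proof (intro ext)
        fix a b
        have "(\<Sum>i<length ys. \<Sum>j<length xs. E i j (M i j)) a b = (\<Sum>i<length ys. \<Sum>j<length xs. E i j (M i j) a b)"
          by (simp add: sum_fun_apply)
        also have "\<dots> = (\<Sum>i<length ys. if i = a then (\<Sum>j<length xs. if j = b then M a b else 0) else 0)"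
          by (rule sum.cong) (auto simp: E_def intro!: sum.cong)
        also have "\<dots> = M a b" using M by (auto simp: sum.delta add_hom)
        finally show "M a b = (\<Sum>i<length ys. \<Sum>j<length xs. E i j (M i j)) a b" by simp
      qed
      moreover have "\<dots> \<in> V.span BB"
      proof (intro V.span_sum lin)
        fix i j assume "i \<in> {..<length ys}" "j \<in> {..<length xs}"
        then show "M i j \<in> span (B i j)" using B[of i j] M by (auto simp: add_hom)
      qed auto
      ultimately show ?thesis by simp
    qed
    ultimately show "\<exists>B. finite B \<and> cat_hom add xs ys \<subseteq> V.span B" by blast
  qed (auto simp: fun_eq_iff add_hom add_ob add_comp hom_scale comp_scale_left comp_scale_right scale_sum_right intro!: sum.cong)
qed

section \<open>Connected components and contraction\<close>

text \<open>Edges are arbitrary sets of points, so that the result of a contraction can serve as an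
  edge set again. Every point of the type is related to itself.\<close>

definition conn :: "'a set set \<Rightarrow> 'a rel" where
  "conn E = {(x, y). \<exists>p \<in> E. x \<in> p \<and> y \<in> p}\<^sup>*"

definition comps :: "'a set set \<Rightarrow> 'a set set" where
  "comps E = (\<lambda>x. conn E `` {x}) ` \<Union>E"

text \<open>This is \<open>star\<close> for an arbitrary point type and an arbitrary set M of hidden
  points; removing the empty set discards the closed loops, the components that lie wholly in
  M.\<close>

definition contract :: "'a set \<Rightarrow> 'a set set \<Rightarrow> 'a set set" where
  "contract M E = (\<lambda>c. c - M) ` comps E - {{}}"

definition nloops :: "'a set \<Rightarrow> 'a set set \<Rightarrow> nat" where
  "nloops M E = card {c \<in> comps E. c \<subseteq> M}"

lemma components_eq_comps: "components E = comps E"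
  by (auto simp: components_def comps_def quotient_def conn_def)

lemma conn_refl [simp]: "(x, x) \<in> conn E"
  by (simp add: conn_def)

lemma conn_trans: "(x, y) \<in> conn E \<Longrightarrow> (y, z) \<in> conn E \<Longrightarrow> (x, z) \<in> conn E"
  by (simp add: conn_def)

lemma conn_sym: "(x, y) \<in> conn E \<Longrightarrow> (y, x) \<in> conn E"
  unfolding conn_def by (rule symD[OF sym_rtrancl]) (auto simp: sym_def)

lemma conn_edge: "p \<in> E \<Longrightarrow> x \<in> p \<Longrightarrow> y \<in> p \<Longrightarrow> (x, y) \<in> conn E"
  unfolding conn_def by (rule r_into_rtrancl) auto

lemma conn_induct [consumes 1, case_names refl step]:
  assumes "(x, y) \<in> conn E" "P x"
    and "\<And>y z p. (x, y) \<in> conn E \<Longrightarrow> P y \<Longrightarrow> p \<in> E \<Longrightarrow> y \<in> p \<Longrightarrow> z \<in> p \<Longrightarrow> P z"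
  shows "P y"
  using assms(1) unfolding conn_def
proof (induction rule: rtrancl_induct)
  case (step y z)
  then show ?case using assms(3)[of y _ z] by (auto simp: conn_def)
qed (rule assms(2))

lemma conn_mono: "E \<subseteq> F \<Longrightarrow> conn E \<subseteq> conn F"
  unfolding conn_def by (intro rtrancl_mono) auto

lemma conn_in_Union: "(x, y) \<in> conn E \<Longrightarrow> x \<noteq> y \<Longrightarrow> y \<in> \<Union>E"
  by (induction rule: conn_induct) auto

lemma conn_class_eq: "(x, y) \<in> conn E \<Longrightarrow> conn E `` {x} = conn E `` {y}"
  using conn_trans conn_sym by (metis (no_types, lifting) Image_singleton_iff subsetI subset_antisym)

lemma comps_subset: "c \<in> comps E \<Longrightarrow> c \<subseteq> \<Union>E"
proof
  fix y assume "c \<in> comps E" "y \<in> c"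
  then obtain x where "x \<in> \<Union>E" "(x, y) \<in> conn E" by (auto simp: comps_def)
  then show "y \<in> \<Union>E" using conn_in_Union by (cases "x = y") auto
qed

lemma comps_memD: "c \<in> comps E \<Longrightarrow> x \<in> c \<Longrightarrow> c = conn E `` {x}"
  using conn_class_eq by (fastforce simp: comps_def)

lemma comps_of_point: "x \<in> \<Union>E \<Longrightarrow> conn E `` {x} \<in> comps E"
  by (auto simp: comps_def)

lemma comps_nonempty: "c \<in> comps E \<Longrightarrow> c \<noteq> {}"
proof -
  assume "c \<in> comps E"
  then obtain x where "c = conn E `` {x}" by (auto simp: comps_def)
  then have "x \<in> c" by simp
  then show ?thesis by blast
qed

lemma comps_partition: "partition_on (\<Union>E) (comps E)"
proof (rule partition_onI)
  show "\<Union>(comps E) = \<Union>E"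
  proof (intro equalityI subsetI)
    fix x assume "x \<in> \<Union>E"
    then have "conn E `` {x} \<in> comps E" by (rule comps_of_point)
    moreover have "x \<in> conn E `` {x}" by simp
    ultimately show "x \<in> \<Union>(comps E)" by blast
  qed (use comps_subset in blast)
  show "disjnt p q" if "p \<in> comps E" "q \<in> comps E" "p \<noteq> q" for p q
    using that comps_memD by (metis disjnt_iff)
qed (auto dest: comps_nonempty)

lemma comps_eqI:
  assumes part: "partition_on (\<Union>E) C"
    and cover: "\<And>p. p \<in> E \<Longrightarrow> \<exists>c\<in>C. p \<subseteq> c"
    and connected: "\<And>c x y. c \<in> C \<Longrightarrow> x \<in> c \<Longrightarrow> y \<in> c \<Longrightarrow> (x, y) \<in> conn E"
  shows "comps E = C"
proof -
  have *: "conn E `` {x} = c" if c: "c \<in> C" "x \<in> c" for c x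
  proof (intro equalityI subsetI)
    fix y assume "y \<in> conn E `` {x}"
    then have "(x, y) \<in> conn E" by simp
    then show "y \<in> c"
    proof (induction rule: conn_induct)
      case (step y z p)
      then obtain c' where "c' \<in> C" "p \<subseteq> c'" using cover by blast
      then have "c' = c" using step c partition_onD2[OF part] by (auto dest: disjointD)
      then show ?case using \<open>p \<subseteq> c'\<close> step by auto
    qed (rule c)
  qed (use connected c in auto)
  have U: "\<Union>C = \<Union>E" using part by (simp add: partition_on_def)
  show ?thesis
  proof (intro equalityI subsetI)
    fix c assume "c \<in> comps E"
    then obtain x where "x \<in> \<Union>E" "c = conn E `` {x}" by (auto simp: comps_def)
    then show "c \<in> C" using * U by (metis UnionE)
  next
    fix c assume c: "c \<in> C"
    then obtain x where "x \<in> c" using partition_onD3[OF part] by (metis ex_in_conv)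
    then show "c \<in> comps E" using * c U comps_of_point by (metis UnionI)
  qed
qed

lemma conn_image:
  assumes "inj_on f (\<Union>E)" "x \<in> \<Union>E"
  shows "conn ((`) f ` E) `` {f x} = f ` (conn E `` {x})"
proof (intro equalityI subsetI)
  fix z assume "z \<in> conn ((`) f ` E) `` {f x}"
  then have "(f x, z) \<in> conn ((`) f ` E)" by simp
  then show "z \<in> f ` (conn E `` {x})"
  proof (induction rule: conn_induct)
    case (step y z p)
    then obtain y' z' q where y: "y = f y'" "(x, y') \<in> conn E" and q: "q \<in> E" "p = f ` q"
      and z: "z = f z'" "z' \<in> q" by auto
    have "y' \<in> \<Union>E" using y(2) assms(2) conn_in_Union by (cases "x = y'") auto
    have "f y' \<in> f ` q" using step.hyps y(1) q(2) by simp
    then have "y' \<in> q" using inj_on_image_mem_iff[OF assms(1) \<open>y' \<in> \<Union>E\<close>, of q] q(1) by blast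
    then have "(x, z') \<in> conn E" using y z q conn_trans conn_edge[of q E y' z'] by metis
    then show ?case using z by blast
  qed auto
next
  fix z assume "z \<in> f ` (conn E `` {x})"
  then obtain y where y: "(x, y) \<in> conn E" "z = f y" by auto
  from y(1) have "(f x, f y) \<in> conn ((`) f ` E)"
  proof (induction rule: conn_induct)
    case (step y z p)
    then show ?case using conn_trans conn_edge[of "f ` p"] by (metis imageI)
  qed simp
  then show "z \<in> conn ((`) f ` E) `` {f x}" using y by simp
qed

lemma comps_image:
  assumes "inj_on f (\<Union>E)"
  shows "comps ((`) f ` E) = (`) f ` comps E"
proof -
  have "\<Union>((`) f ` E) = f ` \<Union>E" by auto
  then show ?thesis
    unfolding comps_def using conn_image[OF assms] by (force simp: image_image)
qed

lemma contract_memI: "c \<in> comps E \<Longrightarrow> x \<in> c \<Longrightarrow> x \<notin> M \<Longrightarrow> c - M \<in> contract M E"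
  by (auto simp: contract_def)

lemma contract_image:
  assumes "inj_on f (\<Union>E)" "\<And>x. x \<in> \<Union>E \<Longrightarrow> f x \<in> M' \<longleftrightarrow> x \<in> M"
  shows "contract M' ((`) f ` E) = (`) f ` contract M E"
    and "nloops M' ((`) f ` E) = nloops M E"
proof -
  have d: "f ` c - M' = f ` (c - M)" if "c \<in> comps E" for c
    using comps_subset[OF that] assms(2) by auto
  show "contract M' ((`) f ` E) = (`) f ` contract M E"
  proof -
    have "(\<lambda>c. c - M') ` (`) f ` comps E = (`) f ` (\<lambda>c. c - M) ` comps E"
      unfolding image_image using d by (intro image_cong) auto
    moreover have "(`) f ` A - {{}} = (`) f ` (A - {{}})" for A :: "'a set set" by auto
    ultimately show ?thesis unfolding contract_def comps_image[OF assms(1)] by simp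
  qed
  have "{c \<in> comps ((`) f ` E). c \<subseteq> M'} = (`) f ` {c \<in> comps E. c \<subseteq> M}"
  proof -
    have "f ` c \<subseteq> M' \<longleftrightarrow> c \<subseteq> M" if "c \<in> comps E" for c
      using comps_subset[OF that] assms(2) by blast
    then show ?thesis unfolding comps_image[OF assms(1)] by auto
  qed
  moreover have "inj_on ((`) f) {c \<in> comps E. c \<subseteq> M}"
  proof (rule inj_onI)
    fix c d assume "c \<in> {c \<in> comps E. c \<subseteq> M}" "d \<in> {c \<in> comps E. c \<subseteq> M}" "f ` c = f ` d"
    then show "c = d" using inj_on_image_eq_iff[OF assms(1), of c d] comps_subset[of c] comps_subset[of d] by simp
  qed
  ultimately show "nloops M' ((`) f ` E) = nloops M E"
    by (simp add: nloops_def card_image)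
qed

lemma contract_partition: "partition_on (\<Union>E - M) (contract M E)"
proof (rule partition_onI)
  show "\<Union>(contract M E) = \<Union>E - M"
  proof -
    have "\<Union>(contract M E) = \<Union>(comps E) - M" by (auto simp: contract_def)
    then show ?thesis using comps_partition[of E] by (simp add: partition_on_def)
  qed
  show "disjnt p q" if "p \<in> contract M E" "q \<in> contract M E" "p \<noteq> q" for p q
    using that comps_memD[of _ E] unfolding contract_def disjnt_iff by blast
qed (auto simp: contract_def)

text \<open>Edges of F avoid M, so a path that enters M must stay in E until it leaves M again; such
  an excursion is replaced by one contracted edge.\<close>

lemma contract_conn:
  assumes disj: "M \<inter> \<Union>F = {}" and x: "x \<notin> M"
  shows "conn (contract M E \<union> F) `` {x} = conn (E \<union> F) `` {x} - M"
proof (intro equalityI subsetI)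
  fix y assume "y \<in> conn (contract M E \<union> F) `` {x}"
  then have "(x, y) \<in> conn (contract M E \<union> F)" by simp
  then have "(x, y) \<in> conn (E \<union> F) \<and> y \<notin> M"
  proof (induction rule: conn_induct)
    case (step y z p)
    show ?case
    proof (cases "p \<in> F")
      case True
      then have "z \<notin> M" "(y, z) \<in> conn (E \<union> F)" using step disj conn_edge[of p "E \<union> F" y z] by auto
      then show ?thesis using step conn_trans[of x y _ z] by blast
    next
      case False
      then obtain c where "c \<in> comps E" "p = c - M" using step by (auto simp: contract_def)
      then have "(y, z) \<in> conn E" "z \<notin> M" using step comps_memD[of c E y] by auto
      then show ?thesis using conn_mono[of E "E \<union> F"] step conn_trans[of x y _ z] by blast
    qed
  qed (use x in simp)
  then show "y \<in> conn (E \<union> F) `` {x} - M" by simp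
next
  have lift: "(w, y) \<in> conn (contract M E \<union> F)" if "(w, y) \<in> conn E" "w \<notin> M" "y \<notin> M" for w y
  proof (cases "w = y")
    case False
    then have "y \<in> \<Union>E" using that conn_in_Union by metis
    then have "conn E `` {y} - M \<in> contract M E"
      using that comps_of_point[of y E] contract_memI[of "conn E `` {y}" E y M] by simp
    then show ?thesis
      using that conn_edge[of "conn E `` {y} - M" "contract M E \<union> F" w y] conn_sym[of w y E] by auto
  qed simp
  fix y assume "y \<in> conn (E \<union> F) `` {x} - M"
  then have y: "(x, y) \<in> conn (E \<union> F)" "y \<notin> M" by auto
  \<comment> \<open>The current endpoint may lie in M, where the contracted graph does not reach.
    The invariant therefore keeps a visible point w that is joined to it inside E.\<close>
  from y(1) have "\<exists>w. w \<notin> M \<and> (x, w) \<in> conn (contract M E \<union> F) \<and> (w, y) \<in> conn E"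
  proof (induction rule: conn_induct)
    case (step y z p)
    then obtain w where w: "w \<notin> M" "(x, w) \<in> conn (contract M E \<union> F)" "(w, y) \<in> conn E" by blast
    show ?case
    proof (cases "p \<in> F")
      case True
      then have "y \<notin> M" "z \<notin> M" using disj step by auto
      then have "(x, z) \<in> conn (contract M E \<union> F)"
        using w(2) lift[OF w(3,1)] True step.hyps conn_edge[of p "contract M E \<union> F" y z]
          conn_trans[of x w _ y] conn_trans[of x y _ z] by blast
      then show ?thesis using \<open>z \<notin> M\<close> by auto
    next
      case False
      then have "(w, z) \<in> conn E" using w(3) step.hyps conn_edge[of p E y z] conn_trans[of w y E z] by blast
      then show ?thesis using w by blast
    qed
  qed (use x in auto)
  then show "y \<in> conn (contract M E \<union> F) `` {x}"
    using lift y conn_trans by (metis Image_singleton_iff)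
qed

text \<open>Components with a visible point become those of the contracted graph, and distinct ones
  stay distinct because they are disjoint. Components hidden in M cannot use F and are already
  components of E.\<close>

lemma contract_comps:
  assumes disj: "M \<inter> \<Union>F = {}"
  shows "(\<lambda>c. c - M) ` {c \<in> comps (E \<union> F). \<not> c \<subseteq> M} = comps (contract M E \<union> F)"
    and "inj_on (\<lambda>c. c - M) {c \<in> comps (E \<union> F). \<not> c \<subseteq> M}"
    and "{c \<in> comps (E \<union> F). c \<subseteq> M} = {c \<in> comps E. c \<subseteq> M}"
proof -
  have U: "\<Union>(contract M E \<union> F) = \<Union>(E \<union> F) - M"
    using contract_partition[of E M] disj by (auto simp: partition_on_def)
  show "(\<lambda>c. c - M) ` {c \<in> comps (E \<union> F). \<not> c \<subseteq> M} = comps (contract M E \<union> F)"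
  proof (intro equalityI subsetI)
    fix d assume "d \<in> (\<lambda>c. c - M) ` {c \<in> comps (E \<union> F). \<not> c \<subseteq> M}"
    then obtain c x where c: "c \<in> comps (E \<union> F)" "d = c - M" "x \<in> c" "x \<notin> M" by auto
    then have "c = conn (E \<union> F) `` {x}" "x \<in> \<Union>(E \<union> F)"
      using comps_memD[OF c(1,3)] comps_subset[OF c(1)] c(3) by blast+
    then have "x \<in> \<Union>(contract M E \<union> F)" "d = conn (contract M E \<union> F) `` {x}"
      using c U contract_conn[OF disj c(4), of E] by blast+
    then show "d \<in> comps (contract M E \<union> F)" using comps_of_point by metis
  next
    fix d assume "d \<in> comps (contract M E \<union> F)"
    then obtain x where x: "x \<in> \<Union>(E \<union> F)" "x \<notin> M" "d = conn (contract M E \<union> F) `` {x}"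
      using U by (auto simp: comps_def)
    then have "d = conn (E \<union> F) `` {x} - M" using contract_conn[OF disj] by blast
    moreover have "conn (E \<union> F) `` {x} \<in> comps (E \<union> F)" using x(1) by (rule comps_of_point)
    moreover have "x \<in> conn (E \<union> F) `` {x}" by simp
    then have "\<not> conn (E \<union> F) `` {x} \<subseteq> M" using x(2) by blast
    ultimately show "d \<in> (\<lambda>c. c - M) ` {c \<in> comps (E \<union> F). \<not> c \<subseteq> M}" by blast
  qed
  show "inj_on (\<lambda>c. c - M) {c \<in> comps (E \<union> F). \<not> c \<subseteq> M}"
  proof (rule inj_onI)
    fix c d assume c: "c \<in> {c \<in> comps (E \<union> F). \<not> c \<subseteq> M}" and d: "d \<in> {c \<in> comps (E \<union> F). \<not> c \<subseteq> M}"
      and "c - M = d - M"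
    then obtain x where "x \<in> c" "x \<in> d" by blast
    then show "c = d" using comps_memD c d by (metis (no_types, lifting) mem_Collect_eq)
  qed
  have *: "conn (E \<union> F) `` {x} = conn E `` {x}" if "conn E `` {x} \<subseteq> M" for x
  proof (intro equalityI subsetI)
    fix y assume "y \<in> conn (E \<union> F) `` {x}"
    then have "(x, y) \<in> conn (E \<union> F)" by simp
    then have "(x, y) \<in> conn E"
    proof (induction rule: conn_induct)
      case (step y z p)
      then have "y \<in> M" using that by auto
      then have "p \<in> E" using step disj by auto
      then show ?case using step conn_trans conn_edge by metis
    qed simp
    then show "y \<in> conn E `` {x}" by simp
  qed (use conn_mono[of E "E \<union> F"] in auto)
  have sub: "conn E `` {x} \<subseteq> conn (E \<union> F) `` {x}" for x using conn_mono[of E "E \<union> F"] by auto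
  show "{c \<in> comps (E \<union> F). c \<subseteq> M} = {c \<in> comps E. c \<subseteq> M}"
  proof (intro equalityI subsetI)
    fix c assume "c \<in> {c \<in> comps (E \<union> F). c \<subseteq> M}"
    then obtain x where x: "x \<in> \<Union>(E \<union> F)" "c = conn (E \<union> F) `` {x}" "c \<subseteq> M" by (auto simp: comps_def)
    moreover have "x \<in> conn (E \<union> F) `` {x}" by simp
    ultimately have "x \<in> \<Union>E" using disj by blast
    moreover have "c = conn E `` {x}" using * sub x by blast
    ultimately show "c \<in> {c \<in> comps E. c \<subseteq> M}" using x(3) comps_of_point[of x E] by simp
  next
    fix c assume "c \<in> {c \<in> comps E. c \<subseteq> M}"
    then obtain x where x: "x \<in> \<Union>E" "c = conn E `` {x}" "c \<subseteq> M" by (auto simp: comps_def)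
    then show "c \<in> {c \<in> comps (E \<union> F). c \<subseteq> M}" using *[of x] comps_of_point[of x "E \<union> F"] by simp
  qed
qed

text \<open>Contraction can be done in stages; this is what makes stacking of diagrams
  associative.\<close>

lemma contract_contract:
  assumes disj: "M \<inter> \<Union>F = {}"
  shows "contract N (contract M E \<union> F) = contract (M \<union> N) (E \<union> F)"
proof -
  have "contract N (contract M E \<union> F) = (\<lambda>c. c - M - N) ` {c \<in> comps (E \<union> F). \<not> c \<subseteq> M} - {{}}"
    unfolding contract_def[of N] contract_comps(1)[OF disj, symmetric] by (simp add: image_image)
  also have "\<dots> = (\<lambda>c. c - (M \<union> N)) ` comps (E \<union> F) - {{}}" by auto
  finally show ?thesis by (simp add: contract_def)
qed

lemma finite_comps: "finite (\<Union>E) \<Longrightarrow> finite (comps E)"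
  by (simp add: comps_def)

text \<open>A hidden component either lies in M and closes in the first stage, or survives that
  stage and closes in the second.\<close>

lemma nloops_contract:
  assumes disj: "M \<inter> \<Union>F = {}" and fin: "finite (\<Union>(E \<union> F))"
  shows "nloops (M \<union> N) (E \<union> F) = nloops M E + nloops N (contract M E \<union> F)"
proof -
  let ?A = "{c \<in> comps (E \<union> F). c \<subseteq> M}" and ?B = "{c \<in> comps (E \<union> F). \<not> c \<subseteq> M \<and> c - M \<subseteq> N}"
  have f: "finite (comps (E \<union> F))" using fin by (rule finite_comps)
  have "{c \<in> comps (E \<union> F). c \<subseteq> M \<union> N} = ?A \<union> ?B" by auto
  then have "nloops (M \<union> N) (E \<union> F) = card ?A + card ?B"
    unfolding nloops_def using f by (simp add: card_Un_disjoint[of ?A ?B] disjoint_iff)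
  moreover have "card ?A = nloops M E" by (simp add: nloops_def contract_comps(3)[OF disj])
  moreover have "{d \<in> comps (contract M E \<union> F). d \<subseteq> N} = (\<lambda>c. c - M) ` ?B"
    unfolding contract_comps(1)[OF disj, symmetric] by auto
  moreover have "inj_on (\<lambda>c. c - M) ?B" by (rule inj_on_subset[OF contract_comps(2)[OF disj, of E]]) auto
  ultimately show ?thesis by (simp add: nloops_def[of N] card_image)
qed

text \<open>The count is grown from a single vertex: as long as the set is not the whole component
  some edge leaves it, and adding the far end of that edge adds at least one edge.\<close>

lemma comps_card_le_edges:
  assumes "finite (\<Union>E)" "\<And>p. p \<in> E \<Longrightarrow> card p = 2" "c \<in> comps E"
  shows "card c \<le> card {p \<in> E. p \<subseteq> c} + 1"
proof -
  have finc: "finite c" using finite_subset[OF comps_subset[OF assms(3)] assms(1)] .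
  have finE: "finite E" using assms(1) finite_UnionD by blast
  obtain x where x: "x \<in> c" "c = conn E `` {x}" using assms(3) comps_nonempty comps_memD by (metis ex_in_conv)
  define P where "P S \<longleftrightarrow> x \<in> S \<and> S \<subseteq> c \<and> card S \<le> card {p \<in> E. p \<subseteq> S} + 1" for S
  have "P {x}" using x by (simp add: P_def)
  moreover have "card S < Suc (card c)" if "P S" for S
    using that finc by (simp add: P_def card_mono less_Suc_eq_le)
  ultimately obtain S where S: "P S" and max: "\<And>T. P T \<Longrightarrow> card T \<le> card S"
    using ex_has_greatest_nat[of P "{x}" card "Suc (card c)"] by blast
  have finS: "finite S" using S finc finite_subset by (auto simp: P_def)
  have "S = c"
  proof (rule ccontr)
    assume "S \<noteq> c"
    then obtain y where y: "y \<in> c" "y \<notin> S" using S by (auto simp: P_def)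
    have "\<exists>a b p. a \<in> S \<and> b \<notin> S \<and> p \<in> E \<and> a \<in> p \<and> b \<in> p"
    proof (rule ccontr)
      assume no: "\<not> ?thesis"
      have "(x, y) \<in> conn E" using x y by auto
      then have "y \<in> S"
      proof (induction rule: conn_induct)
        case (step y z p)
        then show ?case using no by blast
      qed (use S in \<open>simp add: P_def\<close>)
      then show False using y by simp
    qed
    then obtain a b p where ab: "a \<in> S" "b \<notin> S" "p \<in> E" "a \<in> p" "b \<in> p" by blast
    have p: "p = {a, b}" using assms(2)[OF ab(3)] ab by (auto simp: card_2_iff)
    have "b \<in> c" using ab S comps_memD[OF assms(3), of a] conn_edge[of p E a b] by (auto simp: P_def)
    have "insert p {p \<in> E. p \<subseteq> S} \<subseteq> {p \<in> E. p \<subseteq> insert b S}" using ab p by auto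
    then have "card (insert p {p \<in> E. p \<subseteq> S}) \<le> card {p \<in> E. p \<subseteq> insert b S}"
      using finE by (intro card_mono) auto
    moreover have "p \<notin> {p \<in> E. p \<subseteq> S}" using ab by auto
    ultimately have "P (insert b S)"
      using S ab \<open>b \<in> c\<close> finS finE by (simp add: P_def)
    from max[OF this] show False using ab finS by simp
  qed
  then show ?thesis using S by (simp add: P_def)
qed

section \<open>Perfect matchings\<close>

definition pairing_on :: "'a set \<Rightarrow> 'a set set \<Rightarrow> bool" where
  "pairing_on X P \<longleftrightarrow> partition_on X P \<and> (\<forall>p\<in>P. card p = 2)"

lemma pairing_on_card:
  assumes P: "pairing_on X P" and fin: "finite X" and closed: "\<And>p. p \<in> P \<Longrightarrow> p \<inter> c \<noteq> {} \<Longrightarrow> p \<subseteq> c"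
  shows "card (c \<inter> X) = 2 * card {p \<in> P. p \<subseteq> c}"
proof -
  have U: "c \<inter> X = \<Union>{p \<in> P. p \<subseteq> c}"
    using P closed by (auto simp: pairing_on_def partition_on_def)
  have "finite P" using P fin by (meson finite_elements pairing_on_def)
  moreover have "disjoint {p \<in> P. p \<subseteq> c}"
    using P by (auto simp: pairing_on_def partition_on_def intro: pairwise_subset)
  ultimately have "card (\<Union>{p \<in> P. p \<subseteq> c}) = (\<Sum>p\<in>{p \<in> P. p \<subseteq> c}. card p)"
    using P by (intro card_Union_disjoint) (auto simp: pairing_on_def card_2_iff)
  also have "\<dots> = (\<Sum>p\<in>{p \<in> P. p \<subseteq> c}. 2)" using P by (intro sum.cong) (auto simp: pairing_on_def)
  finally show ?thesis using U by simp
qed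

text \<open>
  A component of a union of two matchings is a path or a cycle: it is a connected graph, hence has
  at least as many edges as vertices minus one, while the number of edges is half the degree sum.
\<close>

lemma pairing_on_contract:
  assumes P: "pairing_on (B \<union> M) P" and Q: "pairing_on (M \<union> T) Q"
    and fin: "finite B" "finite M" "finite T" and disj: "B \<inter> M = {}" "B \<inter> T = {}" "M \<inter> T = {}"
    and MN: "M \<subseteq> N" "N \<inter> (B \<union> T) = {}"
  shows "pairing_on (B \<union> T) (contract N (P \<union> Q))"
proof -
  have U: "\<Union>P = B \<union> M" "\<Union>Q = M \<union> T"
    using P Q by (auto simp: pairing_on_def partition_on_def)
  have "\<Union>(P \<union> Q) - N = B \<union> T" using U MN disj by auto
  then have part: "partition_on (B \<union> T) (contract N (P \<union> Q))" using contract_partition by metis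
  have "card (c - N) = 2" if c: "c \<in> comps (P \<union> Q)" "c - N \<noteq> {}" for c
  proof -
    have closed: "p \<subseteq> c" if "p \<in> P \<union> Q" "p \<inter> c \<noteq> {}" for p
      using that c(1) comps_memD[OF c(1)] conn_edge[of p "P \<union> Q"] by blast
    have sub: "c \<subseteq> B \<union> M \<union> T" using comps_subset[OF c(1)] U by auto
    have finc: "finite c" using sub fin finite_subset by blast
    have cN: "c - N = (c \<inter> B) \<union> (c \<inter> T)" using sub MN by auto
    have 1: "card (c \<inter> (B \<union> M)) = 2 * card {p \<in> P. p \<subseteq> c}"
      by (rule pairing_on_card[OF P]) (use fin closed in auto)
    have 2: "card (c \<inter> (M \<union> T)) = 2 * card {p \<in> Q. p \<subseteq> c}"
      by (rule pairing_on_card[OF Q]) (use fin closed in auto)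
    have 3: "card c \<le> card {p \<in> P \<union> Q. p \<subseteq> c} + 1"
      by (rule comps_card_le_edges[OF _ _ c(1)]) (use U fin P Q in \<open>auto simp: pairing_on_def\<close>)
    have "{p \<in> P \<union> Q. p \<subseteq> c} = {p \<in> P. p \<subseteq> c} \<union> {p \<in> Q. p \<subseteq> c}" by auto
    then have 4: "card {p \<in> P \<union> Q. p \<subseteq> c} \<le> card {p \<in> P. p \<subseteq> c} + card {p \<in> Q. p \<subseteq> c}"
      by (simp only: card_Un_le)
    have 5: "card (c \<inter> (B \<union> M)) = card (c \<inter> B) + card (c \<inter> M)"
      unfolding Int_Un_distrib using finc disj by (intro card_Un_disjoint) auto
    have 6: "card (c \<inter> (M \<union> T)) = card (c \<inter> M) + card (c \<inter> T)"
      unfolding Int_Un_distrib using finc disj by (intro card_Un_disjoint) auto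
    have 7: "card (c - N) = card (c \<inter> B) + card (c \<inter> T)"
      unfolding cN using finc disj by (intro card_Un_disjoint) auto
    have "c = (c \<inter> (B \<union> M)) \<union> (c \<inter> T)" using sub by auto
    then have 8: "card c = card (c \<inter> (B \<union> M)) + card (c \<inter> T)"
      using finc disj card_Un_disjoint[of "c \<inter> (B \<union> M)" "c \<inter> T"] by auto
    \<comment> \<open>Let the component have b bottom, t top and m middle points. Its edges number
      at most (b + t) / 2 + m, while connectedness gives b + t + m <= edges + 1, so b + t <= 2;
      parity and nonemptiness leave only 2.\<close>
    have "card (c - N) \<le> 2" using 1 2 3 4 5 6 7 8 by linarith
    moreover have "card (c - N) + 2 * card (c \<inter> M) = 2 * (card {p \<in> P. p \<subseteq> c} + card {p \<in> Q. p \<subseteq> c})"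
      using 1 2 unfolding 5 6 7 by simp
    then have "even (card (c - N))" by presburger
    moreover have "card (c - N) \<noteq> 0" using c(2) finc by auto
    ultimately show ?thesis by presburger
  qed
  then show ?thesis using part by (auto simp: pairing_on_def contract_def)
qed

definition relabel :: "'a set \<Rightarrow> ('a \<Rightarrow> 'a) \<Rightarrow> 'a \<Rightarrow> 'a" where
  "relabel M g x = (if x \<in> M then g x else x)"

text \<open>Each point m of M carries one extra edge to a fresh point g m. Contraction slides the
  endpoint m along that edge, so the matching P is merely renamed, the strands of \<open>Q0\<close>
  stay apart, and no component is hidden. The condition on N allows it to be infinite, as the set of
  all \<open>Mid\<close> points is.\<close>

lemma contract_relabel:
  assumes P: "disjoint P" "{} \<notin> P" and M: "M \<subseteq> \<Union>P"
    and g: "inj_on g M" "g ` M \<inter> \<Union>P = {}"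
    and Q0: "disjoint Q0" "{} \<notin> Q0" "\<Union>Q0 \<inter> (\<Union>P \<union> g ` M) = {}"
    and N: "N \<inter> (\<Union>P \<union> g ` M \<union> \<Union>Q0) = M"
  defines "E \<equiv> P \<union> ((\<lambda>m. {m, g m}) ` M \<union> Q0)"
  shows "contract N E = (`) (relabel M g) ` P \<union> Q0"
    and "nloops N E = 0"
proof -
  let ?h = "\<lambda>p. p \<union> g ` (p \<inter> M)"
  \<comment> \<open>Each block is an edge of P enlarged by the fresh points attached to its
    endpoints in M.\<close>
  define C where "C = ?h ` P \<union> Q0"
  have UE: "\<Union>E = \<Union>P \<union> g ` M \<union> \<Union>Q0" using M by (auto simp: E_def)
  have UP: "\<Union>(?h ` P) = \<Union>P \<union> g ` M" using M by auto
  have "partition_on (\<Union>E) C"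
  proof (rule partition_onI)
    show "\<Union>C = \<Union>E" unfolding C_def UE Union_Un_distrib UP ..
    show "{} \<notin> C" using P Q0 by (auto simp: C_def)
    fix p q assume pq: "p \<in> C" "q \<in> C" "p \<noteq> q"
    have 1: "disjnt (?h a) (?h b)" if "a \<in> P" "b \<in> P" "a \<noteq> b" for a b
    proof -
      have "a \<inter> b = {}" using that P by (auto dest: disjointD)
      then show ?thesis using that g by (auto simp: disjnt_def inj_on_def)
    qed
    have 2: "disjnt (?h a) b" if "a \<in> P" "b \<in> Q0" for a b
      using that Q0 by (auto simp: disjnt_def)
    show "disjnt p q"
    proof -
      have 3: "disjnt a b" if "a \<in> Q0" "b \<in> Q0" "a \<noteq> b" for a b
        using that Q0(1) by (simp add: pairwise_def)
      consider a b where "a \<in> P" "b \<in> P" "p = ?h a" "q = ?h b" | a where "a \<in> P" "p = ?h a" "q \<in> Q0"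
        | b where "b \<in> P" "p \<in> Q0" "q = ?h b" | "p \<in> Q0" "q \<in> Q0"
        using pq(1,2) unfolding C_def by blast
      then show ?thesis
      proof cases
        case 1
        then show ?thesis using \<open>\<And>a b. a \<in> P \<Longrightarrow> b \<in> P \<Longrightarrow> a \<noteq> b \<Longrightarrow> disjnt (?h a) (?h b)\<close>[of a b] pq(3) by metis
      next
        case 2
        then show ?thesis using \<open>\<And>a b. a \<in> P \<Longrightarrow> b \<in> Q0 \<Longrightarrow> disjnt (?h a) b\<close> by metis
      next
        case 3
        then show ?thesis using \<open>\<And>a b. a \<in> P \<Longrightarrow> b \<in> Q0 \<Longrightarrow> disjnt (?h a) b\<close> disjnt_sym by metis
      next
        case 4
        then show ?thesis using \<open>\<And>a b. a \<in> Q0 \<Longrightarrow> b \<in> Q0 \<Longrightarrow> a \<noteq> b \<Longrightarrow> disjnt a b\<close> pq(3) by metis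
      qed
    qed
  qed
  moreover have "\<exists>c\<in>C. p \<subseteq> c" if "p \<in> E" for p
  proof -
    consider "p \<in> P" | m where "m \<in> M" "p = {m, g m}" | "p \<in> Q0" using \<open>p \<in> E\<close> by (auto simp: E_def)
    then show ?thesis
    proof cases
      case 1
      then show ?thesis unfolding C_def by (intro bexI[of _ "?h p"]) auto
    next
      case 2
      then obtain q where "q \<in> P" "m \<in> q" using M by auto
      then show ?thesis unfolding C_def using 2 by (intro bexI[of _ "?h q"]) auto
    next
      case 3
      then show ?thesis by (auto simp: C_def)
    qed
  qed
  moreover have "(x, y) \<in> conn E" if c: "c \<in> C" "x \<in> c" "y \<in> c" for c x y
  proof (cases "c \<in> Q0")
    case True
    then show ?thesis using conn_edge[of c E x y] c by (auto simp: E_def)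
  next
    case False
    then obtain p where p: "p \<in> P" "c = ?h p" using c by (auto simp: C_def)
    have to_p: "\<exists>w\<in>p. (z, w) \<in> conn E" if z: "z \<in> c" for z
    proof (cases "z \<in> p")
      case False
      then obtain m where "m \<in> p" "m \<in> M" "z = g m" using z p by auto
      then show ?thesis using conn_edge[of "{m, g m}" E "g m" m] by (auto simp: E_def)
    next
      case True
      then show ?thesis using conn_refl[of z E] by (rule bexI[rotated])
    qed
    obtain w w' where "w \<in> p" "(x, w) \<in> conn E" "w' \<in> p" "(y, w') \<in> conn E"
      using to_p c by blast
    moreover have "(w, w') \<in> conn E" using calculation conn_edge[of p E w w'] p by (auto simp: E_def)
    ultimately show ?thesis using conn_trans[of x w E w'] conn_trans[of x w' E y] conn_sym[of y w' E] by blast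
  qed
  ultimately have comps: "comps E = C" by (rule comps_eqI)
  have hN: "?h p - N = relabel M g ` p" if "p \<in> P" for p
  proof -
    have "p \<subseteq> \<Union>P" using that by auto
    then have "x \<in> N \<longleftrightarrow> x \<in> M" if "x \<in> p" for x using N that by auto
    moreover have "x \<notin> N" if "x \<in> g ` M" for x
    proof
      assume "x \<in> N"
      then have "x \<in> M" using N that by blast
      then show False using g(2) that M by blast
    qed
    ultimately show ?thesis by (auto simp: relabel_def)
  qed
  have qN: "q - N = q" "q \<inter> N = {}" if "q \<in> Q0" for q
  proof -
    have "M \<inter> q = {}" using that Q0 M by auto
    then show "q - N = q" "q \<inter> N = {}" using that N by auto
  qed
  have ne: "relabel M g ` p \<noteq> {}" if "p \<in> P" for p using that P(2) by fast
  show "contract N E = (`) (relabel M g) ` P \<union> Q0"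
    unfolding contract_def comps C_def image_Un image_image
    using hN qN(1) Q0(2) ne by (auto simp: image_iff)
  have "\<not> c \<subseteq> N" if c: "c \<in> C" for c
  proof -
    consider p where "p \<in> P" "c = ?h p" | "c \<in> Q0" using c unfolding C_def by blast
    then show ?thesis
    proof cases
      case 1
      then show ?thesis using hN[OF 1(1)] ne[OF 1(1)] by (metis Diff_eq_empty_iff)
    next
      case 2
      then show ?thesis using qN[OF 2] Q0(2) by (metis Int_absorb2)
    qed
  qed
  then have none: "{c \<in> C. c \<subseteq> N} = {}" by blast
  show "nloops N E = 0" unfolding nloops_def comps none by simp
qed

section \<open>Composition of Brauer diagrams\<close>

lemma brauer_diagrams_iff:
  "D \<in> brauer_diagrams r s \<longleftrightarrow> pairing_on (Bot ` {1..r} \<union> Top ` {1..s}) D"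
  by (simp add: brauer_diagrams_def pairing_on_def)

lemma pairing_on_image:
  assumes "pairing_on X P" "inj_on f X"
  shows "pairing_on (f ` X) ((`) f ` P)"
proof -
  have part: "partition_on X P" using assms by (simp add: pairing_on_def)
  have sub: "p \<subseteq> X" if "p \<in> P" for p using part that by (auto simp: partition_on_def)
  have "partition_on (f ` X) ((`) f ` P)"
  proof (rule partition_onI)
    show "\<Union>((`) f ` P) = f ` X" using part by (auto simp: partition_on_def)
    show "{} \<notin> (`) f ` P" using part by (auto simp: partition_on_def)
    fix p q assume "p \<in> (`) f ` P" "q \<in> (`) f ` P" "p \<noteq> q"
    then obtain p' q' where pq: "p' \<in> P" "q' \<in> P" "p = f ` p'" "q = f ` q'" "p' \<noteq> q'" by blast
    then have "p' \<inter> q' = {}" using part by (auto simp: partition_on_def dest: disjointD)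
    then show "disjnt p q"
      using pq inj_on_image_Int[OF assms(2) sub sub, of p' q'] by (auto simp: disjnt_def)
  qed
  moreover have "card (f ` p) = 2" if "p \<in> P" for p
    using that assms sub[OF that] card_image[OF inj_on_subset[OF assms(2)]] by (auto simp: pairing_on_def)
  ultimately show ?thesis by (auto simp: pairing_on_def)
qed

lemma pairing_on_Union: "pairing_on X P \<Longrightarrow> \<Union>P = X"
  by (simp add: pairing_on_def partition_on_def)

lemma diagram_no_Mid: "D \<in> brauer_diagrams r s \<Longrightarrow> p \<in> D \<Longrightarrow> x \<in> p \<Longrightarrow> x \<in> Bot ` {1..r} \<union> Top ` {1..s}"
  by (metis UnionI brauer_diagrams_iff pairing_on_Union)

lemma diagram_point:
  assumes "D \<in> brauer_diagrams r s" "p \<in> D" "x \<in> p"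
  obtains (Bot) i where "i \<in> {1..r}" "x = Bot i" | (Top) i where "i \<in> {1..s}" "x = Top i"
  using diagram_no_Mid[OF assms] by blast

lemma top_to_mid_pairing:
  assumes "G \<in> brauer_diagrams r s"
  shows "pairing_on (Bot ` {1..r} \<union> Mid ` {1..s}) ((`) top_to_mid ` G)"
proof -
  have "inj_on top_to_mid (Bot ` {1..r} \<union> Top ` {1..s})" by (auto simp: inj_on_def)
  from pairing_on_image[OF _ this] show ?thesis
    using assms by (simp add: brauer_diagrams_iff image_Un image_image)
qed

lemma bot_to_mid_pairing:
  assumes "H \<in> brauer_diagrams s t"
  shows "pairing_on (Mid ` {1..s} \<union> Top ` {1..t}) ((`) bot_to_mid ` H)"
proof -
  have "inj_on bot_to_mid (Bot ` {1..s} \<union> Top ` {1..t})" by (auto simp: inj_on_def)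
  from pairing_on_image[OF _ this] show ?thesis
    using assms by (simp add: brauer_diagrams_iff image_Un image_image)
qed

lemma star_eq_contract: "star H G = contract (range Mid) (stack H G)"
  by (simp add: star_def contract_def components_eq_comps)

lemma loops_eq_nloops: "loops H G = nloops (range Mid) (stack H G)"
  by (simp add: loops_def nloops_def components_eq_comps)

lemma star_in:
  assumes "G \<in> brauer_diagrams r s" "H \<in> brauer_diagrams s t"
  shows "star H G \<in> brauer_diagrams r t"
  unfolding star_eq_contract stack_def brauer_diagrams_iff
  by (rule pairing_on_contract[OF top_to_mid_pairing[OF assms(1)] bot_to_mid_pairing[OF assms(2)]]) auto

text \<open>
  For associativity, three stacked diagrams live on four layers of points; both bracketings are
  the contraction of the two middle layers at once.
\<close>

fun layer :: "nat \<Rightarrow> nat \<Rightarrow> nat \<Rightarrow> point \<Rightarrow> nat \<times> nat" where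
  "layer a b c (Bot i) = (a, i)"
| "layer a b c (Mid i) = (b, i)"
| "layer a b c (Top i) = (c, i)"

text \<open>The diagram drawn with its bottom on level a and its top on level c. Diagrams have no
  \<open>Mid\<close> points, so sending those to level a is a default value.\<close>

definition place :: "nat \<Rightarrow> nat \<Rightarrow> diagram \<Rightarrow> (nat \<times> nat) set set" where
  "place a c D = (`) (layer a a c) ` D"

lemma inj_layer: "a \<noteq> b \<Longrightarrow> b \<noteq> c \<Longrightarrow> a \<noteq> c \<Longrightarrow> inj_on (layer a b c) S"
proof (rule inj_onI)
  fix x y assume "layer a b c x = layer a b c y" "a \<noteq> b" "b \<noteq> c" "a \<noteq> c"
  then show "x = y" by (cases x; cases y) auto
qed

lemma place_eq: "D \<in> brauer_diagrams r s \<Longrightarrow> place a c D = (`) (layer a b c) ` D"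
  unfolding place_def by (intro image_cong refl) (auto dest: diagram_no_Mid)

lemma layer_stack:
  assumes "G \<in> brauer_diagrams r s" "H \<in> brauer_diagrams s t"
  shows "(`) (layer a b c) ` stack H G = place a b G \<union> place b c H"
proof -
  have "layer a b c ` top_to_mid ` p = layer a a b ` p" if "p \<in> G" for p
    unfolding image_image by (intro image_cong refl) (auto elim: diagram_point[OF assms(1) that])
  moreover have "layer a b c ` bot_to_mid ` p = layer b b c ` p" if "p \<in> H" for p
    unfolding image_image by (intro image_cong refl) (auto elim: diagram_point[OF assms(2) that])
  ultimately show ?thesis
    unfolding place_def stack_def image_Un by (simp add: image_image cong: image_cong)
qed

lemma place_star:
  assumes "G \<in> brauer_diagrams r s" "H \<in> brauer_diagrams s t" "a \<noteq> b" "b \<noteq> c" "a \<noteq> c"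
  shows "place a c (star H G) = contract ({b} \<times> UNIV) (place a b G \<union> place b c H)"
    and "loops H G = nloops ({b} \<times> UNIV) (place a b G \<union> place b c H)"
proof -
  have "layer a b c x \<in> {b} \<times> UNIV \<longleftrightarrow> x \<in> range Mid" for x
    using assms by (cases x) auto
  from contract_image[OF inj_layer[OF assms(3,4,5)] this]
  show "place a c (star H G) = contract ({b} \<times> UNIV) (place a b G \<union> place b c H)"
    and "loops H G = nloops ({b} \<times> UNIV) (place a b G \<union> place b c H)"
    unfolding layer_stack[OF assms(1,2), symmetric] place_eq[OF star_in[OF assms(1,2)], of a c b]
    by (simp_all add: star_eq_contract loops_eq_nloops)
qed

lemma place_disjoint: "a \<noteq> b \<Longrightarrow> a \<noteq> c \<Longrightarrow> D \<in> brauer_diagrams r s \<Longrightarrow> ({a} \<times> UNIV) \<inter> \<Union>(place b c D) = {}"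
  unfolding place_def by (auto dest!: diagram_no_Mid)

lemma finite_place: "D \<in> brauer_diagrams r s \<Longrightarrow> finite (\<Union>(place a c D))"
proof -
  assume "D \<in> brauer_diagrams r s"
  then have "\<Union>(place a c D) = layer a a c ` (Bot ` {1..r} \<union> Top ` {1..s})"
    unfolding brauer_diagrams_iff using pairing_on_Union[of _ D] by (simp add: place_def image_Union[symmetric])
  then show ?thesis by simp
qed

lemma star_assoc:
  assumes G: "G \<in> brauer_diagrams r s" and H: "H \<in> brauer_diagrams s t" and K: "K \<in> brauer_diagrams t u"
  shows "star K (star H G) = star (star K H) G"
    and "loops K (star H G) + loops H G = loops (star K H) G + loops K H"
proof -
  let ?G = "place 0 1 G" and ?H = "place 1 2 H" and ?K = "place 2 3 K"
  let ?M = "{1 :: nat} \<times> (UNIV :: nat set)" and ?N = "{2 :: nat} \<times> (UNIV :: nat set)"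
  have 1: "place 0 3 (star K (star H G)) = contract ?N (contract ?M (?G \<union> ?H) \<union> ?K)"
    using place_star(1)[OF star_in[OF G H] K, of 0 2 3] place_star(1)[OF G H, of 0 1 2] by simp
  have 2: "place 0 3 (star (star K H) G) = contract ?M (contract ?N (?H \<union> ?K) \<union> ?G)"
    using place_star(1)[OF G star_in[OF H K], of 0 1 3] place_star(1)[OF H K, of 1 2 3] by (simp add: Un_commute)
  have d: "?M \<inter> \<Union>?K = {}" "?N \<inter> \<Union>?G = {}" using place_disjoint G K by auto
  have "place 0 3 (star K (star H G)) = place 0 3 (star (star K H) G)"
    unfolding 1 2 contract_contract[OF d(1)] contract_contract[OF d(2)] by (simp add: ac_simps)
  \<comment> \<open>The diagram is read off from its picture on the outer levels, since labelling
    points by levels is injective.\<close>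
  then have "(`) (layer 0 1 3) ` (star K (star H G)) = (`) (layer 0 1 3) ` (star (star K H) G)"
    using place_eq[OF star_in[OF star_in[OF G H] K]] place_eq[OF star_in[OF G star_in[OF H K]]] by metis
  then show "star K (star H G) = star (star K H) G"
    using inj_image_eq_iff[of "(`) (layer 0 1 3)"] inj_image_eq_iff[OF inj_layer[of 0 1 3 UNIV]]
    by (simp add: inj_def[of "(`) (layer 0 (Suc 0) 3)"])
  have fin: "finite (\<Union>((?G \<union> ?H) \<union> ?K))" using finite_place G H K by auto
  \<comment> \<open>The loops on both middle levels form one total, which the two bracketings split
    differently.\<close>
  have "loops K (star H G) + loops H G = nloops (?M \<union> ?N) ((?G \<union> ?H) \<union> ?K)"
    using place_star(2)[OF star_in[OF G H] K, of 0 2 3] place_star(1)[OF G H, of 0 1 2]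
      place_star(2)[OF G H, of 0 1 2] nloops_contract[OF d(1) fin] by simp
  also have "\<dots> = nloops (?N \<union> ?M) ((?H \<union> ?K) \<union> ?G)" by (simp add: ac_simps)
  also have "\<dots> = loops (star K H) G + loops K H"
    using place_star(2)[OF G star_in[OF H K], of 0 1 3] place_star(1)[OF H K, of 1 2 3]
      place_star(2)[OF H K, of 1 2 3] nloops_contract[OF d(2), of "?H \<union> ?K"] fin by (simp add: ac_simps)
  finally show "loops K (star H G) + loops H G = loops (star K H) G + loops K H" .
qed

section \<open>Stacking with identities and partial permutations\<close>

fun map_bot :: "(nat \<Rightarrow> nat) \<Rightarrow> point \<Rightarrow> point" where
  "map_bot f (Bot i) = Bot (f i)"
| "map_bot f p = p"

text \<open>The lower diagram carries the points of X bijectively up to all its top points and joins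
  those of Y among themselves. None of its strands joins two top points, so stacking H only renames
  the bottom points of H and adds C. With Y empty this covers identities and permutations; with a
  single pair it serves to factor the other diagrams.\<close>

lemma star_partial_permutation:
  assumes \<alpha>: "bij_betw \<alpha> X {1..s}" and H: "H \<in> brauer_diagrams s t"
    and C: "pairing_on (Bot ` Y) C" "X \<inter> Y = {}"
  defines "G \<equiv> (\<lambda>x. {Bot x, Top (\<alpha> x)}) ` X \<union> C"
  shows "star H G = (`) (map_bot (inv_into X \<alpha>)) ` H \<union> C" "loops H G = 0"
proof -
  define \<beta> where "\<beta> = inv_into X \<alpha>"
  have \<beta>: "bij_betw \<beta> {1..s} X" "\<And>x. x \<in> X \<Longrightarrow> \<beta> (\<alpha> x) = x" "\<And>j. j \<in> {1..s} \<Longrightarrow> \<alpha> (\<beta> j) = j"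
    unfolding \<beta>_def using \<alpha> by (auto simp: bij_betw_inv_into bij_betw_inv_into_left bij_betw_inv_into_right)
  define M where "M = Mid ` {1..s}"
  define g where "g p = (case p of Mid j \<Rightarrow> Bot (\<beta> j) | _ \<Rightarrow> p)" for p
  let ?P = "(`) bot_to_mid ` H"
  have P: "pairing_on (M \<union> Top ` {1..t}) ?P" unfolding M_def by (rule bot_to_mid_pairing[OF H])
  have UP: "\<Union>?P = M \<union> Top ` {1..t}" using P by (rule pairing_on_Union)
  have UC: "\<Union>C = Bot ` Y" using C by (simp add: pairing_on_Union)
  have X: "X = \<beta> ` {1..s}" using \<beta>(1) by (simp add: bij_betw_def)
  have gM: "g ` M = Bot ` X" unfolding X M_def image_image by (simp add: g_def)
  have Cmid: "top_to_mid ` p = p" if "p \<in> C" for p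
  proof -
    have "p \<subseteq> Bot ` Y" using UC that by auto
    then have "top_to_mid x = x" if "x \<in> p" for x using that by auto
    then show ?thesis by (simp add: image_def)
  qed
  have t1: "(`) top_to_mid ` (\<lambda>x. {Bot x, Top (\<alpha> x)}) ` X = (\<lambda>m. {m, g m}) ` M"
    unfolding X M_def image_image using \<beta>(3) by (intro image_cong) (auto simp: g_def)
  have t2: "(`) top_to_mid ` C = C" using Cmid by simp
  have stack: "stack H G = ?P \<union> ((\<lambda>m. {m, g m}) ` M \<union> C)"
    unfolding stack_def G_def image_Un t1 t2 by (rule Un_commute)
  have 1: "disjoint ?P" "{} \<notin> ?P" "disjoint C" "{} \<notin> C"
    using P C by (auto simp: pairing_on_def partition_on_def)
  have "inj_on \<beta> {1..s}" using \<beta>(1) by (simp add: bij_betw_def)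
  then have 2: "inj_on g M"
    unfolding M_def g_def by (intro inj_onI) (auto simp: inj_on_eq_iff)
  have 3: "M \<subseteq> \<Union>?P" "g ` M \<inter> \<Union>?P = {}" "\<Union>C \<inter> (\<Union>?P \<union> g ` M) = {}"
    "range Mid \<inter> (\<Union>?P \<union> g ` M \<union> \<Union>C) = M"
    unfolding UP UC gM using C(2) by (auto simp: M_def)
  note rel = contract_relabel[OF 1(1,2) 3(1) 2 3(2) 1(3,4) 3(3,4), folded stack]
  show "loops H G = 0" using rel(2) by (simp add: loops_eq_nloops)
  have "relabel M g ` bot_to_mid ` p = map_bot \<beta> ` p" if "p \<in> H" for p
    unfolding image_image
    by (intro image_cong refl) (auto simp: M_def g_def relabel_def elim: diagram_point[OF H that])
  then have "(`) (relabel M g) ` ?P = (`) (map_bot \<beta>) ` H"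
    unfolding image_image[of _ _ H] by simp
  then show "star H G = (`) (map_bot (inv_into X \<alpha>)) ` H \<union> C"
    using rel(1) by (simp add: star_eq_contract \<beta>_def)
qed

lemma id_diagram_eq: "id_diagram r = (\<lambda>x. {Bot x, Top x}) ` {1..r}"
  by (auto simp: id_diagram_def)

lemma perm_diagram_eq: "perm_diagram r \<sigma> = (\<lambda>x. {Bot x, Top (\<sigma> x)}) ` {1..r}"
  by (auto simp: perm_diagram_def)

lemma pairing_on_empty: "pairing_on (f ` {}) {}"
  by (simp add: pairing_on_def partition_on_def)

lemma star_id_right:
  assumes "H \<in> brauer_diagrams s t" shows "star H (id_diagram s) = H" "loops H (id_diagram s) = 0"
proof -
  have "map_bot (inv_into {1..s} (\<lambda>x. x)) ` p = p" if "p \<in> H" for p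
  proof -
    have "map_bot (inv_into {1..s} (\<lambda>x. x)) x = x" if "x \<in> p" for x
      using diagram_no_Mid[OF assms \<open>p \<in> H\<close> that] by (auto intro: inv_into_f_eq)
    then show ?thesis by (simp add: image_def)
  qed
  then show "star H (id_diagram s) = H" "loops H (id_diagram s) = 0"
    using star_partial_permutation[of "\<lambda>x. x" "{1..s}" s H t "{}" "{}"] assms
      pairing_on_empty[of Bot] by (simp_all add: id_diagram_eq bij_betw_def)
qed

text \<open>The upside-down version: the vertical strands now lie above, so
  \<open>contract_relabel\<close> turns the middle points into top points.\<close>

lemma star_id_left:
  assumes G: "G \<in> brauer_diagrams r s" shows "star (id_diagram s) G = G" "loops (id_diagram s) G = 0"
proof -
  define M where "M = Mid ` {1..s}"
  define g where "g p = (case p of Mid j \<Rightarrow> Top j | _ \<Rightarrow> p)" for p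
  let ?P = "(`) top_to_mid ` G"
  have P: "pairing_on (Bot ` {1..r} \<union> M) ?P" unfolding M_def by (rule top_to_mid_pairing[OF G])
  have UP: "\<Union>?P = Bot ` {1..r} \<union> M" using P by (rule pairing_on_Union)
  have gM: "g ` M = Top ` {1..s}" unfolding M_def image_image by (simp add: g_def)
  have "(`) bot_to_mid ` id_diagram s = (\<lambda>m. {m, g m}) ` M"
    unfolding id_diagram_eq M_def image_image by (intro image_cong) (auto simp: g_def)
  then have stack: "stack (id_diagram s) G = ?P \<union> ((\<lambda>m. {m, g m}) ` M \<union> {})"
    unfolding stack_def by simp
  have 1: "disjoint ?P" "{} \<notin> ?P" using P by (auto simp: pairing_on_def partition_on_def)
  have 2: "inj_on g M" by (auto simp: inj_on_def g_def M_def)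
  have 3: "M \<subseteq> \<Union>?P" "g ` M \<inter> \<Union>?P = {}" "\<Union>{} \<inter> (\<Union>?P \<union> g ` M) = {}"
    "range Mid \<inter> (\<Union>?P \<union> g ` M \<union> \<Union>{}) = M"
    unfolding UP gM by (auto simp: M_def)
  have e: "disjoint {}" "{} \<notin> ({} :: point set set)" by auto
  note rel = contract_relabel[OF 1 3(1) 2 3(2) e 3(3,4), folded stack]
  show "loops (id_diagram s) G = 0" using rel(2) by (simp add: loops_eq_nloops)
  have "relabel M g ` top_to_mid ` p = p" if "p \<in> G" for p
  proof -
    have "relabel M g (top_to_mid x) = x" if "x \<in> p" for x
      using diagram_no_Mid[OF G \<open>p \<in> G\<close> that] by (auto simp: M_def g_def relabel_def)
    then show ?thesis by (simp add: image_image)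
  qed
  then have "(`) (relabel M g) ` ?P = G"
    unfolding image_image[of _ _ G] by simp
  then show "star (id_diagram s) G = G" using rel(1) by (simp add: star_eq_contract)
qed

section \<open>Permutation diagrams and the ideal of the others\<close>

lemma perm_diagram_in:
  assumes "\<sigma> permutes {1..r}" shows "perm_diagram r \<sigma> \<in> perm_diagrams r"
proof -
  have "partition_on (Bot ` {1..r} \<union> Top ` {1..r}) (perm_diagram r \<sigma>)"
  proof (rule partition_onI)
    show "\<Union>(perm_diagram r \<sigma>) = Bot ` {1..r} \<union> Top ` {1..r}"
      using permutes_image[OF assms] by (auto simp: perm_diagram_eq image_iff)
    show "disjnt p q" if "p \<in> perm_diagram r \<sigma>" "q \<in> perm_diagram r \<sigma>" "p \<noteq> q" for p q
      using that permutes_inj[OF assms] by (auto simp: perm_diagram_eq disjnt_def dest: injD)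
  qed (auto simp: perm_diagram_eq)
  then show ?thesis
    by (auto simp: perm_diagrams_def brauer_diagrams_def perm_diagram_eq)
qed

lemma star_perm_diagram:
  assumes "\<sigma> permutes {1..r}" "\<tau> permutes {1..r}"
  shows "star (perm_diagram r \<sigma>) (perm_diagram r \<tau>) = perm_diagram r (\<sigma> \<circ> \<tau>)"
    and "loops (perm_diagram r \<sigma>) (perm_diagram r \<tau>) = 0"
proof -
  have b: "bij_betw \<tau> {1..r} {1..r}" using assms(2) by (rule permutes_imp_bij)
  have H: "perm_diagram r \<sigma> \<in> brauer_diagrams r r" using perm_diagram_in[OF assms(1)] by (simp add: perm_diagrams_def)
  note st = star_partial_permutation[OF b H pairing_on_empty Int_empty_right]
  have "(`) (map_bot (inv_into {1..r} \<tau>)) ` perm_diagram r \<sigma> = (\<lambda>x. {Bot (inv_into {1..r} \<tau> x), Top (\<sigma> x)}) ` {1..r}"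
    by (simp add: perm_diagram_eq image_image)
  also have "\<dots> = (\<lambda>x. {Bot (inv_into {1..r} \<tau> x), Top (\<sigma> x)}) ` \<tau> ` {1..r}"
    using b by (simp add: bij_betw_def)
  also have "\<dots> = perm_diagram r (\<sigma> \<circ> \<tau>)"
    unfolding perm_diagram_eq image_image using b
    by (intro image_cong) (auto simp: bij_betw_inv_into_left)
  finally show "star (perm_diagram r \<sigma>) (perm_diagram r \<tau>) = perm_diagram r (\<sigma> \<circ> \<tau>)"
    "loops (perm_diagram r \<sigma>) (perm_diagram r \<tau>) = 0"
    using st by (simp_all add: perm_diagram_eq[of r \<tau>])
qed

text \<open>The endpoint maps X and Y are kept abstract so that the argument serves bottom points
  and, upside down, top points.\<close>

lemma pairing_without_pairs_left:
  fixes r s :: nat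
  assumes D: "pairing_on (X ` {1..r} \<union> Y ` {1..s}) D"
    and XY: "inj X" "inj Y" "\<And>i j. X i \<noteq> Y j"
    and no: "\<And>i j. {X i, X j} \<notin> D"
  obtains f where "inj_on f {1..r}" "f ` {1..r} \<subseteq> {1..s}" "(\<lambda>i. {X i, Y (f i)}) ` {1..r} \<subseteq> D"
proof -
  have part: "disjoint D" and U: "\<Union>D = X ` {1..r} \<union> Y ` {1..s}"
    using D by (auto simp: pairing_on_def partition_on_def)
  have "\<exists>j\<in>{1..s}. {X i, Y j} \<in> D" if "i \<in> {1..r}" for i
  proof -
    have "X i \<in> \<Union>D" using that U by auto
    then obtain p where p: "p \<in> D" "X i \<in> p" by auto
    then have "card p = 2" using D by (simp add: pairing_on_def)
    then obtain a b where "p = {a, b}" by (auto simp: card_2_iff)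
    then have "p = {X i, if a = X i then b else a}" using p by auto
    then obtain y where y: "p = {X i, y}" by blast
    then have "y \<in> X ` {1..r} \<union> Y ` {1..s}" using p U by auto
    then show ?thesis using p y no by blast
  qed
  then obtain f where f: "\<And>i. i \<in> {1..r} \<Longrightarrow> f i \<in> {1..s} \<and> {X i, Y (f i)} \<in> D" by metis
  have "inj_on f {1..r}"
  proof (rule inj_onI)
    fix i j assume ij: "i \<in> {1..r}" "j \<in> {1..r}" "f i = f j"
    have "{X i, Y (f i)} \<inter> {X j, Y (f j)} \<noteq> {}" using ij by auto
    then have "{X i, Y (f i)} = {X j, Y (f j)}" using f ij part disjointD by metis
    then show "i = j" using XY ij by (auto simp: doubleton_eq_iff dest: injD)
  qed
  then show thesis using f by (intro that[of f]) auto
qed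

lemma pairing_bijection:
  fixes r :: nat
  assumes D: "pairing_on (X ` {1..r} \<union> Y ` {1..r}) D"
    and f: "inj_on f {1..r}" "f ` {1..r} \<subseteq> {1..r}" "(\<lambda>i. {X i, Y (f i)}) ` {1..r} \<subseteq> D"
  shows "D = (\<lambda>i. {X i, Y (f i)}) ` {1..r}" "f ` {1..r} = {1..r}"
proof -
  show im: "f ` {1..r} = {1..r}" by (rule endo_inj_surj[OF finite_atLeastAtMost f(2,1)])
  have part: "disjoint D" "{} \<notin> D" and U: "\<Union>D = X ` {1..r} \<union> Y ` {1..r}"
    using D by (auto simp: pairing_on_def partition_on_def)
  have "p \<in> (\<lambda>i. {X i, Y (f i)}) ` {1..r}" if p: "p \<in> D" for p
  proof -
    obtain x where x: "x \<in> p" using part p by (metis ex_in_conv)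
    then have "x \<in> X ` {1..r} \<union> Y ` f ` {1..r}" using U p im by auto
    then obtain i where i: "i \<in> {1..r}" "x \<in> {X i, Y (f i)}" by auto
    then have "p = {X i, Y (f i)}" using part(1) p x f(3) disjointD[of D p "{X i, Y (f i)}"] by blast
    then show ?thesis using i by auto
  qed
  then show "D = (\<lambda>i. {X i, Y (f i)}) ` {1..r}" using f(3) by auto
qed

lemma permutation_extension:
  assumes "inj_on f {1..r}" "f ` {1..r} = {1..r :: nat}"
  obtains \<sigma> where "\<sigma> permutes {1..r}" "\<And>i. i \<in> {1..r} \<Longrightarrow> \<sigma> i = f i"
proof
  show "(\<lambda>i. if i \<in> {1..r} then f i else i) permutes {1..r}"
  proof (rule bij_imp_permutes)
    have "bij_betw f {1..r} {1..r}" using assms by (simp add: bij_betw_def)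
    then show "bij_betw (\<lambda>i. if i \<in> {1..r} then f i else i) {1..r} {1..r}"
      by (subst bij_betw_cong[where g = f]) auto
  qed auto
qed auto

text \<open>Without pairs among them the r bottom points inject into the r top points, and an
  injection between finite sets of equal size is onto.\<close>

lemma no_bottom_pair_imp_perm:
  assumes D: "D \<in> brauer_diagrams r r" and no: "\<And>i j. {Bot i, Bot j} \<notin> D"
  shows "\<exists>\<sigma>. \<sigma> permutes {1..r} \<and> D = perm_diagram r \<sigma>"
proof -
  have D': "pairing_on (Bot ` {1..r} \<union> Top ` {1..r}) D" using D by (simp add: brauer_diagrams_iff)
  obtain f where f: "inj_on f {1..r}" "f ` {1..r} \<subseteq> {1..r}" "(\<lambda>i. {Bot i, Top (f i)}) ` {1..r} \<subseteq> D"
    by (rule pairing_without_pairs_left[OF D' _ _ _ no]) (auto simp: inj_def)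
  note b = pairing_bijection[OF D' f]
  obtain \<sigma> where \<sigma>: "\<sigma> permutes {1..r}" "\<And>i. i \<in> {1..r} \<Longrightarrow> \<sigma> i = f i"
    using permutation_extension[OF f(1) b(2)] by blast
  have "D = perm_diagram r \<sigma>" unfolding perm_diagram_eq b(1) using \<sigma>(2) by (intro image_cong) auto
  then show ?thesis using \<sigma> by auto
qed

lemma perm_diagrams_no_pairs:
  "D \<in> perm_diagrams r \<Longrightarrow> {Bot i, Bot j} \<notin> D" "D \<in> perm_diagrams r \<Longrightarrow> {Top i, Top j} \<notin> D"
  by (auto simp: perm_diagrams_def doubleton_eq_iff)+

lemma perm_diagrams_eq: "perm_diagrams r = perm_diagram r ` {\<sigma>. \<sigma> permutes {1..r}}"
proof (intro equalityI subsetI)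
  fix D assume D: "D \<in> perm_diagrams r"
  then have "D \<in> brauer_diagrams r r" by (simp add: perm_diagrams_def)
  from no_bottom_pair_imp_perm[OF this perm_diagrams_no_pairs(1)[OF D]]
  show "D \<in> perm_diagram r ` {\<sigma>. \<sigma> permutes {1..r}}" by auto
qed (auto intro: perm_diagram_in)

lemma isolated_edge_comps:
  assumes "p \<in> E" "p \<noteq> {}" "\<And>q. q \<in> E \<Longrightarrow> q \<inter> p \<noteq> {} \<Longrightarrow> q = p"
  shows "p \<in> comps E"
proof -
  obtain x where x: "x \<in> p" using assms by auto
  have "conn E `` {x} = p"
  proof (intro equalityI subsetI)
    fix y assume "y \<in> conn E `` {x}"
    then have "(x, y) \<in> conn E" by simp
    then show "y \<in> p"
    proof (induction rule: conn_induct)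
      case (step y z q)
      then have "q = p" using assms(3) by blast
      then show ?case using step by simp
    qed (rule x)
  qed (use conn_edge[OF assms(1) x] in auto)
  then show ?thesis using comps_of_point[of x E] x assms by auto
qed

text \<open>Such a pair meets no middle point, so it is a component of the stack by itself.\<close>

lemma star_keeps_bottom_pair:
  assumes G: "G \<in> brauer_diagrams r s" and H: "H \<in> brauer_diagrams s t" and p: "{Bot i, Bot j} \<in> G"
  shows "{Bot i, Bot j} \<in> star H G"
proof -
  let ?p = "{Bot i, Bot j}"
  have pG: "?p \<in> (`) top_to_mid ` G" using image_eqI[OF _ p, of ?p "(`) top_to_mid"] by simp
  have dis: "disjoint ((`) top_to_mid ` G)" using top_to_mid_pairing[OF G] by (simp add: pairing_on_def partition_on_def)
  have UH: "\<Union>((`) bot_to_mid ` H) = Mid ` {1..s} \<union> Top ` {1..t}"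
    by (rule pairing_on_Union[OF bot_to_mid_pairing[OF H]])
  have "q = ?p" if "q \<in> stack H G" "q \<inter> ?p \<noteq> {}" for q
  proof (cases "q \<in> (`) top_to_mid ` G")
    case True
    then show ?thesis using disjointD[OF dis True pG] that by blast
  next
    case False
    then have "q \<in> (`) bot_to_mid ` H" using that by (auto simp: stack_def)
    then have "q \<subseteq> Mid ` {1..s} \<union> Top ` {1..t}" unfolding UH[symmetric] by (rule Union_upper)
    then show ?thesis using that by auto
  qed
  then have "?p \<in> comps (stack H G)"
    using pG by (intro isolated_edge_comps) (auto simp: stack_def)
  then have "?p - range Mid \<in> star H G"
    unfolding star_eq_contract by (rule contract_memI[of _ _ "Bot i"]) auto
  moreover have "?p - range Mid = ?p" by auto
  ultimately show ?thesis by simp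
qed

lemma star_keeps_top_pair:
  assumes G: "G \<in> brauer_diagrams r s" and H: "H \<in> brauer_diagrams s t" and p: "{Top i, Top j} \<in> H"
  shows "{Top i, Top j} \<in> star H G"
proof -
  let ?p = "{Top i, Top j}"
  have pH: "?p \<in> (`) bot_to_mid ` H" using image_eqI[OF _ p, of ?p "(`) bot_to_mid"] by simp
  have dis: "disjoint ((`) bot_to_mid ` H)" using bot_to_mid_pairing[OF H] by (simp add: pairing_on_def partition_on_def)
  have UG: "\<Union>((`) top_to_mid ` G) = Bot ` {1..r} \<union> Mid ` {1..s}"
    by (rule pairing_on_Union[OF top_to_mid_pairing[OF G]])
  have "q = ?p" if "q \<in> stack H G" "q \<inter> ?p \<noteq> {}" for q
  proof (cases "q \<in> (`) bot_to_mid ` H")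
    case True
    then show ?thesis using disjointD[OF dis True pH] that by blast
  next
    case False
    then have "q \<in> (`) top_to_mid ` G" using that by (auto simp: stack_def)
    then have "q \<subseteq> Bot ` {1..r} \<union> Mid ` {1..s}" unfolding UG[symmetric] by (rule Union_upper)
    then show ?thesis using that by auto
  qed
  then have "?p \<in> comps (stack H G)"
    using pH by (intro isolated_edge_comps) (auto simp: stack_def)
  then have "?p - range Mid \<in> star H G"
    unfolding star_eq_contract by (rule contract_memI[of _ _ "Top i"]) auto
  moreover have "?p - range Mid = ?p" by auto
  ultimately show ?thesis by simp
qed

text \<open>Composition keeps the bottom pairs of G and the top pairs of H, so there are none. Hence
  the non-permutation diagrams span an ideal, and a composite through fewer than r points is never a
  permutation.\<close>

lemma star_perm_imp:
  assumes G: "G \<in> brauer_diagrams r s" and H: "H \<in> brauer_diagrams s r" and perm: "star H G \<in> perm_diagrams r"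
  shows "r \<le> s" "r = s \<Longrightarrow> G \<in> perm_diagrams r" "r = s \<Longrightarrow> H \<in> perm_diagrams r"
proof -
  have noG: "{Bot i, Bot j} \<notin> G" for i j
    using star_keeps_bottom_pair[OF G H] perm_diagrams_no_pairs(1)[OF perm] by blast
  have noH: "{Top i, Top j} \<notin> H" for i j
    using star_keeps_top_pair[OF G H] perm_diagrams_no_pairs(2)[OF perm] by blast
  obtain f where "inj_on f {1..r}" "f ` {1..r} \<subseteq> {1..s}"
    by (rule pairing_without_pairs_left[of Bot r Top s G]) (use G noG in \<open>auto simp: inj_def brauer_diagrams_iff\<close>)
  then have "card {1..r} \<le> card {1..s}" by (metis card_inj_on_le finite_atLeastAtMost)
  then show "r \<le> s" by simp
  show "G \<in> perm_diagrams r" if "r = s"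
    using no_bottom_pair_imp_perm[of G r] G noG that perm_diagram_in by auto
  show "H \<in> perm_diagrams r" if "r = s"
  proof -
    have H': "pairing_on (Top ` {1..r} \<union> Bot ` {1..r}) H" using H that by (simp add: brauer_diagrams_iff Un_commute)
    obtain f where f: "inj_on f {1..r}" "f ` {1..r} \<subseteq> {1..r}" "(\<lambda>i. {Top i, Bot (f i)}) ` {1..r} \<subseteq> H"
      by (rule pairing_without_pairs_left[OF H' _ _ _ noH]) (auto simp: inj_def)
    from pairing_bijection(1)[OF H' f] have "\<forall>p\<in>H. \<exists>i j. p = {Bot i, Top j}" by auto
    then show ?thesis using H that by (simp add: perm_diagrams_def)
  qed
qed

text \<open>G keeps one bottom pair of D and carries the remaining points up to s = r - 2 positions;
  H is the rest of D with its bottom points renamed. Since G has no pair of top points no loop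
  arises, which matters when \<delta> is zero.\<close>

lemma non_perm_factors:
  assumes D: "D \<in> brauer_diagrams r r" "D \<notin> perm_diagrams r"
  obtains s G H where "s < r" "G \<in> brauer_diagrams r s" "H \<in> brauer_diagrams s r" "star H G = D" "loops H G = 0"
proof -
  obtain i j where ij: "{Bot i, Bot j} \<in> D"
    using no_bottom_pair_imp_perm[OF D(1)] D(2) perm_diagram_in by blast
  let ?c = "{Bot i, Bot j}"
  have D': "pairing_on (Bot ` {1..r} \<union> Top ` {1..r}) D" using D by (simp add: brauer_diagrams_iff)
  have ne: "i \<noteq> j" using D' ij by (auto simp: pairing_on_def)
  have ir: "i \<in> {1..r}" "j \<in> {1..r}" 
    using diagram_no_Mid[OF D(1) ij, of "Bot i"] diagram_no_Mid[OF D(1) ij, of "Bot j"] by auto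
  define s where "s = r - 2"
  have "{i, j} \<subseteq> {1..r}" using ir by auto
  then have "card {i, j} \<le> card {1..r}" by (intro card_mono) auto
  then have r2: "2 \<le> r" using ne by simp
  define X where "X = {1..r} - {i, j}"
  have "card X = card {1..s}" unfolding X_def s_def using ir ne by (simp add: card_Diff_subset)
  then obtain \<alpha> where \<alpha>: "bij_betw \<alpha> X {1..s}"
    using finite_same_card_bij[of X "{1..s}"] by (auto simp: X_def)
  define G where "G = (\<lambda>x. {Bot x, Top (\<alpha> x)}) ` X \<union> {?c}"
  have C: "pairing_on (Bot ` {i, j}) {?c}" using ne by (auto simp: pairing_on_def partition_on_def)
  have Xij: "X \<inter> {i, j} = {}" by (auto simp: X_def)
  have G: "G \<in> brauer_diagrams r s"
  proof -
    have "partition_on (Bot ` {1..r} \<union> Top ` {1..s}) G"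
    proof (rule partition_onI)
      have "Top ` {1..s} = Top ` \<alpha> ` X" using \<alpha> by (simp add: bij_betw_def)
      then show "\<Union>G = Bot ` {1..r} \<union> Top ` {1..s}" using ir by (auto simp: G_def X_def)
      show "disjnt p q" if "p \<in> G" "q \<in> G" "p \<noteq> q" for p q
        using that Xij \<alpha> by (auto simp: G_def disjnt_def bij_betw_def dest: inj_onD)
    qed (auto simp: G_def)
    then show ?thesis using ne by (auto simp: brauer_diagrams_def G_def)
  qed
  define H where "H = (`) (map_bot \<alpha>) ` (D - {?c})"
  have DC: "pairing_on (Bot ` X \<union> Top ` {1..r}) (D - {?c})"
  proof -
    have "partition_on (Bot ` X \<union> Top ` {1..r}) (D - {?c})"
    proof (rule partition_onI)
      have d: "p \<inter> ?c = {}" if "p \<in> D - {?c}" for p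
        using that ij D' disjointD[of D p ?c] by (auto simp: pairing_on_def partition_on_def)
      have "\<Union>(D - {?c}) = \<Union>D - ?c" using d ij by blast
      then show "\<Union>(D - {?c}) = Bot ` X \<union> Top ` {1..r}"
        using pairing_on_Union[OF D'] by (auto simp: X_def)
      show "disjnt p q" if "p \<in> D - {?c}" "q \<in> D - {?c}" "p \<noteq> q" for p q
        using that D' by (auto simp: pairing_on_def partition_on_def pairwise_def)
    qed (use D' in \<open>auto simp: pairing_on_def partition_on_def\<close>)
    then show ?thesis using D' by (auto simp: pairing_on_def)
  qed
  have H: "H \<in> brauer_diagrams s r"
  proof -
    have \<alpha>X: "inj_on \<alpha> X" "{1..s} = \<alpha> ` X" using \<alpha> by (simp_all add: bij_betw_def)
    have "inj_on (map_bot \<alpha>) (Bot ` X \<union> Top ` {1..r})" using \<alpha>X(1) by (intro inj_onI) (auto dest: inj_onD)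
    from pairing_on_image[OF DC this] show ?thesis
      unfolding brauer_diagrams_iff H_def \<alpha>X(2) by (simp add: image_Un image_image)
  qed
  note st = star_partial_permutation[OF \<alpha> H C Xij, folded G_def]
  have "map_bot (inv_into X \<alpha>) ` map_bot \<alpha> ` p = p" if "p \<in> D - {?c}" for p
  proof -
    have "p \<subseteq> Bot ` X \<union> Top ` {1..r}" using pairing_on_Union[OF DC] that by auto
    then have "map_bot (inv_into X \<alpha>) (map_bot \<alpha> x) = x" if "x \<in> p" for x
      using that \<alpha> by (auto simp: bij_betw_inv_into_left)
    then show ?thesis by (simp add: image_image)
  qed
  then have "(`) (map_bot (inv_into X \<alpha>)) ` H = D - {?c}"
    unfolding H_def image_image[of _ _ "D - {?c}"] by simp
  then have "star H G = D" using st(1) ij by auto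
  then show thesis using st(2) G H r2 by (intro that[of s G H]) (auto simp: s_def)
qed

section \<open>The Brauer category is linear\<close>

definition pm_scale :: "'k::field \<Rightarrow> ('d \<Rightarrow>\<^sub>0 'k) \<Rightarrow> ('d \<Rightarrow>\<^sub>0 'k)" where
  "pm_scale c f = Poly_Mapping.map ((*) c) f"

lemma lookup_pm_scale: "Poly_Mapping.lookup (pm_scale c f) D = c * Poly_Mapping.lookup f D"
  by (simp add: pm_scale_def Poly_Mapping.map.rep_eq when_def)

lemma vector_space_pm_scale: "vector_space pm_scale"
  by unfold_locales (auto intro!: poly_mapping_eqI simp: lookup_pm_scale lookup_add algebra_simps)

interpretation DS: vector_space pm_scale
  by (rule vector_space_pm_scale)

lemma pm_scale_single: "pm_scale c (Poly_Mapping.single D a) = Poly_Mapping.single D (c * a)"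
  by (rule poly_mapping_eqI) (simp add: lookup_pm_scale lookup_single when_def)

lemma poly_mapping_sum_singles:
  assumes "finite S" "Poly_Mapping.keys f \<subseteq> S"
  shows "f = (\<Sum>D\<in>S. Poly_Mapping.single D (Poly_Mapping.lookup f D))"
proof (rule poly_mapping_eqI)
  fix E
  have "(\<Sum>D\<in>S. Poly_Mapping.lookup (Poly_Mapping.single D (Poly_Mapping.lookup f D)) E) =
    (\<Sum>D\<in>S. if D = E then Poly_Mapping.lookup f E else 0)"
    by (rule sum.cong) (auto simp: lookup_single when_def)
  also have "\<dots> = Poly_Mapping.lookup f E" using assms by (auto simp: sum.delta in_keys_iff)
  finally show "Poly_Mapping.lookup f E = Poly_Mapping.lookup (\<Sum>D\<in>S. Poly_Mapping.single D (Poly_Mapping.lookup f D)) E"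
    by (simp add: lookup_sum)
qed

text \<open>Supports change under addition, so bilinearity is proved after writing all sums over
  common finite index sets.\<close>

lemma brauer_comp_superset:
  assumes "finite S" "finite T" "Poly_Mapping.keys h \<subseteq> S" "Poly_Mapping.keys g \<subseteq> T"
  shows "brauer_comp \<delta> h g = (\<Sum>H\<in>S. \<Sum>G\<in>T. Poly_Mapping.single (star H G)
    (Poly_Mapping.lookup h H * Poly_Mapping.lookup g G * \<delta> ^ loops H G))"
proof -
  have "(\<Sum>H\<in>S. \<Sum>G\<in>T. Poly_Mapping.single (star H G)
    (Poly_Mapping.lookup h H * Poly_Mapping.lookup g G * \<delta> ^ loops H G)) =
    (\<Sum>H\<in>Poly_Mapping.keys h. \<Sum>G\<in>T. Poly_Mapping.single (star H G)
    (Poly_Mapping.lookup h H * Poly_Mapping.lookup g G * \<delta> ^ loops H G))"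
    using assms by (intro sum.mono_neutral_right) (auto simp: in_keys_iff)
  also have "\<dots> = brauer_comp \<delta> h g"
    unfolding brauer_comp_def using assms
    by (intro sum.cong refl sum.mono_neutral_right) (auto simp: in_keys_iff)
  finally show ?thesis ..
qed

lemma brauer_comp_add_left: "brauer_comp \<delta> (h + h') g = brauer_comp \<delta> h g + brauer_comp \<delta> h' g"
proof -
  let ?S = "Poly_Mapping.keys h \<union> Poly_Mapping.keys h'" and ?T = "Poly_Mapping.keys g"
  have "Poly_Mapping.keys (h + h') \<subseteq> ?S" by (rule keys_add)
  then show ?thesis
    using brauer_comp_superset[of ?S ?T "h + h'" g \<delta>] brauer_comp_superset[of ?S ?T h g \<delta>]
      brauer_comp_superset[of ?S ?T h' g \<delta>]
    by (simp add: lookup_add sum.distrib[symmetric] single_add[symmetric] algebra_simps)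
qed

lemma brauer_comp_add_right: "brauer_comp \<delta> h (g + g') = brauer_comp \<delta> h g + brauer_comp \<delta> h g'"
proof -
  let ?T = "Poly_Mapping.keys g \<union> Poly_Mapping.keys g'" and ?S = "Poly_Mapping.keys h"
  have "Poly_Mapping.keys (g + g') \<subseteq> ?T" by (rule keys_add)
  then show ?thesis
    using brauer_comp_superset[of ?S ?T h "g + g'" \<delta>] brauer_comp_superset[of ?S ?T h g \<delta>]
      brauer_comp_superset[of ?S ?T h g' \<delta>]
    by (simp add: lookup_add sum.distrib[symmetric] single_add[symmetric] algebra_simps)
qed

lemma brauer_comp_zero [simp]: "brauer_comp \<delta> 0 g = 0" "brauer_comp \<delta> h 0 = 0"
  by (simp_all add: brauer_comp_def)

lemma brauer_comp_sum_left: "brauer_comp \<delta> (sum h I) g = (\<Sum>i\<in>I. brauer_comp \<delta> (h i) g)"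
  by (induction I rule: infinite_finite_induct) (auto simp: brauer_comp_add_left)

lemma brauer_comp_sum_right: "brauer_comp \<delta> h (sum g I) = (\<Sum>i\<in>I. brauer_comp \<delta> h (g i))"
  by (induction I rule: infinite_finite_induct) (auto simp: brauer_comp_add_right)

lemma pm_scale_sum: "pm_scale c (sum f I) = (\<Sum>i\<in>I. pm_scale c (f i))"
  by (rule DS.scale_sum_right)

lemma keys_pm_scale: "Poly_Mapping.keys (pm_scale c f) \<subseteq> Poly_Mapping.keys f"
  by (auto simp: in_keys_iff lookup_pm_scale)

lemma brauer_comp_scale:
  "brauer_comp \<delta> (pm_scale c h) g = pm_scale c (brauer_comp \<delta> h g)"
  "brauer_comp \<delta> h (pm_scale c g) = pm_scale c (brauer_comp \<delta> h g)"
  using brauer_comp_superset[of "Poly_Mapping.keys h" "Poly_Mapping.keys g" "pm_scale c h" g \<delta>]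
    brauer_comp_superset[of "Poly_Mapping.keys h" "Poly_Mapping.keys g" h "pm_scale c g" \<delta>]
    keys_pm_scale[of c h] keys_pm_scale[of c g]
  by (simp_all add: brauer_comp_def[of _ h g] pm_scale_sum pm_scale_single lookup_pm_scale mult_ac)

lemma brauer_comp_single:
  "brauer_comp \<delta> (Poly_Mapping.single H a) (Poly_Mapping.single G b) =
    Poly_Mapping.single (star H G) (a * b * \<delta> ^ loops H G)"
  using brauer_comp_superset[of "{H}" "{G}" "Poly_Mapping.single H a" "Poly_Mapping.single G b" \<delta>] by simp

lemma finite_brauer_diagrams: "finite (brauer_diagrams r s)"
proof -
  have "brauer_diagrams r s \<subseteq> Pow (Pow (Bot ` {1..r} \<union> Top ` {1..s}))"
    by (auto simp: brauer_diagrams_def partition_on_def)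
  then show ?thesis by (rule finite_subset) simp
qed

abbreviation brauer_hom :: "nat \<Rightarrow> nat \<Rightarrow> (diagram \<Rightarrow>\<^sub>0 'k::field) set" where
  "brauer_hom r s \<equiv> {f. Poly_Mapping.keys f \<subseteq> brauer_diagrams r s}"

lemma poly_mapping_support_induct [consumes 1, case_names zero single add]:
  fixes f :: "'d \<Rightarrow>\<^sub>0 'b::comm_monoid_add"
  assumes f: "Poly_Mapping.keys f \<subseteq> S" and fin: "finite S"
    and zero: "P 0" and single: "\<And>D a. D \<in> S \<Longrightarrow> P (Poly_Mapping.single D a)"
    and add: "\<And>f g. Poly_Mapping.keys f \<subseteq> S \<Longrightarrow> Poly_Mapping.keys g \<subseteq> S \<Longrightarrow> P f \<Longrightarrow> P g \<Longrightarrow> P (f + g)"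
  shows "P f"
proof -
  have "T \<subseteq> S \<Longrightarrow> Poly_Mapping.keys (\<Sum>D\<in>T. Poly_Mapping.single D (Poly_Mapping.lookup f D)) \<subseteq> S \<and>
    P (\<Sum>D\<in>T. Poly_Mapping.single D (Poly_Mapping.lookup f D))" if "finite T" for T
    using that
  proof (induction T rule: finite_induct)
    case (insert D T)
    have "Poly_Mapping.keys (Poly_Mapping.single D (Poly_Mapping.lookup f D)) \<subseteq> S" using insert by simp
    then have "Poly_Mapping.keys (Poly_Mapping.single D (Poly_Mapping.lookup f D) +
        (\<Sum>D\<in>T. Poly_Mapping.single D (Poly_Mapping.lookup f D))) \<subseteq> S"
      using insert keys_add[of "Poly_Mapping.single D (Poly_Mapping.lookup f D)"
          "\<Sum>D\<in>T. Poly_Mapping.single D (Poly_Mapping.lookup f D)"] by blast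
    moreover have "P (Poly_Mapping.single D (Poly_Mapping.lookup f D) +
        (\<Sum>D\<in>T. Poly_Mapping.single D (Poly_Mapping.lookup f D)))"
      using insert single by (intro add) auto
    ultimately show ?case using insert by simp
  qed (use zero in auto)
  from this[OF fin order_refl] show ?thesis using poly_mapping_sum_singles[OF fin f] by simp
qed

lemma brauer_comp_in:
  assumes "Poly_Mapping.keys g \<subseteq> brauer_diagrams r s" "Poly_Mapping.keys h \<subseteq> brauer_diagrams s t"
  shows "Poly_Mapping.keys (brauer_comp \<delta> h g) \<subseteq> brauer_diagrams r t"
proof
  fix D assume "D \<in> Poly_Mapping.keys (brauer_comp \<delta> h g)"
  then have "(\<Sum>H\<in>Poly_Mapping.keys h. \<Sum>G\<in>Poly_Mapping.keys g. Poly_Mapping.lookup (Poly_Mapping.single (star H G)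
    (Poly_Mapping.lookup h H * Poly_Mapping.lookup g G * \<delta> ^ loops H G)) D) \<noteq> 0"
    by (simp add: in_keys_iff brauer_comp_def lookup_sum)
  then obtain H where H: "H \<in> Poly_Mapping.keys h" "(\<Sum>G\<in>Poly_Mapping.keys g. Poly_Mapping.lookup (Poly_Mapping.single (star H G)
    (Poly_Mapping.lookup h H * Poly_Mapping.lookup g G * \<delta> ^ loops H G)) D) \<noteq> 0"
    by (meson sum.not_neutral_contains_not_neutral)
  then obtain G where G: "G \<in> Poly_Mapping.keys g" "Poly_Mapping.lookup (Poly_Mapping.single (star H G)
    (Poly_Mapping.lookup h H * Poly_Mapping.lookup g G * \<delta> ^ loops H G)) D \<noteq> 0"
    by (meson sum.not_neutral_contains_not_neutral)
  then have "D = star H G" by (auto simp: lookup_single when_def split: if_splits)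
  then show "D \<in> brauer_diagrams r t" using star_in G H assms by blast
qed

text \<open>Trilinearity reduces the claim to three diagrams; there the exponents of \<delta> agree
  by the loop count in \<open>star_assoc\<close>.\<close>

lemma brauer_comp_assoc:
  fixes \<delta> :: "'k::field"
  assumes f: "Poly_Mapping.keys f \<subseteq> brauer_diagrams r s" and g: "Poly_Mapping.keys g \<subseteq> brauer_diagrams s t"
    and h: "Poly_Mapping.keys h \<subseteq> brauer_diagrams t u"
  shows "brauer_comp \<delta> (brauer_comp \<delta> h g) f = brauer_comp \<delta> h (brauer_comp \<delta> g f)"
  using f
proof (rule poly_mapping_support_induct[OF _ finite_brauer_diagrams])
  fix F and a :: 'k assume F: "F \<in> brauer_diagrams r s"
  let ?f = "Poly_Mapping.single F a"
  show "brauer_comp \<delta> (brauer_comp \<delta> h g) ?f = brauer_comp \<delta> h (brauer_comp \<delta> g ?f)"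
    using g
  proof (rule poly_mapping_support_induct[OF _ finite_brauer_diagrams])
    fix G and b :: 'k assume G: "G \<in> brauer_diagrams s t"
    let ?g = "Poly_Mapping.single G b"
    show "brauer_comp \<delta> (brauer_comp \<delta> h ?g) ?f = brauer_comp \<delta> h (brauer_comp \<delta> ?g ?f)"
      using h
    proof (rule poly_mapping_support_induct[OF _ finite_brauer_diagrams])
      fix H and c :: 'k assume H: "H \<in> brauer_diagrams t u"
      show "brauer_comp \<delta> (brauer_comp \<delta> (Poly_Mapping.single H c) ?g) ?f =
        brauer_comp \<delta> (Poly_Mapping.single H c) (brauer_comp \<delta> ?g ?f)"
        using star_assoc[OF F G H]
        by (simp add: brauer_comp_single mult.assoc mult.left_commute power_add[symmetric] add.commute)
    qed (simp_all add: brauer_comp_add_left brauer_comp_add_right)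
  qed (simp_all add: brauer_comp_add_left brauer_comp_add_right)
qed (simp_all add: brauer_comp_add_left brauer_comp_add_right)

lemma brauer_comp_id_right:
  assumes "Poly_Mapping.keys f \<subseteq> brauer_diagrams r s"
  shows "brauer_comp \<delta> f (Poly_Mapping.single (id_diagram r) 1) = f"
  using assms
  by (rule poly_mapping_support_induct[OF _ finite_brauer_diagrams])
    (simp_all add: brauer_comp_add_left brauer_comp_single star_id_right)

lemma brauer_comp_id_left:
  assumes "Poly_Mapping.keys f \<subseteq> brauer_diagrams r s"
  shows "brauer_comp \<delta> (Poly_Mapping.single (id_diagram s) 1) f = f"
  using assms
  by (rule poly_mapping_support_induct[OF _ finite_brauer_diagrams])
    (simp_all add: brauer_comp_add_right brauer_comp_single star_id_left)

lemma id_diagram_perm: "id_diagram r = perm_diagram r id"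
  by (simp add: id_diagram_eq perm_diagram_eq)

lemma id_diagram_in: "id_diagram r \<in> perm_diagrams r" "id_diagram r \<in> brauer_diagrams r r"
  using perm_diagram_in[OF permutes_id] by (simp_all add: id_diagram_perm perm_diagrams_def id_def)

lemma brauer_category_simps [simp]:
  "cat_ob (brauer_category \<delta>) = UNIV" "cat_hom (brauer_category \<delta>) r s = brauer_hom r s"
  "cat_id (brauer_category \<delta>) r = Poly_Mapping.single (id_diagram r) 1"
  "cat_comp (brauer_category \<delta>) r s t = brauer_comp \<delta>"
  by (simp_all add: brauer_category_def)

lemma keys_add_subset:
  "Poly_Mapping.keys f \<subseteq> S \<Longrightarrow> Poly_Mapping.keys g \<subseteq> S \<Longrightarrow> Poly_Mapping.keys (f + g) \<subseteq> S"
  by (rule subset_trans[OF keys_add]) simp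

lemma linear_brauer_category:
  fixes \<delta> :: "'k::field"
  shows "linear_category (brauer_category \<delta>) pm_scale"
proof -
  have span: "(brauer_hom r s :: (diagram \<Rightarrow>\<^sub>0 'k) set) \<subseteq> DS.span ((\<lambda>D. Poly_Mapping.single D 1) ` brauer_diagrams r s)" for r s
  proof
    fix f :: "diagram \<Rightarrow>\<^sub>0 'k" assume "f \<in> brauer_hom r s"
    then have "Poly_Mapping.keys f \<subseteq> brauer_diagrams r s" by simp
    then show "f \<in> DS.span ((\<lambda>D. Poly_Mapping.single D 1) ` brauer_diagrams r s)"
    proof (rule poly_mapping_support_induct[OF _ finite_brauer_diagrams])
      fix D and a :: 'k assume "D \<in> brauer_diagrams r s"
      then have "pm_scale a (Poly_Mapping.single D 1) \<in> DS.span ((\<lambda>D. Poly_Mapping.single D 1) ` brauer_diagrams r s)"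
        by (intro DS.span_scale DS.span_base) auto
      then show "Poly_Mapping.single D a \<in> DS.span ((\<lambda>D. Poly_Mapping.single D 1) ` brauer_diagrams r s)"
        by (simp add: pm_scale_single)
    qed (auto simp: DS.span_zero DS.span_add)
  qed
  have fin: "\<exists>B. finite B \<and> (brauer_hom r s :: (diagram \<Rightarrow>\<^sub>0 'k) set) \<subseteq> DS.span B" for r s
    using span[of r s] finite_imageI[OF finite_brauer_diagrams] by blast
  show ?thesis
    by unfold_locales
      (simp_all add: fin id_diagram_in  brauer_comp_add_left brauer_comp_add_right brauer_comp_scale
        keys_add_subset subset_trans[OF keys_pm_scale],
        (assumption | rule brauer_comp_assoc brauer_comp_in brauer_comp_id_left brauer_comp_id_right)+)
qed

section \<open>The projection onto the group algebra\<close>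

lemma lookup_sym_proj: "Poly_Mapping.lookup (sym_proj r a) D = (if D \<in> perm_diagrams r then Poly_Mapping.lookup a D else 0)"
proof -
  have "Poly_Mapping.lookup (sym_proj r a) D =
    (\<Sum>E\<in>Poly_Mapping.keys a \<inter> perm_diagrams r. if E = D then Poly_Mapping.lookup a D else 0)"
    unfolding sym_proj_def lookup_sum by (rule sum.cong) (auto simp: lookup_single when_def)
  then show ?thesis by (auto simp: sum.delta in_keys_iff)
qed

lemma sym_proj_add: "sym_proj r (a + b) = sym_proj r a + sym_proj r b"
  by (rule poly_mapping_eqI) (simp add: lookup_sym_proj lookup_add)

lemma sym_proj_zero [simp]: "sym_proj r 0 = 0"
  by (rule poly_mapping_eqI) (simp add: lookup_sym_proj)

lemma sym_proj_sum: "sym_proj r (sum f I) = (\<Sum>i\<in>I. sym_proj r (f i))"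
  by (induction I rule: infinite_finite_induct) (auto simp: sym_proj_add)

lemma sym_proj_in: "sym_proj r a \<in> sym_group_algebra r"
  by (auto simp: sym_group_algebra_def in_keys_iff lookup_sym_proj split: if_splits)

lemma sym_proj_id: "a \<in> sym_group_algebra r \<Longrightarrow> sym_proj r a = a"
  by (rule poly_mapping_eqI) (auto simp: sym_group_algebra_def in_keys_iff lookup_sym_proj)

lemma sym_proj_single: "sym_proj r (Poly_Mapping.single D a) = (if D \<in> perm_diagrams r then Poly_Mapping.single D a else 0)"
  by (rule poly_mapping_eqI) (auto simp: lookup_sym_proj lookup_single when_def)

lemma sym_group_algebra_subset: "a \<in> sym_group_algebra r \<Longrightarrow> Poly_Mapping.keys a \<subseteq> brauer_diagrams r r"
  by (auto simp: sym_group_algebra_def perm_diagrams_def)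

lemma star_perm_diagrams:
  assumes "D \<in> perm_diagrams r" "E \<in> perm_diagrams r"
  shows "star D E \<in> perm_diagrams r" "loops D E = 0"
proof -
  obtain \<sigma> \<tau> where "\<sigma> permutes {1..r}" "\<tau> permutes {1..r}" "D = perm_diagram r \<sigma>" "E = perm_diagram r \<tau>"
    using assms by (auto simp: perm_diagrams_eq)
  then show "star D E \<in> perm_diagrams r" "loops D E = 0"
    using star_perm_diagram[of \<sigma> r \<tau>] perm_diagram_in[OF permutes_compose] by auto
qed

text \<open>A composite of diagrams is a permutation exactly when both factors are, so the terms
  that the projection kills form an ideal.\<close>

lemma sym_proj_comp:
  assumes a: "Poly_Mapping.keys a \<subseteq> brauer_diagrams r r" and b: "Poly_Mapping.keys b \<subseteq> brauer_diagrams r r"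
  shows "sym_proj r (brauer_comp \<delta> a b) = brauer_comp \<delta> (sym_proj r a) (sym_proj r b)"
  using a
proof (rule poly_mapping_support_induct[OF _ finite_brauer_diagrams])
  fix H c assume H: "H \<in> brauer_diagrams r r"
  show "sym_proj r (brauer_comp \<delta> (Poly_Mapping.single H c) b) =
    brauer_comp \<delta> (sym_proj r (Poly_Mapping.single H c)) (sym_proj r b)"
    using b
  proof (rule poly_mapping_support_induct[OF _ finite_brauer_diagrams])
    fix G d assume G: "G \<in> brauer_diagrams r r"
    show "sym_proj r (brauer_comp \<delta> (Poly_Mapping.single H c) (Poly_Mapping.single G d)) =
      brauer_comp \<delta> (sym_proj r (Poly_Mapping.single H c)) (sym_proj r (Poly_Mapping.single G d))"
      using star_perm_imp[OF G H] star_perm_diagrams(1)[of H r G]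
      by (auto simp: brauer_comp_single sym_proj_single)
  qed (simp_all add: brauer_comp_add_right sym_proj_add)
qed (simp_all add: brauer_comp_add_left sym_proj_add)

lemma sym_proj_factor_zero:
  assumes g: "Poly_Mapping.keys g \<subseteq> brauer_diagrams r s" and h: "Poly_Mapping.keys h \<subseteq> brauer_diagrams s r" and "s < r"
  shows "sym_proj r (brauer_comp \<delta> h g) = 0"
  using g
proof (rule poly_mapping_support_induct[OF _ finite_brauer_diagrams])
  fix G c assume G: "G \<in> brauer_diagrams r s"
  show "sym_proj r (brauer_comp \<delta> h (Poly_Mapping.single G c)) = 0"
    using h
  proof (rule poly_mapping_support_induct[OF _ finite_brauer_diagrams])
    fix H d assume H: "H \<in> brauer_diagrams s r"
    show "sym_proj r (brauer_comp \<delta> (Poly_Mapping.single H d) (Poly_Mapping.single G c)) = 0"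
      using star_perm_imp(1)[OF G H] \<open>s < r\<close> by (auto simp: brauer_comp_single sym_proj_single)
  qed (simp_all add: brauer_comp_add_left sym_proj_add)
qed (simp_all add: brauer_comp_add_right sym_proj_add)

lemma sym_group_algebra_comp:
  assumes "a \<in> sym_group_algebra r" "b \<in> sym_group_algebra r"
  shows "brauer_comp \<delta> a b \<in> sym_group_algebra r"
  using sym_proj_comp[OF sym_group_algebra_subset[OF assms(1)] sym_group_algebra_subset[OF assms(2)], of \<delta>]
    sym_proj_id assms sym_proj_in by metis

lemma sym_group_carrier_algebra:
  "carrier_algebra (sym_group_algebra r) (brauer_comp \<delta>) (Poly_Mapping.single (id_diagram r) 1)"
  by unfold_locales
    (simp_all add: sym_group_algebra_comp brauer_comp_add_left brauer_comp_add_right,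
      simp_all add: sym_group_algebra_def id_diagram_in  keys_add_subset,
      (assumption | rule brauer_comp_assoc brauer_comp_id_left brauer_comp_id_right sym_group_algebra_subset
        sym_group_algebra_def[THEN eq_reflection, THEN meta_eq_to_obj_eq, THEN equalityD2, THEN subsetD, OF CollectI])+)

text \<open>Each diagram in the support is a non-permutation and factors through fewer points; its
  coefficient is put into the upper factor. The sum has the form required by
  \<open>prim_sum_factors\<close>.\<close>

lemma kernel_factors:
  assumes a: "Poly_Mapping.keys a \<subseteq> brauer_diagrams r r" and proj: "sym_proj r a = 0"
  obtains s u v where "\<And>D. D \<in> Poly_Mapping.keys a \<Longrightarrow> s D < r \<and> Poly_Mapping.keys (u D) \<subseteq> brauer_diagrams r (s D) \<and>
      Poly_Mapping.keys (v D) \<subseteq> brauer_diagrams (s D) r"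
    "a = (\<Sum>D\<in>Poly_Mapping.keys a. brauer_comp \<delta> (v D) (u D))"
proof -
  have np: "D \<in> brauer_diagrams r r \<and> D \<notin> perm_diagrams r" if "D \<in> Poly_Mapping.keys a" for D
    using a that proj lookup_sym_proj[of r a D] by (auto simp: in_keys_iff)
  have "\<exists>s u v. s < r \<and> Poly_Mapping.keys u \<subseteq> brauer_diagrams r s \<and> Poly_Mapping.keys v \<subseteq> brauer_diagrams s r \<and>
    brauer_comp \<delta> v u = Poly_Mapping.single D (Poly_Mapping.lookup a D)" if D: "D \<in> Poly_Mapping.keys a" for D
  proof -
    obtain s G H where "s < r" "G \<in> brauer_diagrams r s" "H \<in> brauer_diagrams s r" "star H G = D" "loops H G = 0"
      using np[OF D] by (auto elim: non_perm_factors)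
    then show ?thesis
      by (intro exI[of _ s] exI[of _ "Poly_Mapping.single G 1"] exI[of _ "Poly_Mapping.single H (Poly_Mapping.lookup a D)"])
        (simp add: brauer_comp_single)
  qed
  then obtain s u v where suv: "\<And>D. D \<in> Poly_Mapping.keys a \<Longrightarrow> s D < r \<and> Poly_Mapping.keys (u D) \<subseteq> brauer_diagrams r (s D) \<and>
      Poly_Mapping.keys (v D) \<subseteq> brauer_diagrams (s D) r \<and> brauer_comp \<delta> (v D) (u D) = Poly_Mapping.single D (Poly_Mapping.lookup a D)"
    by metis
  show thesis
  proof (rule that[of s u v])
    show "a = (\<Sum>D\<in>Poly_Mapping.keys a. brauer_comp \<delta> (v D) (u D))"
      using suv poly_mapping_sum_singles[of "Poly_Mapping.keys a" a] by simp
  qed (use suv in auto)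
qed

section \<open>Young symmetrizers in the rational group ring\<close>

text \<open>Bijections of all natural numbers, written additively: multiplication of finitely
  supported functions is convolution over an additive monoid, so the group ring comes for free, and
  one type serves every r.\<close>

typedef nperm = "{\<sigma> :: nat \<Rightarrow> nat. bij \<sigma>}" morphisms ap Abs_nperm
  using bij_id by blast

instantiation nperm :: group_add
begin

definition "0 = Abs_nperm id"
definition "g + h = Abs_nperm (ap g \<circ> ap h)"
definition "- g = Abs_nperm (inv (ap g))"
definition "g - h = g + - (h :: nperm)"

lemma bij_ap: "bij (ap g)"
  using ap[of g] by simp

lemma ap_zero [simp]: "ap 0 = id"
  by (simp add: zero_nperm_def Abs_nperm_inverse)

lemma ap_plus [simp]: "ap (g + h) = ap g \<circ> ap h"
  by (simp add: plus_nperm_def Abs_nperm_inverse bij_comp bij_ap)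

lemma ap_uminus: "ap (- g) = inv (ap g)"
  by (simp add: uminus_nperm_def Abs_nperm_inverse bij_imp_bij_inv bij_ap)

instance
proof
  fix a b c :: nperm
  show "a + b + c = a + (b + c)" by (simp add: ap_inject[symmetric] o_assoc)
  show "0 + a = a" "a + 0 = a" by (simp_all add: ap_inject[symmetric])
  show "- a + a = 0"
    by (simp add: ap_inject[symmetric] ap_uminus inv_o_cancel bij_is_inj bij_ap)
  show "a + - b = a - b" by (simp add: minus_nperm_def)
qed

end

lemma ap_uminus_ap [simp]: "ap (- g) (ap g x) = x" "ap g (ap (- g) x) = x"
  using bij_ap[of g] by (simp_all add: ap_uminus bij_is_inj bij_is_surj surj_f_inv_f)

lemma nperm_eqI: "(\<And>x. ap g x = ap h x) \<Longrightarrow> g = h"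
  by (simp add: ap_inject[symmetric] fun_eq_iff)

definition symg :: "nat \<Rightarrow> nperm set" where
  "symg r = {g. ap g permutes {1..r}}"

lemma sym_zero [simp]: "0 \<in> symg r"
  by (simp add: symg_def permutes_id[unfolded id_def] id_def)

lemma sym_plus: "g \<in> symg r \<Longrightarrow> h \<in> symg r \<Longrightarrow> g + h \<in> symg r"
  by (simp add: symg_def permutes_compose)

lemma sym_uminus: "g \<in> symg r \<Longrightarrow> - g \<in> symg r"
  by (simp add: symg_def ap_uminus permutes_inv)

lemma sym_in: "g \<in> symg r \<Longrightarrow> x \<in> {1..r} \<Longrightarrow> ap g x \<in> {1..r}"
  using permutes_in_image[of "ap g" "{1..r}" x] by (simp add: symg_def)

lemma sym_out: "g \<in> symg r \<Longrightarrow> x \<notin> {1..r} \<Longrightarrow> ap g x = x"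
  by (simp add: symg_def permutes_def)

lemma ap_Abs_permutes: "\<sigma> permutes S \<Longrightarrow> ap (Abs_nperm \<sigma>) = \<sigma>"
  by (simp add: Abs_nperm_inverse permutes_bij)

lemma ap_image_sym: "ap ` symg r = {\<sigma>. \<sigma> permutes {1..r}}"
proof (intro equalityI subsetI)
  fix \<sigma> assume "\<sigma> \<in> {\<sigma>. \<sigma> permutes {1..r}}"
  then show "\<sigma> \<in> ap ` symg r"
    using ap_Abs_permutes[of \<sigma> "{1..r}"] by (intro image_eqI[of _ _ "Abs_nperm \<sigma>"]) (auto simp: symg_def)
qed (auto simp: symg_def)

lemma finite_sym: "finite (symg r)"
proof -
  have "finite (ap ` symg r)" unfolding ap_image_sym by (simp add: finite_permutations)
  then show ?thesis by (rule finite_imageD) (simp add: inj_on_def ap_inject)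
qed

lemma finite_subset_sym: "R \<subseteq> symg r \<Longrightarrow> finite R"
  using finite_sym finite_subset by blast

section \<open>The rational group ring and its inversion\<close>

type_synonym qring = "nperm \<Rightarrow>\<^sub>0 rat"

abbreviation gp :: "nperm \<Rightarrow> qring" where "gp g \<equiv> Poly_Mapping.single g 1"

definition psign :: "nperm \<Rightarrow> rat" where "psign g = of_int (sign (ap g))"

definition qsym :: "nat \<Rightarrow> qring set" where "qsym r = {x. Poly_Mapping.keys x \<subseteq> symg r}"

lemma gp_mult: "gp g * gp h = gp (g + h)"
  by (simp add: mult_single)

lemma scale_mult_left: "pm_scale q x * y = pm_scale q (x * y :: qring)"
  by (simp add: pm_scale_def mult_map_scale_conv_mult mult.assoc)

lemma scale_mult_right: "x * pm_scale q y = pm_scale q (x * y :: qring)"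
proof -
  have "x * Poly_Mapping.single 0 q = Poly_Mapping.single 0 q * x"
    using subset_UNIV[of "Poly_Mapping.keys x"]
  proof -
    have "Poly_Mapping.keys x \<subseteq> Poly_Mapping.keys x" by simp
    then show ?thesis
      by (rule poly_mapping_support_induct) (auto simp: mult_single distrib_left distrib_right mult.commute)
  qed
  then show ?thesis by (simp add: pm_scale_def mult_map_scale_conv_mult mult.assoc[symmetric])
qed

lemma single_eq_scale: "Poly_Mapping.single g q = pm_scale q (gp g)"
  by (simp add: pm_scale_single)

lemma qsym_single: "g \<in> symg r \<Longrightarrow> Poly_Mapping.single g q \<in> qsym r"
  by (simp add: qsym_def)

lemma qsym_zero: "0 \<in> qsym r"
  by (simp add: qsym_def)

lemma qsym_add: "x \<in> qsym r \<Longrightarrow> y \<in> qsym r \<Longrightarrow> x + y \<in> qsym r"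
  unfolding qsym_def by (simp add: keys_add_subset)

lemma qsym_sum: "(\<And>i. i \<in> I \<Longrightarrow> f i \<in> qsym r) \<Longrightarrow> sum f I \<in> qsym r"
  by (induction I rule: infinite_finite_induct) (auto simp: qsym_add qsym_zero)

lemma qsym_mult: "x \<in> qsym r \<Longrightarrow> y \<in> qsym r \<Longrightarrow> x * y \<in> qsym r"
  using keys_mult[of x y] sym_plus unfolding qsym_def by blast

lemma qsym_induct [consumes 1, case_names zero gp add]:
  assumes "x \<in> qsym r" "P 0" "\<And>g q. g \<in> symg r \<Longrightarrow> P (pm_scale q (gp g))"
    "\<And>x y. x \<in> qsym r \<Longrightarrow> y \<in> qsym r \<Longrightarrow> P x \<Longrightarrow> P y \<Longrightarrow> P (x + y)"
  shows "P x"
proof (rule poly_mapping_support_induct[OF _ finite_sym])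
  show "Poly_Mapping.keys x \<subseteq> symg r" using assms(1) by (simp add: qsym_def)
  show "P (Poly_Mapping.single g q)" if "g \<in> symg r" for g q
    using assms(3)[OF that] by (simp add: single_eq_scale[of g q])
qed (use assms in \<open>auto simp: qsym_def\<close>)

text \<open>The antiautomorphism inverting group elements; it plays the part of the conjugate
  transpose.\<close>

definition qinv :: "qring \<Rightarrow> qring" where "qinv = Poly_Mapping.map_key uminus"

lemma qinv_add: "qinv (x + y) = qinv x + qinv y"
  by (simp add: qinv_def map_key_plus)

lemma qinv_zero [simp]: "qinv 0 = 0"
  by (simp add: qinv_def)

lemma qinv_single: "qinv (Poly_Mapping.single g q) = Poly_Mapping.single (- g) q"
  using map_key_single[of uminus "- g" q] by (simp add: qinv_def)

lemma qinv_sum: "qinv (sum f I) = (\<Sum>i\<in>I. qinv (f i))"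
  by (induction I rule: infinite_finite_induct) (auto simp: qinv_add)

lemma qring_induct [case_names zero single add]:
  fixes x :: qring
  assumes "P 0" "\<And>g q. P (Poly_Mapping.single g q)" "\<And>x y. P x \<Longrightarrow> P y \<Longrightarrow> P (x + y)"
  shows "P x"
  by (rule poly_mapping_support_induct[OF order_refl finite_keys]) (use assms in auto)

lemma qinv_mult: "qinv (x * y) = qinv y * qinv x"
proof (induction x rule: qring_induct)
  case (single g q)
  show ?case
    by (induction y rule: qring_induct)
      (simp_all add: mult_single qinv_single qinv_add distrib_left distrib_right minus_add mult.commute)
qed (simp_all add: qinv_add distrib_left distrib_right)

lemma qinv_qinv [simp]: "qinv (qinv x) = x"
  by (induction x rule: qring_induct) (simp_all add: qinv_add qinv_single)

lemma qinv_qsym: "x \<in> qsym r \<Longrightarrow> qinv x \<in> qsym r"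
  by (induction rule: qsym_induct)
    (simp_all add: qinv_add qsym_add qsym_zero single_eq_scale[symmetric] qinv_single qsym_single sym_uminus)

text \<open>The coefficient of the product at the identity is the sum of the squares of the
  coefficients of x, which is positive over the rationals.\<close>

lemma mult_qinv_nonzero:
  assumes "x \<noteq> (0 :: qring)" shows "x * qinv x \<noteq> 0"
proof -
  let ?K = "Poly_Mapping.keys x"
  have x: "x = (\<Sum>g\<in>?K. Poly_Mapping.single g (Poly_Mapping.lookup x g))"
    by (rule poly_mapping_sum_singles) auto
  have "x * qinv x = (\<Sum>g\<in>?K. \<Sum>h\<in>?K. Poly_Mapping.single (g - h) (Poly_Mapping.lookup x g * Poly_Mapping.lookup x h))"
    by (subst (1 2) x) (simp add: qinv_sum qinv_single sum_product mult_single)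
  then have "Poly_Mapping.lookup (x * qinv x) 0 =
      (\<Sum>g\<in>?K. \<Sum>h\<in>?K. if h = g then Poly_Mapping.lookup x g * Poly_Mapping.lookup x g else 0)"
    by (simp add: lookup_sum lookup_single when_def)
  also have "\<dots> = (\<Sum>g\<in>?K. Poly_Mapping.lookup x g * Poly_Mapping.lookup x g)"
    by (simp add: sum.delta)
  also have "\<dots> > 0"
    using assms by (intro sum_pos) (auto simp: in_keys_iff zero_less_mult_iff linorder_neq_iff)
  finally show ?thesis by auto
qed

lemma self_neg_zero: "x = - x \<Longrightarrow> x = (0 :: qring)"
  by (rule poly_mapping_eqI) (metis lookup_uminus lookup_zero neg_equal_zero)

subsection \<open>Diagrams of partitions\<close>

definition young :: "nat list \<Rightarrow> (nat \<times> nat) set" where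
  "young \<mu> = {(i, j). i < length \<mu> \<and> j < \<mu> ! i}"

lemma card_young: "card (young \<mu>) = sum_list \<mu>"
proof -
  have "young \<mu> = Sigma {..<length \<mu>} (\<lambda>i. {..<\<mu> ! i})" by (auto simp: young_def)
  then show ?thesis by (simp add: sum_list_sum_nth atLeast0LessThan)
qed

lemma young_down: "is_partition \<mu> \<Longrightarrow> (i, j) \<in> young \<mu> \<Longrightarrow> i' \<le> i \<Longrightarrow> (i', j) \<in> young \<mu>"
  using sorted_wrt_nth_less[of "(\<ge>)" \<mu> i' i] by (cases "i' = i") (auto simp: young_def is_partition_def)

lemma tableau_entry_bij:
  "bij_betw (\<lambda>(i, j). tableau_entry \<mu> i j) (young \<mu>) {1..sum_list \<mu>}"
proof (induction \<mu> rule: rev_induct)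
  case (snoc m \<mu>)
  let ?e = "\<lambda>(i, j). tableau_entry (\<mu> @ [m]) i j"
  have Y: "young (\<mu> @ [m]) = young \<mu> \<union> {length \<mu>} \<times> {..<m}"
    by (auto simp: young_def nth_append less_Suc_eq)
  have "bij_betw ?e (young \<mu>) {1..sum_list \<mu>}"
    using snoc by (rule bij_betw_cong[THEN iffD1, rotated]) (auto simp: young_def tableau_entry_def)
  moreover have "bij_betw ?e ({length \<mu>} \<times> {..<m}) {sum_list \<mu> + 1..sum_list \<mu> + m}"
  proof (rule bij_betw_imageI)
    show "inj_on ?e ({length \<mu>} \<times> {..<m})" by (auto simp: inj_on_def tableau_entry_def)
    have "?e ` ({length \<mu>} \<times> {..<m}) = (\<lambda>j. j + (sum_list \<mu> + 1)) ` {..<m}"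
      by (force simp: tableau_entry_def image_iff)
    also have "\<dots> = {sum_list \<mu> + 1..sum_list \<mu> + m}"
      unfolding lessThan_atLeast0 image_add_atLeastLessThan' by auto
    finally show "?e ` ({length \<mu>} \<times> {..<m}) = {sum_list \<mu> + 1..sum_list \<mu> + m}" .
  qed
  ultimately have "bij_betw ?e (young \<mu> \<union> {length \<mu>} \<times> {..<m}) ({1..sum_list \<mu>} \<union> {sum_list \<mu> + 1..sum_list \<mu> + m})"
    by (rule bij_betw_combine) auto
  moreover have "{1..sum_list \<mu>} \<union> {sum_list \<mu> + 1..sum_list \<mu> + m} = {1..sum_list (\<mu> @ [m])}" by auto
  ultimately show ?case unfolding Y by simp
qed (simp add: young_def bij_betw_def)

definition pos :: "nat list \<Rightarrow> nat \<Rightarrow> nat \<times> nat" where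
  "pos \<mu> = inv_into (young \<mu>) (\<lambda>(i, j). tableau_entry \<mu> i j)"

lemma pos_bij: "bij_betw (pos \<mu>) {1..sum_list \<mu>} (young \<mu>)"
  unfolding pos_def by (rule bij_betw_inv_into[OF tableau_entry_bij])

lemma pos_entry: "(i, j) \<in> young \<mu> \<Longrightarrow> pos \<mu> (tableau_entry \<mu> i j) = (i, j)"
  using bij_betw_inv_into_left[OF tableau_entry_bij, of "(i, j)" \<mu>] by (simp add: pos_def)

definition partitions :: "nat \<Rightarrow> nat list set" where
  "partitions r = {\<mu>. is_partition \<mu> \<and> sum_list \<mu> = r}"

text \<open>The dominance order, with no condition on sizes; \<open>take\<close> past the end of a
  list leaves the partial sum at the total.\<close>

definition dominates :: "nat list \<Rightarrow> nat list \<Rightarrow> bool" where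
  "dominates \<mu> \<nu> \<longleftrightarrow> (\<forall>k. sum_list (take k \<nu>) \<le> sum_list (take k \<mu>))"

lemma dominates_antisym:
  assumes "dominates \<mu> \<nu>" "dominates \<nu> \<mu>" "\<mu> \<in> partitions r" "\<nu> \<in> partitions r"
  shows "\<mu> = \<nu>"
proof -
  have eq: "sum_list (take k \<mu>) = sum_list (take k \<nu>)" for k
    using assms(1,2) by (simp add: dominates_def le_antisym)
  have pad: "sum_list (take (Suc k) \<mu>) = sum_list (take k \<mu>) + (if k < length \<mu> then \<mu> ! k else 0)" for k and \<mu> :: "nat list"
    by (simp add: take_Suc_conv_app_nth)
  have nth: "(if k < length \<mu> then \<mu> ! k else 0) = (if k < length \<nu> then \<nu> ! k else 0)" for k
    using eq[of k] eq[of "Suc k"] pad[of k \<mu>] pad[of k \<nu>] by linarith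
  have pos: "k < length \<mu> \<Longrightarrow> 0 < \<mu> ! k" "k < length \<nu> \<Longrightarrow> 0 < \<nu> ! k" for k
    using assms(3,4) by (auto simp: partitions_def is_partition_def)
  have "k < length \<mu> \<longleftrightarrow> k < length \<nu>" for k
    using nth[of k] pos[of k] by (auto split: if_splits)
  then have "length \<mu> = length \<nu>" by (metis linorder_neq_iff)
  then show ?thesis
  proof (rule nth_equalityI)
    show "\<mu> ! k = \<nu> ! k" if "k < length \<mu>" for k
      using nth[of k] that \<open>length \<mu> = length \<nu>\<close> by simp
  qed
qed

text \<open>
  Fill the boxes of \<open>\<mu>\<close> and the rows of \<open>\<nu>\<close> with the same numbers so that no two numbers share
  a row of \<open>\<nu>\<close> and a column of \<open>\<mu>\<close>: the numbers in the first \<open>k\<close> rows of \<open>\<nu>\<close> occupy at most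
  \<open>k\<close> places in each column, hence can be pushed up into the first \<open>k\<close> rows of \<open>\<mu>\<close>.
\<close>

lemma column_count:
  assumes \<mu>: "is_partition \<mu>" and T: "bij_betw T X (young \<mu>)" and fin: "finite X"
    and inj: "inj_on (\<lambda>x. (\<rho> x, snd (T x))) X"
  shows "card {x \<in> X. \<rho> x < k \<and> snd (T x) = j} \<le> card {x \<in> X. fst (T x) < k \<and> snd (T x) = j}"
    (is "card ?A \<le> card ?B")
proof (cases "\<forall>x\<in>X. snd (T x) = j \<longrightarrow> fst (T x) < k")
  case True
  then show ?thesis using fin by (intro card_mono) auto
next
  case False
  \<comment> \<open>A box of this column lies outside the first k rows, so the column runs through
    all of these and the right-hand set has at least k elements; the left-hand one has at most k
    because \<rho> is injective on the column.\<close>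
  then obtain x where x: "x \<in> X" "snd (T x) = j" "k \<le> fst (T x)" by auto
  have "T x \<in> young \<mu>" using x(1) T by (auto simp: bij_betw_def)
  then have "(fst (T x), j) \<in> young \<mu>" using x(2) by auto
  then have row: "(i, j) \<in> young \<mu>" if "i < k" for i
    using young_down[OF \<mu>, of "fst (T x)" j i] \<open>(fst (T x), j) \<in> young \<mu>\<close> x(3) that by simp
  have "inj_on \<rho> ?A" using inj by (auto simp: inj_on_def)
  then have "card ?A \<le> card {..<k}" by (rule card_inj_on_le) auto
  moreover have "{..<k} \<subseteq> (fst \<circ> T) ` ?B"
  proof
    fix i assume "i \<in> {..<k}"
    then have "(i, j) \<in> T ` X" using row T by (auto simp: bij_betw_def)
    then obtain y where "y \<in> X" "T y = (i, j)" by (auto simp: image_iff)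
    then show "i \<in> (fst \<circ> T) ` ?B" using \<open>i \<in> {..<k}\<close> by (intro image_eqI[of _ _ y]) auto
  qed
  then have "card {..<k} \<le> card ?B" using fin surj_card_le[of ?B "{..<k}" "fst \<circ> T"] by simp
  ultimately show ?thesis by simp
qed

lemma card_rows:
  assumes T: "bij_betw T X (young \<mu>)"
  shows "card {x \<in> X. fst (T x) < k} = sum_list (take k \<mu>)"
proof -
  have "bij_betw T {x \<in> X. fst (T x) < k} {y \<in> young \<mu>. fst y < k}"
  proof (rule bij_betw_imageI)
    show "inj_on T {x \<in> X. fst (T x) < k}" using T by (auto simp: bij_betw_def intro: inj_on_subset)
    have "T ` {x \<in> X. fst (T x) < k} = {y \<in> T ` X. fst y < k}" by auto
    then show "T ` {x \<in> X. fst (T x) < k} = {y \<in> young \<mu>. fst y < k}" using T by (simp add: bij_betw_def)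
  qed
  moreover have "{y \<in> young \<mu>. fst y < k} = young (take k \<mu>)" by (auto simp: young_def)
  ultimately show ?thesis using bij_betw_same_card card_young[of "take k \<mu>"] by fastforce
qed

lemma card_by_columns:
  assumes "finite X"
  shows "card {x \<in> X. P x} = (\<Sum>j\<in>f ` X. card {x \<in> X. P x \<and> f x = j})"
proof -
  have "{x \<in> X. P x} = (\<Union>j\<in>f ` X. {x \<in> X. P x \<and> f x = j})" by auto
  then have "card {x \<in> X. P x} = card (\<Union>j\<in>f ` X. {x \<in> X. P x \<and> f x = j})" by simp
  also have "\<dots> = (\<Sum>j\<in>f ` X. card {x \<in> X. P x \<and> f x = j})"
    using assms by (intro card_UN_disjoint) auto
  finally show ?thesis .
qed

text \<open>Summing the column inequality over all columns turns it into an inequality between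
  partial sums of rows.\<close>

lemma transversal_dominates:
  assumes \<mu>: "is_partition \<mu>" and T: "bij_betw T X (young \<mu>)" and S: "bij_betw S X (young \<nu>)" and fin: "finite X"
    and inj: "inj_on (\<lambda>x. (fst (S x), snd (T x))) X"
  shows "dominates \<mu> \<nu>"
  unfolding dominates_def
proof
  fix k
  let ?c = "\<lambda>x. snd (T x)"
  have "sum_list (take k \<nu>) = (\<Sum>j\<in>?c ` X. card {x \<in> X. fst (S x) < k \<and> ?c x = j})"
    unfolding card_rows[OF S, symmetric] by (rule card_by_columns[OF fin])
  also have "\<dots> \<le> (\<Sum>j\<in>?c ` X. card {x \<in> X. fst (T x) < k \<and> ?c x = j})"
    by (intro sum_mono column_count[OF \<mu> T fin inj])
  also have "\<dots> = sum_list (take k \<mu>)"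
    unfolding card_rows[OF T, symmetric] by (rule card_by_columns[OF fin, symmetric])
  finally show "sum_list (take k \<nu>) \<le> sum_list (take k \<mu>)" .
qed

text \<open>For equal shapes the summed inequality is an equality, hence so is each column
  inequality for each k. Comparing k = i with k = i + 1 shows that the box (i, j) is hit.\<close>

lemma transversal_image:
  assumes \<mu>: "is_partition \<mu>" and T: "bij_betw T X (young \<mu>)" and S: "bij_betw S X (young \<mu>)" and fin: "finite X"
    and inj: "inj_on (\<lambda>x. (fst (S x), snd (T x))) X"
  shows "(\<lambda>x. (fst (S x), snd (T x))) ` X = young \<mu>"
proof -
  let ?c = "\<lambda>x. snd (T x)"
  let ?s = "\<lambda>k j. card {x \<in> X. fst (S x) < k \<and> ?c x = j}" and ?t = "\<lambda>k j. card {x \<in> X. fst (T x) < k \<and> ?c x = j}"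
  have sums: "(\<Sum>j\<in>?c ` X. ?s k j) = (\<Sum>j\<in>?c ` X. ?t k j)" for k
    unfolding card_by_columns[OF fin, symmetric] card_rows[OF S] card_rows[OF T] ..
  have eq: "?s k j = ?t k j" if "j \<in> ?c ` X" for k j
  proof (rule ccontr)
    assume "?s k j \<noteq> ?t k j"
    then have "?s k j < ?t k j" using column_count[OF \<mu> T fin inj, of k j] by simp
    then have "(\<Sum>j\<in>?c ` X. ?s k j) < (\<Sum>j\<in>?c ` X. ?t k j)"
      using that fin column_count[OF \<mu> T fin inj] by (intro sum_strict_mono_ex1) auto
    then show False using sums[of k] by simp
  qed
  have "young \<mu> \<subseteq> (\<lambda>x. (fst (S x), snd (T x))) ` X"
  proof
    fix b assume b: "b \<in> young \<mu>"
    obtain i j where ij: "b = (i, j)" by fastforce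
    obtain y where y: "y \<in> X" "T y = (i, j)" using b ij T by (metis bij_betw_def imageE)
    have "?t i j < ?t (Suc i) j"
    proof (rule psubset_card_mono)
      have "y \<in> {x \<in> X. fst (T x) < Suc i \<and> ?c x = j}" "y \<notin> {x \<in> X. fst (T x) < i \<and> ?c x = j}"
        using y by auto
      then show "{x \<in> X. fst (T x) < i \<and> ?c x = j} \<subset> {x \<in> X. fst (T x) < Suc i \<and> ?c x = j}" by auto
    qed (use fin in auto)
    then have lt: "?s i j < ?s (Suc i) j" using eq[of j i] eq[of j "Suc i"] y by force
    show "b \<in> (\<lambda>x. (fst (S x), snd (T x))) ` X"
    proof (rule ccontr)
      assume "b \<notin> (\<lambda>x. (fst (S x), snd (T x))) ` X"
      then have "{x \<in> X. fst (S x) < Suc i \<and> ?c x = j} = {x \<in> X. fst (S x) < i \<and> ?c x = j}"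
        using ij by (auto simp: less_Suc_eq image_iff)
      then show False using lt by simp
    qed
  qed
  moreover have "card ((\<lambda>x. (fst (S x), snd (T x))) ` X) = card (young \<mu>)"
    using card_image[OF inj] bij_betw_same_card[OF T] by simp
  ultimately show ?thesis using card_subset_eq[of "(\<lambda>x. (fst (S x), snd (T x))) ` X" "young \<mu>"] fin by simp
qed

text \<open>Taking for f the row or the column of an entry gives the two Young subgroups of the
  tableau.\<close>

definition fibre_group :: "nat \<Rightarrow> (nat \<Rightarrow> 'a) \<Rightarrow> nperm set" where
  "fibre_group r f = {g \<in> symg r. \<forall>x\<in>{1..r}. f (ap g x) = f x}"

section \<open>Young subgroups and symmetrizers\<close>

abbreviation row_group :: "nat list \<Rightarrow> nperm set" where
  "row_group \<mu> \<equiv> fibre_group (sum_list \<mu>) (\<lambda>x. fst (pos \<mu> x))"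

abbreviation col_group :: "nat list \<Rightarrow> nperm set" where
  "col_group \<mu> \<equiv> fibre_group (sum_list \<mu>) (\<lambda>x. snd (pos \<mu> x))"

definition row_sym :: "nat list \<Rightarrow> qring" where
  "row_sym \<mu> = (\<Sum>g\<in>row_group \<mu>. gp g)"

definition col_sym :: "nat list \<Rightarrow> qring" where
  "col_sym \<mu> = (\<Sum>g\<in>col_group \<mu>. pm_scale (psign g) (gp g))"

lemma fibre_group_sym: "g \<in> fibre_group r f \<Longrightarrow> g \<in> symg r"
  by (simp add: fibre_group_def)

lemma finite_fibre_group: "finite (fibre_group r f)"
  by (auto intro!: finite_subset_sym fibre_group_sym)

lemma fibre_group_zero: "0 \<in> fibre_group r f"
  by (simp add: fibre_group_def)

lemma fibre_group_plus: "g \<in> fibre_group r f \<Longrightarrow> h \<in> fibre_group r f \<Longrightarrow> g + h \<in> fibre_group r f"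
  using sym_in by (auto simp: fibre_group_def sym_plus)

lemma fibre_group_uminus:
  assumes "g \<in> fibre_group r f" shows "- g \<in> fibre_group r f"
proof -
  have g: "g \<in> symg r" using assms by (rule fibre_group_sym)
  have "f (ap (- g) x) = f x" if "x \<in> {1..r}" for x
  proof -
    have "ap (- g) x \<in> {1..r}" using sym_in[OF sym_uminus[OF g] that] .
    then have "f (ap g (ap (- g) x)) = f (ap (- g) x)" using assms unfolding fibre_group_def by blast
    then show ?thesis by simp
  qed
  then show ?thesis using g by (simp add: fibre_group_def sym_uminus)
qed

lemma sym_permutation: "g \<in> symg r \<Longrightarrow> permutation (ap g)"
  unfolding symg_def permutation_permutes by blast

lemma psign_plus: "g \<in> symg r \<Longrightarrow> h \<in> symg r \<Longrightarrow> psign (g + h) = psign g * psign h"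
  by (simp add: psign_def sign_compose sym_permutation)

lemma psign_zero [simp]: "psign 0 = 1"
  by (simp add: psign_def)

lemma psign_square [simp]: "psign g * psign g = 1"
  by (simp add: psign_def sign_def)

lemma psign_uminus: "g \<in> symg r \<Longrightarrow> psign (- g) = psign g"
  by (simp add: psign_def ap_uminus sign_inverse sym_permutation)

lemma row_sym_in: "row_sym \<mu> \<in> qsym (sum_list \<mu>)"
  unfolding row_sym_def by (intro qsym_sum qsym_single fibre_group_sym)

lemma col_sym_in: "col_sym \<mu> \<in> qsym (sum_list \<mu>)"
  unfolding col_sym_def single_eq_scale[symmetric] by (intro qsym_sum qsym_single fibre_group_sym)

lemma gp_row_sym: "g \<in> row_group \<mu> \<Longrightarrow> gp g * row_sym \<mu> = row_sym \<mu>"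
  unfolding row_sym_def sum_distrib_left gp_mult
  by (rule sum.reindex_bij_witness[of _ "\<lambda>h. - g + h" "\<lambda>h. g + h"])
    (auto simp: add.assoc[symmetric] fibre_group_plus fibre_group_uminus)

lemma row_sym_gp: "g \<in> row_group \<mu> \<Longrightarrow> row_sym \<mu> * gp g = row_sym \<mu>"
  unfolding row_sym_def sum_distrib_right gp_mult
  by (rule sum.reindex_bij_witness[of _ "\<lambda>h. h + - g" "\<lambda>h. h + g"])
    (auto simp: add.assoc fibre_group_plus fibre_group_uminus simp del: add_uminus_conv_diff)

lemma gp_col_sym: "g \<in> col_group \<mu> \<Longrightarrow> gp g * col_sym \<mu> = pm_scale (psign g) (col_sym \<mu>)"
  unfolding col_sym_def sum_distrib_left scale_mult_right gp_mult pm_scale_sum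
  by (rule sum.reindex_bij_witness[of _ "\<lambda>h. - g + h" "\<lambda>h. g + h"])
    (auto simp: add.assoc[symmetric] fibre_group_plus fibre_group_uminus
      psign_plus[OF fibre_group_sym fibre_group_sym] mult.assoc[symmetric])

lemma row_sym_square: "row_sym \<mu> * row_sym \<mu> = pm_scale (of_nat (card (row_group \<mu>))) (row_sym \<mu>)"
proof -
  have "row_sym \<mu> * row_sym \<mu> = (\<Sum>g\<in>row_group \<mu>. gp g * row_sym \<mu>)"
    by (subst row_sym_def) (simp add: sum_distrib_right)
  also have "\<dots> = of_nat (card (row_group \<mu>)) * row_sym \<mu>" by (simp add: gp_row_sym)
  finally show ?thesis by (simp add: pm_scale_def mult_map_scale_conv_mult)
qed

lemma col_sym_square: "col_sym \<mu> * col_sym \<mu> = pm_scale (of_nat (card (col_group \<mu>))) (col_sym \<mu>)"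
proof -
  have "col_sym \<mu> * col_sym \<mu> = (\<Sum>g\<in>col_group \<mu>. pm_scale (psign g) (gp g * col_sym \<mu>))"
    by (subst col_sym_def) (simp add: sum_distrib_right scale_mult_left)
  also have "\<dots> = of_nat (card (col_group \<mu>)) * col_sym \<mu>" by (simp add: gp_col_sym)
  finally show ?thesis by (simp add: pm_scale_def mult_map_scale_conv_mult)
qed

lemma qinv_scale: "qinv (pm_scale q x) = pm_scale q (qinv x)"
  by (induction x rule: qring_induct)
    (simp_all add: qinv_add qinv_single pm_scale_single DS.scale_right_distrib)

lemma qinv_row_sym: "qinv (row_sym \<mu>) = row_sym \<mu>"
  unfolding row_sym_def qinv_sum qinv_single
  by (rule sum.reindex_bij_witness[of _ uminus uminus]) (auto simp: fibre_group_uminus)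

lemma qinv_col_sym: "qinv (col_sym \<mu>) = col_sym \<mu>"
  unfolding col_sym_def qinv_sum qinv_scale qinv_single
  by (rule sum.reindex_bij_witness[of _ uminus uminus]) (auto simp: fibre_group_uminus psign_uminus[OF fibre_group_sym])

definition swap :: "nat \<Rightarrow> nat \<Rightarrow> nperm" where "swap x y = Abs_nperm (transpose x y)"

lemma ap_swap: "ap (swap x y) = transpose x y"
  by (simp add: swap_def Abs_nperm_inverse)

lemma swap_in: "x \<in> {1..r} \<Longrightarrow> y \<in> {1..r} \<Longrightarrow> swap x y \<in> symg r"
  using permutes_swap_id[of x "{1..r}" y] by (simp add: symg_def ap_swap)

text \<open>A transposition in the row group of \<open>\<nu>\<close> is moved through \<open>g\<close> into the column group of \<open>\<mu>\<close>.\<close>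

lemma row_gp_col_zero:
  assumes \<mu>: "sum_list \<mu> = r" and \<nu>: "sum_list \<nu> = r" and g: "g \<in> symg r"
    and ninj: "\<not> inj_on (\<lambda>x. (fst (pos \<nu> x), snd (pos \<mu> (ap (- g) x)))) {1..r}"
  shows "row_sym \<nu> * gp g * col_sym \<mu> = 0"
proof -
  obtain x y where xy: "x \<in> {1..r}" "y \<in> {1..r}" "x \<noteq> y" "fst (pos \<nu> x) = fst (pos \<nu> y)"
    "snd (pos \<mu> (ap (- g) x)) = snd (pos \<mu> (ap (- g) y))"
    using ninj by (auto simp: inj_on_def)
  \<comment> \<open>The transposition t preserves the rows of \<nu>, and its conjugate u preserves
    the columns of \<mu>. Since t is absorbed on the left and u is odd, the product equals its own
    negative.\<close>
  let ?t = "swap x y" and ?u = "- g + (swap x y + g)"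
  have t: "?t \<in> symg r" using swap_in xy by simp
  have trow: "?t \<in> row_group \<nu>"
    using t xy \<nu> by (auto simp: fibre_group_def ap_swap transpose_def)
  have u: "?u \<in> symg r" using t g by (simp add: sym_plus sym_uminus)
  have ucol: "?u \<in> col_group \<mu>"
  proof -
    have "snd (pos \<mu> (ap ?u z)) = snd (pos \<mu> z)" for z
    proof (cases "ap g z = x \<or> ap g z = y")
      case True
      then have "z = ap (- g) x \<or> z = ap (- g) y" by auto
      then show ?thesis using xy by (auto simp: ap_swap)
    next
      case False
      then show ?thesis by (simp add: ap_swap transpose_def)
    qed
    then show ?thesis using u \<mu> by (simp add: fibre_group_def)
  qed
  have "psign ?u = psign (- g) * (psign ?t * psign g)"
    using g t by (simp add: psign_plus[of _ r] sym_plus sym_uminus)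
  also have "\<dots> = psign ?t" using g psign_uminus[of g r] by (simp add: mult.left_commute[of "psign g" "psign ?t"])
  also have "\<dots> = -1" using xy by (simp add: psign_def ap_swap sign_swap_id)
  finally have su: "psign ?u = -1" .
  have "row_sym \<nu> * gp g * col_sym \<mu> = row_sym \<nu> * (gp ?t * gp g) * col_sym \<mu>"
    using row_sym_gp[OF trow] by (simp only: mult.assoc[symmetric])
  also have "gp ?t * gp g = gp g * gp ?u" unfolding gp_mult by (simp add: add.assoc[symmetric])
  also have "row_sym \<nu> * (gp g * gp ?u) * col_sym \<mu> = row_sym \<nu> * gp g * (gp ?u * col_sym \<mu>)"
    by (simp only: mult.assoc)
  also have "\<dots> = - (row_sym \<nu> * gp g * col_sym \<mu>)"
    by (simp add: gp_col_sym[OF ucol] su scale_mult_right)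
  finally show ?thesis by (rule self_neg_zero)
qed

lemma pos_conj_bij: "g \<in> symg (sum_list \<mu>) \<Longrightarrow> bij_betw (\<lambda>x. pos \<mu> (ap (- g) x)) {1..sum_list \<mu>} (young \<mu>)"
  using bij_betw_trans[OF permutes_imp_bij pos_bij, of "ap (- g)" \<mu>] sym_uminus[of g]
  by (simp add: symg_def o_def)

text \<open>If a group element g survived, no two entries would share a row of \<nu> and a column of
  \<mu> read through g, and dominance would follow.\<close>

lemma row_col_zero:
  assumes \<mu>: "\<mu> \<in> partitions r" and \<nu>: "\<nu> \<in> partitions r" and nd: "\<not> dominates \<mu> \<nu>" and x: "x \<in> qsym r"
  shows "row_sym \<nu> * x * col_sym \<mu> = 0"
  using x
proof (induction rule: qsym_induct)
  case (gp g q)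
  have r: "sum_list \<mu> = r" "sum_list \<nu> = r" "is_partition \<mu>" using \<mu> \<nu> by (auto simp: partitions_def)
  have "\<not> inj_on (\<lambda>x. (fst (pos \<nu> x), snd (pos \<mu> (ap (- g) x)))) {1..r}"
  proof
    assume "inj_on (\<lambda>x. (fst (pos \<nu> x), snd (pos \<mu> (ap (- g) x)))) {1..r}"
    then have "dominates \<mu> \<nu>"
      using transversal_dominates[OF r(3), of "\<lambda>x. pos \<mu> (ap (- g) x)" "{1..r}" "pos \<nu>" \<nu>]
        pos_conj_bij[of g \<mu>] pos_bij[of \<nu>] gp r by simp
    then show False using nd by simp
  qed
  from row_gp_col_zero[OF r(1,2) gp this] show ?case
    by (simp add: scale_mult_left scale_mult_right)
qed (simp_all add: distrib_left distrib_right)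

text \<open>This is von Neumann's lemma: a group element either is a product of a row and a column
  permutation and contributes a sign, or is killed by a transposition preserving both rows and moved
  columns.\<close>

lemma row_col_same:
  assumes \<mu>: "\<mu> \<in> partitions r" and x: "x \<in> qsym r"
  shows "\<exists>q. row_sym \<mu> * x * col_sym \<mu> = pm_scale q (row_sym \<mu> * col_sym \<mu>)"
  using x
proof (induction rule: qsym_induct)
  case zero
  show ?case by (rule exI[of _ 0]) simp
next
  case (add x y)
  then obtain p q where "row_sym \<mu> * x * col_sym \<mu> = pm_scale p (row_sym \<mu> * col_sym \<mu>)"
    "row_sym \<mu> * y * col_sym \<mu> = pm_scale q (row_sym \<mu> * col_sym \<mu>)" by blast
  then have "row_sym \<mu> * (x + y) * col_sym \<mu> = pm_scale (p + q) (row_sym \<mu> * col_sym \<mu>)"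
    by (simp add: distrib_left distrib_right DS.scale_left_distrib)
  then show ?case ..
next
  case (gp g q)
  have r: "sum_list \<mu> = r" "is_partition \<mu>" using \<mu> by (auto simp: partitions_def)
  have "\<exists>s. row_sym \<mu> * gp g * col_sym \<mu> = pm_scale s (row_sym \<mu> * col_sym \<mu>)"
  proof (cases "inj_on (\<lambda>x. (fst (pos \<mu> x), snd (pos \<mu> (ap (- g) x)))) {1..r}")
    case False
    then show ?thesis using row_gp_col_zero[OF r(1) r(1) gp] by (intro exI[of _ 0]) simp
  next
    case True
    let ?f = "\<lambda>x. (fst (pos \<mu> x), snd (pos \<mu> (ap (- g) x)))"
    have im: "?f ` {1..r} = young \<mu>"
      using transversal_image[OF r(2), of "\<lambda>x. pos \<mu> (ap (- g) x)" "{1..r}" "pos \<mu>"]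
        pos_conj_bij[of g \<mu>] pos_bij[of \<mu>] gp r True by simp
    then have fb: "bij_betw ?f {1..r} (young \<mu>)" using True by (simp add: bij_betw_def)
    define e where "e = (\<lambda>(i, j). tableau_entry \<mu> i j)"
    have eb: "bij_betw e (young \<mu>) {1..r}" using tableau_entry_bij[of \<mu>] r by (simp add: e_def)
    have pe: "pos \<mu> (e y) = y" if "y \<in> young \<mu>" for y using pos_entry[of "fst y" "snd y" \<mu>] that by (simp add: e_def split_beta)
    have "bij_betw (\<lambda>x. e (?f x)) {1..r} {1..r}" using bij_betw_trans[OF fb eb] by (simp add: o_def)
    then obtain \<sigma> where \<sigma>: "\<sigma> permutes {1..r}" "\<And>x. x \<in> {1..r} \<Longrightarrow> \<sigma> x = e (?f x)"
      using permutation_extension[of "\<lambda>x. e (?f x)" r] by (auto simp: bij_betw_def)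
    \<comment> \<open>p moves x within its row to the column of the preimage of x under g. Thus p
      preserves rows and p + g preserves columns, so g is the inverse of p followed on the right by
      a column permutation.\<close>
    define p where "p = Abs_nperm \<sigma>"
    have ap_p: "ap p = \<sigma>" unfolding p_def by (rule ap_Abs_permutes[OF \<sigma>(1)])
    have psym: "p \<in> symg r" using \<sigma>(1) by (simp add: symg_def ap_p)
    have pos_p: "pos \<mu> (ap p x) = ?f x" if "x \<in> {1..r}" for x
    proof -
      have "?f x \<in> young \<mu>" using im that by blast
      then show ?thesis using \<sigma>(2)[OF that] pe ap_p by simp
    qed
    have prow: "p \<in> row_group \<mu>" using psym pos_p r by (simp add: fibre_group_def)
    have qcol: "p + g \<in> col_group \<mu>"
      using psym gp r pos_p[OF sym_in[OF gp]] by (simp add: fibre_group_def sym_plus)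
    have "row_sym \<mu> * gp g * col_sym \<mu> = row_sym \<mu> * gp p * gp g * col_sym \<mu>"
      by (simp add: row_sym_gp[OF prow])
    also have "\<dots> = row_sym \<mu> * (gp (p + g) * col_sym \<mu>)" by (simp only: mult.assoc gp_mult[symmetric])
    also have "\<dots> = pm_scale (psign (p + g)) (row_sym \<mu> * col_sym \<mu>)"
      by (simp add: gp_col_sym[OF qcol] scale_mult_right)
    finally show ?thesis ..
  qed
  then obtain s where "row_sym \<mu> * gp g * col_sym \<mu> = pm_scale s (row_sym \<mu> * col_sym \<mu>)" ..
  then have "row_sym \<mu> * pm_scale q (gp g) * col_sym \<mu> = pm_scale (q * s) (row_sym \<mu> * col_sym \<mu>)"
    by (simp add: scale_mult_left scale_mult_right)
  then show ?case ..
qed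

definition ysym :: "nat list \<Rightarrow> qring" where "ysym \<mu> = row_sym \<mu> * col_sym \<mu>"

lemma ysym_in: "\<mu> \<in> partitions r \<Longrightarrow> ysym \<mu> \<in> qsym r"
  unfolding ysym_def using qsym_mult[OF row_sym_in col_sym_in] by (auto simp: partitions_def)

text \<open>Antisymmetry of dominance kills either the outer row-column product or the reverse one.
  In the second case the inversion antiautomorphism, which fixes both symmetrizers, makes the inner
  column-row product vanish.\<close>

lemma ysym_orthogonal:
  assumes \<mu>: "\<mu> \<in> partitions r" and \<nu>: "\<nu> \<in> partitions r" and ne: "\<nu> \<noteq> \<mu>" and x: "x \<in> qsym r"
  shows "ysym \<nu> * x * ysym \<mu> = 0"
proof -
  have in_r: "row_sym \<mu> \<in> qsym r" "col_sym \<nu> \<in> qsym r"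
    using row_sym_in[of \<mu>] col_sym_in[of \<nu>] \<mu> \<nu> by (auto simp: partitions_def)
  have eq: "ysym \<nu> * x * ysym \<mu> = row_sym \<nu> * (col_sym \<nu> * x * row_sym \<mu>) * col_sym \<mu>"
    by (simp add: ysym_def mult.assoc)
  consider "\<not> dominates \<mu> \<nu>" | "\<not> dominates \<nu> \<mu>" using dominates_antisym[OF _ _ \<mu> \<nu>] ne by blast
  then show ?thesis
  proof cases
    case 1
    then show ?thesis unfolding eq using row_col_zero[OF \<mu> \<nu>] x in_r qsym_mult by simp
  next
    case 2
    have "qinv (row_sym \<mu> * qinv x * col_sym \<nu>) = 0"
      using row_col_zero[OF \<nu> \<mu> 2 qinv_qsym[OF x]] by simp
    then have "col_sym \<nu> * x * row_sym \<mu> = 0"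
      by (simp add: qinv_mult qinv_row_sym qinv_col_sym mult.assoc)
    then show ?thesis unfolding eq by simp
  qed
qed

lemma ysym_corner:
  assumes \<mu>: "\<mu> \<in> partitions r" and x: "x \<in> qsym r"
  shows "\<exists>q. ysym \<mu> * x * ysym \<mu> = pm_scale q (ysym \<mu>)"
proof -
  have in_r: "row_sym \<mu> \<in> qsym r" "col_sym \<mu> \<in> qsym r"
    using row_sym_in[of \<mu>] col_sym_in[of \<mu>] \<mu> by (auto simp: partitions_def)
  have "ysym \<mu> * x * ysym \<mu> = row_sym \<mu> * (col_sym \<mu> * x * row_sym \<mu>) * col_sym \<mu>"
    by (simp add: ysym_def mult.assoc)
  then show ?thesis using row_col_same[OF \<mu>, of "col_sym \<mu> * x * row_sym \<mu>"] x in_r qsym_mult by (simp add: ysym_def)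
qed

lemma row_col_trivial:
  assumes "g \<in> row_group \<mu>" "g \<in> col_group \<mu>" shows "g = 0"
proof (rule nperm_eqI)
  fix x
  have g: "g \<in> symg (sum_list \<mu>)" using assms(1) by (rule fibre_group_sym)
  show "ap g x = ap 0 x"
  proof (cases "x \<in> {1..sum_list \<mu>}")
    case True
    then have "pos \<mu> (ap g x) = pos \<mu> x" using assms by (simp add: fibre_group_def prod_eq_iff)
    moreover have "inj_on (pos \<mu>) {1..sum_list \<mu>}" using pos_bij by (rule bij_betw_imp_inj_on)
    ultimately have "ap g x = x" using inj_onD sym_in[OF g True] True by metis
    then show ?thesis by simp
  next
    case False
    then show ?thesis using sym_out[OF g] by simp
  qed
qed

text \<open>A row and a column meet in at most one box, so g + h is the identity only if both
  are.\<close>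

lemma lookup_ysym_zero: "Poly_Mapping.lookup (ysym \<mu>) 0 = 1"
proof -
  have "ysym \<mu> = (\<Sum>g\<in>row_group \<mu>. \<Sum>h\<in>col_group \<mu>. Poly_Mapping.single (g + h) (psign h))"
    by (simp add: ysym_def row_sym_def col_sym_def sum_product pm_scale_single mult_single)
  then have "Poly_Mapping.lookup (ysym \<mu>) 0 = (\<Sum>g\<in>row_group \<mu>. \<Sum>h\<in>col_group \<mu>. if g + h = 0 then psign h else 0)"
    by (simp add: lookup_sum lookup_single when_def)
  also have "\<dots> = (\<Sum>g\<in>row_group \<mu>. \<Sum>h\<in>col_group \<mu>. if h = 0 \<and> g = 0 then 1 else 0)"
  proof (intro sum.cong refl)
    fix g h assume g: "g \<in> row_group \<mu>" and h: "h \<in> col_group \<mu>"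
    have "g + h = 0 \<longleftrightarrow> h = 0 \<and> g = 0"
    proof
      assume "g + h = 0"
      then have "h = - g" using minus_unique by metis
      then show "h = 0 \<and> g = 0" using g h fibre_group_uminus row_col_trivial[of h \<mu>] by auto
    qed simp
    then show "(if g + h = 0 then psign h else 0) = (if h = 0 \<and> g = 0 then 1 else 0)" by simp
  qed
  also have "\<dots> = (\<Sum>g\<in>row_group \<mu>. if g = 0 then 1 else 0)"
    by (intro sum.cong refl) (auto simp: finite_fibre_group fibre_group_zero)
  also have "\<dots> = 1" by (simp add: finite_fibre_group fibre_group_zero)
  finally show ?thesis .
qed

lemma ysym_nonzero: "ysym \<mu> \<noteq> 0"
  using lookup_ysym_zero[of \<mu>] by auto

lemma ysym_square:
  assumes \<mu>: "\<mu> \<in> partitions r"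
  obtains q where "q \<noteq> 0" "ysym \<mu> * ysym \<mu> = pm_scale q (ysym \<mu>)"
proof -
  have "1 \<in> qsym r" using qsym_single[of 0 r 1] by simp
  then obtain q where q: "ysym \<mu> * ysym \<mu> = pm_scale q (ysym \<mu>)"
    using ysym_corner[OF \<mu>, of 1] by auto
  have "q \<noteq> 0"
  proof
    assume "q = 0"
    then have z: "row_sym \<mu> * (col_sym \<mu> * (row_sym \<mu> * col_sym \<mu>)) = 0"
      using q by (simp add: ysym_def mult.assoc)
    \<comment> \<open>Write a and b for the row and column sums. Then h is a multiple of a b a, and
      h h is a multiple of a b a b a, which vanishes with the square of a b. As h is fixed by
      inversion, positivity gives h = 0, and once more a b = 0.\<close>
    let ?h = "ysym \<mu> * qinv (ysym \<mu>)"
    have h: "?h = pm_scale (of_nat (card (col_group \<mu>))) (row_sym \<mu> * col_sym \<mu> * row_sym \<mu>)"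
      using col_sym_square[of \<mu>]
      by (simp add: ysym_def qinv_mult qinv_row_sym qinv_col_sym mult.assoc)
        (simp add: mult.assoc[symmetric] scale_mult_left scale_mult_right)
    have "row_sym \<mu> * col_sym \<mu> * row_sym \<mu> * (row_sym \<mu> * col_sym \<mu> * row_sym \<mu>) =
      row_sym \<mu> * col_sym \<mu> * (row_sym \<mu> * row_sym \<mu>) * col_sym \<mu> * row_sym \<mu>"
      by (simp add: mult.assoc)
    also have "\<dots> = pm_scale (of_nat (card (row_group \<mu>))) (row_sym \<mu> * (col_sym \<mu> * (row_sym \<mu> * col_sym \<mu>)) * row_sym \<mu>)"
      by (simp add: row_sym_square scale_mult_left scale_mult_right mult.assoc)
    finally have "?h * ?h = 0" using z by (simp add: h scale_mult_left scale_mult_right)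
    moreover have "qinv ?h = ?h" by (simp add: qinv_mult)
    ultimately show False using mult_qinv_nonzero[of ?h] mult_qinv_nonzero[OF ysym_nonzero[of \<mu>]] by simp
  qed
  then show thesis using q that by blast
qed

subsection \<open>Cycle types\<close>

lemma orbit_parametrization:
  assumes "permutation f"
  shows "bij_betw (\<lambda>n. (f ^^ n) x) {..<card (orbit f x)} (orbit f x)"
    and "(f ^^ card (orbit f x)) x = x"
proof -
  have x: "x \<in> orbit f x" using assms by (rule permutation_self_in_orbit)
  have b: "bij_betw (\<lambda>n. (f ^^ n) x) {0..<funpow_dist1 f x x} (orbit f x)"
    using inj_on_funpow_dist1[OF x] orbit_conv_funpow_dist1[OF x] by (simp add: bij_betw_def)
  then have c: "card (orbit f x) = funpow_dist1 f x x" using bij_betw_same_card by fastforce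
  show "bij_betw (\<lambda>n. (f ^^ n) x) {..<card (orbit f x)} (orbit f x)"
    unfolding c lessThan_atLeast0 by (rule b)
  show "(f ^^ card (orbit f x)) x = x"
    unfolding c by (rule funpow_dist1_prop[OF x])
qed

text \<open>\<beta> fills the boxes of \<mu> so that h advances each row by one step; the modulus
  closes a row into a cycle.\<close>

definition has_cycle_type :: "nat \<Rightarrow> nperm \<Rightarrow> nat list \<Rightarrow> bool" where
  "has_cycle_type r h \<mu> \<longleftrightarrow> (\<exists>\<beta>. bij_betw \<beta> (young \<mu>) {1..r} \<and>
     (\<forall>i j. (i, j) \<in> young \<mu> \<longrightarrow> ap h (\<beta> (i, j)) = \<beta> (i, Suc j mod \<mu> ! i)))"

text \<open>The rows of the filling are the orbits in order of decreasing size, each started at a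
  chosen representative and continued by iteration; fixed points give rows of length 1.\<close>

lemma cycle_type_exists:
  assumes h: "h \<in> symg r"
  obtains \<mu> where "\<mu> \<in> partitions r" "has_cycle_type r h \<mu>"
proof -
  define f where "f = ap h"
  have f: "f permutes {1..r}" "permutation f" using h sym_permutation by (auto simp: f_def symg_def)
  have same: "orbit f y = orbit f x" if "y \<in> orbit f x" for x y
    using orbit_cyclic_eq3[OF cyclic_on_orbit'[OF f(2)] that] .
  obtain os0 where os0: "distinct os0" "set os0 = orbit f ` {1..r}"
    using finite_distinct_list[of "orbit f ` {1..r}"] by auto
  define os where "os = rev (sort_key card os0)"
  have os: "distinct os" "set os = orbit f ` {1..r}" using os0 by (auto simp: os_def)
  define \<mu> where "\<mu> = map card os"
  define rep where "rep c = (SOME x. x \<in> c)" for c :: "nat set"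
  have orb: "orbit f (rep c) = c \<and> rep c \<in> c \<and> c \<subseteq> {1..r}" if c: "c \<in> set os" for c
  proof -
    obtain x where x: "x \<in> {1..r}" "c = orbit f x" using c os(2) by auto
    have "x \<in> c" using x(2) permutation_self_in_orbit[OF f(2)] by simp
    then have "rep c \<in> c" unfolding rep_def by (rule someI)
    then show ?thesis using same x permutes_orbit_subset[OF f(1)] by auto
  qed
  have yi: "i < length os \<and> j < card (os ! i)" if "(i, j) \<in> young \<mu>" for i j
    using that by (auto simp: young_def \<mu>_def)
  define \<beta> where "\<beta> = (\<lambda>(i, j). (f ^^ j) (rep (os ! i)))"
  have par: "bij_betw (\<lambda>n. (f ^^ n) (rep c)) {..<card c} c" "(f ^^ card c) (rep c) = rep c" if "c \<in> set os" for c
    using orbit_parametrization[OF f(2), of "rep c"] orb[OF that] by auto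
  have \<beta>in: "\<beta> (i, j) \<in> os ! i" if "(i, j) \<in> young \<mu>" for i j
    using par(1)[of "os ! i"] yi[OF that] by (auto simp: \<beta>_def bij_betw_def)
  have bij: "bij_betw \<beta> (young \<mu>) {1..r}"
  proof (rule bij_betw_imageI)
    show "inj_on \<beta> (young \<mu>)"
    proof (rule inj_onI)
      fix a b assume a: "a \<in> young \<mu>" and b: "b \<in> young \<mu>" and eq: "\<beta> a = \<beta> b"
      obtain i j i' j' where ab: "a = (i, j)" "b = (i', j')" by fastforce
      have i: "i < length os" "j < card (os ! i)" "i' < length os" "j' < card (os ! i')"
        using a b ab yi by auto
      have "\<beta> a \<in> os ! i" using \<beta>in[of i j] a ab by simp
      moreover have "\<beta> a \<in> os ! i'" unfolding eq using \<beta>in[of i' j'] b ab by simp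
      moreover obtain x y where "os ! i = orbit f x" "os ! i' = orbit f y"
        using os(2) i nth_mem by (metis imageE)
      ultimately have "os ! i = os ! i'" using same by metis
      then have ii: "i = i'" using os(1) i nth_eq_iff_index_eq by blast
      then have "j = j'" using eq par(1)[of "os ! i"] i ab by (auto simp: \<beta>_def bij_betw_def inj_on_def)
      then show "a = b" using ab ii by simp
    qed
    show "\<beta> ` young \<mu> = {1..r}"
    proof (intro equalityI subsetI)
      fix x assume "x \<in> \<beta> ` young \<mu>"
      then obtain i j where "(i, j) \<in> young \<mu>" "x = \<beta> (i, j)" by auto
      then have "x \<in> os ! i" "os ! i \<in> set os" using \<beta>in yi by auto
      then show "x \<in> {1..r}" using orb by blast
    next
      fix x assume x: "x \<in> {1..r}"
      then obtain i where i: "i < length os" "os ! i = orbit f x" using os(2) by (metis imageI in_set_conv_nth)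
      then have "x \<in> os ! i" using permutation_self_in_orbit[OF f(2)] by simp
      moreover have "(\<lambda>n. (f ^^ n) (rep (os ! i))) ` {..<card (os ! i)} = os ! i"
        using par(1)[of "os ! i"] i(1) by (simp add: bij_betw_def)
      ultimately obtain j where "j \<in> {..<card (os ! i)}" "x = (f ^^ j) (rep (os ! i))" by blast
      then have "j < card (os ! i)" "x = \<beta> (i, j)" by (simp_all add: \<beta>_def)
      then show "x \<in> \<beta> ` young \<mu>" using i by (intro image_eqI[of _ _ "(i, j)"]) (auto simp: young_def \<mu>_def)
    qed
  qed
  have cyc: "ap h (\<beta> (i, j)) = \<beta> (i, Suc j mod \<mu> ! i)" if "(i, j) \<in> young \<mu>" for i j
  proof -
    have i: "i < length os" "j < card (os ! i)" "\<mu> ! i = card (os ! i)" using yi[OF that] by (auto simp: \<mu>_def)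
    have step: "ap h (\<beta> (i, j)) = (f ^^ Suc j) (rep (os ! i))" by (simp add: \<beta>_def f_def)
    show ?thesis
    proof (cases "Suc j = card (os ! i)")
      case True
      then have "(f ^^ Suc j) (rep (os ! i)) = rep (os ! i)" using par(2)[of "os ! i"] i by simp
      then show ?thesis unfolding step using True i by (simp add: \<beta>_def)
    next
      case False
      then show ?thesis using i by (simp add: \<beta>_def f_def)
    qed
  qed
  have "\<mu> \<in> partitions r"
  proof -
    have "sum_list \<mu> = r" using bij_betw_same_card[OF bij] by (simp add: card_young)
    moreover have "sorted_wrt (\<ge>) \<mu>"
      by (simp add: \<mu>_def os_def rev_map[symmetric] sorted_wrt_rev)
    moreover have "0 < n" if n: "n \<in> set \<mu>" for n
    proof -
      obtain c where c: "c \<in> set os" "n = card c" using n by (auto simp: \<mu>_def)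
      then have "rep c \<in> c" "finite c" using orb finite_subset by blast+
      then show ?thesis using c by (auto simp: card_gt_0_iff)
    qed
    ultimately show ?thesis by (auto simp: partitions_def is_partition_def)
  qed
  moreover have "has_cycle_type r h \<mu>" using bij cyc by (auto simp: has_cycle_type_def)
  ultimately show thesis by (rule that)
qed

text \<open>The conjugating permutation matches the two fillings box by box.\<close>

lemma cycle_type_conjugate:
  assumes h: "h \<in> symg r" "has_cycle_type r h \<mu>" and k: "k \<in> symg r" "has_cycle_type r k \<mu>"
  shows "\<exists>g\<in>symg r. k = g + h - g"
proof -
  obtain \<beta> where \<beta>: "bij_betw \<beta> (young \<mu>) {1..r}"
    "\<And>i j. (i, j) \<in> young \<mu> \<Longrightarrow> ap h (\<beta> (i, j)) = \<beta> (i, Suc j mod \<mu> ! i)"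
    using h by (auto simp: has_cycle_type_def)
  obtain \<gamma> where \<gamma>: "bij_betw \<gamma> (young \<mu>) {1..r}"
    "\<And>i j. (i, j) \<in> young \<mu> \<Longrightarrow> ap k (\<gamma> (i, j)) = \<gamma> (i, Suc j mod \<mu> ! i)"
    using k by (auto simp: has_cycle_type_def)
  let ?i = "inv_into (young \<mu>) \<beta>"
  have "bij_betw (\<lambda>x. \<gamma> (?i x)) {1..r} {1..r}"
    using bij_betw_trans[OF bij_betw_inv_into[OF \<beta>(1)] \<gamma>(1)] by (simp add: o_def)
  then obtain \<sigma> where \<sigma>: "\<sigma> permutes {1..r}" "\<And>x. x \<in> {1..r} \<Longrightarrow> \<sigma> x = \<gamma> (?i x)"
    using permutation_extension[of "\<lambda>x. \<gamma> (?i x)" r] by (auto simp: bij_betw_def)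
  define g where "g = Abs_nperm \<sigma>"
  have apg: "ap g = \<sigma>" unfolding g_def by (rule ap_Abs_permutes[OF \<sigma>(1)])
  have g: "g \<in> symg r" using \<sigma>(1) by (simp add: symg_def apg)
  have g\<beta>: "ap g (\<beta> y) = \<gamma> y" if "y \<in> young \<mu>" for y
  proof -
    have "\<beta> y \<in> {1..r}" using \<beta>(1) that by (auto simp: bij_betw_def)
    then show ?thesis using \<sigma>(2) bij_betw_inv_into_left[OF \<beta>(1) that] by (simp add: apg)
  qed
  have "k + g = g + h"
  proof (rule nperm_eqI)
    fix x
    show "ap (k + g) x = ap (g + h) x"
    proof (cases "x \<in> {1..r}")
      case True
      then have "x \<in> \<beta> ` young \<mu>" using bij_betw_imp_surj_on[OF \<beta>(1)] by simp
      then obtain i j where ij: "(i, j) \<in> young \<mu>" "x = \<beta> (i, j)" by auto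
      have "(i, Suc j mod \<mu> ! i) \<in> young \<mu>" using ij(1) by (auto simp: young_def)
      then show ?thesis using g\<beta> \<beta>(2)[OF ij(1)] \<gamma>(2)[OF ij(1)] ij by simp
    next
      case False
      then show ?thesis using sym_out[OF g] sym_out[OF h(1)] sym_out[OF k(1)] by simp
    qed
  qed
  then have "k = g + h - g" by (metis add_diff_cancel)
  then show ?thesis using g by blast
qed

lemma finite_partitions: "finite (partitions r)"
proof (rule finite_subset)
  show "partitions r \<subseteq> {xs. set xs \<subseteq> {..r} \<and> length xs \<le> r}"
  proof
    fix \<mu> assume "\<mu> \<in> partitions r"
    then have \<mu>: "sum_list \<mu> = r" "\<forall>n\<in>set \<mu>. 0 < n" by (auto simp: partitions_def is_partition_def)
    have "length \<mu> \<le> sum_list \<mu>" using \<mu>(2) by (induction \<mu>) auto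
    then show "\<mu> \<in> {xs. set xs \<subseteq> {..r} \<and> length xs \<le> r}" using \<mu>(1) member_le_sum_list by fastforce
  qed
  show "finite {xs. set xs \<subseteq> {..r} \<and> length xs \<le> r}" by (rule finite_lists_length_le) simp
qed

subsection \<open>The centre\<close>

definition conj_class :: "nat \<Rightarrow> nperm \<Rightarrow> nperm set" where
  "conj_class r h = (\<lambda>g. g + h - g) ` symg r"

lemma diff_nperm: "g - h = g + - (h :: nperm)"
  by simp

lemma conj_class_self: "h \<in> conj_class r h"
  unfolding conj_class_def by (rule image_eqI[of _ _ 0]) auto

lemma conj_class_sub: "h \<in> symg r \<Longrightarrow> conj_class r h \<subseteq> symg r"
  unfolding conj_class_def using sym_plus sym_uminus by (auto simp only: diff_nperm)

lemma conj_class_eq: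
  assumes "k \<in> conj_class r h" shows "conj_class r k = conj_class r h"
proof -
  obtain g where g: "g \<in> symg r" "k = g + h - g" using assms by (auto simp: conj_class_def)
  have "f + k - f = (f + g) + h - (f + g)" for f
    unfolding g(2) by (simp only: diff_nperm minus_add add.assoc)
  moreover have "f + h - f = (f - g) + k - (f - g)" for f
    unfolding g(2) by (simp only: diff_nperm minus_add add.assoc minus_minus left_minus add_0_right minus_add_cancel)
  ultimately show ?thesis
    unfolding conj_class_def using g(1) sym_plus sym_uminus by (auto simp only: diff_nperm image_iff) (metis)+
qed

text \<open>Permutations of the same cycle type are conjugate, so choosing one permutation for each
  partition reaches every class.\<close>

lemma card_conj_classes: "card (conj_class r ` symg r) \<le> card (partitions r)"
proof -
  define F where "F \<mu> = conj_class r (SOME h. h \<in> symg r \<and> has_cycle_type r h \<mu>)" for \<mu>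
  have "conj_class r ` symg r \<subseteq> F ` partitions r"
  proof
    fix c assume "c \<in> conj_class r ` symg r"
    then obtain h where h: "h \<in> symg r" "c = conj_class r h" by auto
    obtain \<mu> where \<mu>: "\<mu> \<in> partitions r" "has_cycle_type r h \<mu>" using cycle_type_exists[OF h(1)] .
    let ?k = "SOME h. h \<in> symg r \<and> has_cycle_type r h \<mu>"
    have "?k \<in> symg r \<and> has_cycle_type r ?k \<mu>" by (rule someI[of _ h]) (use h \<mu> in simp)
    then have "?k \<in> conj_class r h"
      using cycle_type_conjugate[OF h(1) \<mu>(2)] by (auto simp: conj_class_def)
    then have "F \<mu> = c" using conj_class_eq h by (simp add: F_def)
    then show "c \<in> F ` partitions r" using \<mu>(1) by auto
  qed
  then show ?thesis using surj_card_le[OF finite_partitions] by blast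
qed

definition central :: "nat \<Rightarrow> qring set" where
  "central r = {x \<in> qsym r. \<forall>g\<in>symg r. gp g * x = x * gp g}"

lemma lookup_conj: "Poly_Mapping.lookup (gp g * x * gp (- g)) (g + h - g) = Poly_Mapping.lookup x h"
proof (induction x rule: qring_induct)
  case (single k q)
  have "g + k + - g = g + h - g \<longleftrightarrow> k = h"
    by (simp only: diff_nperm add_right_cancel add_left_cancel)
  then show ?case by (simp add: mult_single lookup_single when_def)
qed (simp_all add: distrib_left distrib_right lookup_add)

text \<open>A central element has constant coefficients on conjugacy classes, so it is a combination
  of class sums.\<close>

lemma central_span:
  assumes x: "x \<in> central r"
  shows "x \<in> DS.span ((\<lambda>c. \<Sum>h\<in>c. gp h) ` conj_class r ` symg r)"
proof -
  have const: "Poly_Mapping.lookup x k = Poly_Mapping.lookup x h" if k: "k \<in> conj_class r h" for h k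
  proof -
    obtain g where g: "g \<in> symg r" "k = g + h - g" using k by (auto simp: conj_class_def)
    have "gp g * x * gp (- g) = x * (gp g * gp (- g))" using x g by (simp add: central_def mult.assoc)
    then have "gp g * x * gp (- g) = x" by (simp add: gp_mult)
    then show ?thesis using lookup_conj[of g x h] g by simp
  qed
  have "x = (\<Sum>h\<in>symg r. Poly_Mapping.single h (Poly_Mapping.lookup x h))"
    using x by (intro poly_mapping_sum_singles finite_sym) (auto simp: central_def qsym_def)
  also have "\<dots> = (\<Sum>c\<in>conj_class r ` symg r. \<Sum>h\<in>{h \<in> symg r. conj_class r h = c}. Poly_Mapping.single h (Poly_Mapping.lookup x h))"
    by (rule sum.group[symmetric]) (auto simp: finite_sym)
  also have "\<dots> \<in> DS.span ((\<lambda>c. \<Sum>h\<in>c. gp h) ` conj_class r ` symg r)"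
  proof (rule DS.span_sum)
    fix c assume "c \<in> conj_class r ` symg r"
    then obtain k where k: "k \<in> symg r" "c = conj_class r k" by auto
    have "{h \<in> symg r. conj_class r h = c} = c"
      using k conj_class_eq conj_class_self conj_class_sub[OF k(1)] by blast
    then have "(\<Sum>h\<in>{h \<in> symg r. conj_class r h = c}. Poly_Mapping.single h (Poly_Mapping.lookup x h)) =
      (\<Sum>h\<in>c. pm_scale (Poly_Mapping.lookup x k) (gp h))"
      using const k by (simp add: pm_scale_single)
    also have "\<dots> = pm_scale (Poly_Mapping.lookup x k) (\<Sum>h\<in>c. gp h)" by (simp add: pm_scale_sum)
    finally show "(\<Sum>h\<in>{h \<in> symg r. conj_class r h = c}. Poly_Mapping.single h (Poly_Mapping.lookup x h))
      \<in> DS.span ((\<lambda>c. \<Sum>h\<in>c. gp h) ` conj_class r ` symg r)"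
      by (simp only:) (intro DS.span_scale DS.span_base imageI \<open>c \<in> conj_class r ` symg r\<close>)
  qed
  finally show ?thesis .
qed

text \<open>The unnormalised average over conjugates; up to a nonzero scalar it is the central
  idempotent of the block of \<mu>.\<close>

definition yavg :: "nat \<Rightarrow> nat list \<Rightarrow> qring" where
  "yavg r \<mu> = (\<Sum>g\<in>symg r. gp g * ysym \<mu> * gp (- g))"

lemma central_mult_comm:
  assumes x: "x \<in> central r" and y: "y \<in> qsym r" shows "y * x = x * y"
  using y
proof (induction rule: qsym_induct)
  case (gp g q)
  then show ?case using x by (simp add: scale_mult_left scale_mult_right central_def)
qed (simp_all add: distrib_left distrib_right)

lemma yavg_central: "\<mu> \<in> partitions r \<Longrightarrow> yavg r \<mu> \<in> central r"
proof -
  assume \<mu>: "\<mu> \<in> partitions r"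
  have "yavg r \<mu> \<in> qsym r"
    unfolding yavg_def using ysym_in[OF \<mu>] by (intro qsym_sum qsym_mult qsym_single sym_uminus)
  moreover have "gp k * yavg r \<mu> = yavg r \<mu> * gp k" if k: "k \<in> symg r" for k
  proof -
    have "gp k * yavg r \<mu> = (\<Sum>g\<in>symg r. gp (k + g) * ysym \<mu> * gp (- g))"
      by (simp add: yavg_def sum_distrib_left mult.assoc[symmetric] gp_mult)
    also have "\<dots> = (\<Sum>g\<in>symg r. gp g * ysym \<mu> * gp (- g + k))"
      by (rule sum.reindex_bij_witness[of _ "\<lambda>g. - k + g" "\<lambda>g. k + g"])
        (auto simp: add.assoc[symmetric] minus_add k sym_plus sym_uminus simp del: add_uminus_conv_diff, simp add: add.assoc)
    also have "\<dots> = yavg r \<mu> * gp k"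
      by (simp add: yavg_def sum_distrib_right mult.assoc gp_mult)
    finally show ?thesis .
  qed
  ultimately show ?thesis by (simp add: central_def)
qed

lemma yavg_orthogonal:
  assumes "\<mu> \<in> partitions r" "\<nu> \<in> partitions r" "\<nu> \<noteq> \<mu>"
  shows "yavg r \<nu> * yavg r \<mu> = 0"
proof -
  have "gp g * ysym \<nu> * gp (- g) * (gp h * ysym \<mu> * gp (- h)) = 0" if "g \<in> symg r" "h \<in> symg r" for g h
  proof -
    have "gp g * ysym \<nu> * gp (- g) * (gp h * ysym \<mu> * gp (- h)) = gp g * (ysym \<nu> * gp (- g + h) * ysym \<mu>) * gp (- h)"
      by (simp only: mult.assoc gp_mult[symmetric])
    also have "ysym \<nu> * gp (- g + h) * ysym \<mu> = 0"
      using ysym_orthogonal[OF assms] that by (simp add: qsym_single sym_plus sym_uminus)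
    finally show ?thesis by simp
  qed
  then show ?thesis unfolding yavg_def sum_product by (intro sum.neutral ballI) simp
qed

text \<open>A central x commutes with its image under inversion, so x x = 0 would make the square of
  their product vanish; but that product is nonzero and fixed by inversion, against positivity. That
  x is nonzero is read off at the identity, where every conjugate has coefficient 1.\<close>

lemma yavg_square_nonzero:
  assumes \<mu>: "\<mu> \<in> partitions r" shows "yavg r \<mu> * yavg r \<mu> \<noteq> 0"
proof
  let ?x = "yavg r \<mu>"
  assume 0: "?x * ?x = 0"
  have "Poly_Mapping.lookup (gp g * ysym \<mu> * gp (- g)) 0 = 1" for g
    using lookup_conj[of g "ysym \<mu>" 0] lookup_ysym_zero by simp
  then have "Poly_Mapping.lookup ?x 0 = of_nat (card (symg r))" by (simp add: yavg_def lookup_sum)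
  moreover have "card (symg r) \<noteq> 0" using finite_sym sym_zero by (metis card_eq_0_iff empty_iff)
  ultimately have "?x \<noteq> 0" by auto
  then have h: "?x * qinv ?x \<noteq> 0" by (rule mult_qinv_nonzero)
  have comm: "qinv ?x * ?x = ?x * qinv ?x"
    using central_mult_comm[OF yavg_central[OF \<mu>]] qinv_qsym yavg_central[OF \<mu>] by (simp add: central_def)
  have "?x * qinv ?x * (?x * qinv ?x) = ?x * (qinv ?x * ?x) * qinv ?x" by (simp only: mult.assoc)
  also have "\<dots> = ?x * ?x * qinv ?x * qinv ?x" unfolding comm by (simp only: mult.assoc)
  finally have "?x * qinv ?x * (?x * qinv ?x) = 0" using 0 by simp
  moreover have "qinv (?x * qinv ?x) = ?x * qinv ?x" by (simp add: qinv_mult)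
  ultimately show False using mult_qinv_nonzero[OF h] by simp
qed

text \<open>
  There are at least as many partitions as conjugacy classes, so the independent elements
  \<open>yavg r \<mu>\<close> span the centre.
\<close>

lemma one_in_span_yavg: "1 \<in> DS.span (yavg r ` partitions r)"
proof (rule ccontr)
  assume no: "1 \<notin> DS.span (yavg r ` partitions r)"
  have coeff: "u \<mu> = 0" if u: "(\<Sum>\<mu>\<in>partitions r. pm_scale (u \<mu>) (yavg r \<mu>)) = 0" and \<mu>: "\<mu> \<in> partitions r" for u \<mu>
  proof -
    have "0 = yavg r \<mu> * (\<Sum>\<nu>\<in>partitions r. pm_scale (u \<nu>) (yavg r \<nu>))" using u by simp
    also have "\<dots> = (\<Sum>\<nu>\<in>partitions r. pm_scale (u \<nu>) (yavg r \<mu> * yavg r \<nu>))"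
      by (simp add: sum_distrib_left scale_mult_right)
    also have "\<dots> = (\<Sum>\<nu>\<in>partitions r. if \<nu> = \<mu> then pm_scale (u \<mu>) (yavg r \<mu> * yavg r \<mu>) else 0)"
      using yavg_orthogonal[OF _ \<mu>] by (intro sum.cong) auto
    also have "\<dots> = pm_scale (u \<mu>) (yavg r \<mu> * yavg r \<mu>)" using \<mu> finite_partitions by simp
    finally show ?thesis using yavg_square_nonzero[OF \<mu>] by (metis DS.scale_eq_0_iff)
  qed
  have inj: "inj_on (yavg r) (partitions r)"
  proof (rule inj_onI, rule ccontr)
    fix \<mu> \<nu> assume "\<mu> \<in> partitions r" "\<nu> \<in> partitions r" "yavg r \<mu> = yavg r \<nu>" "\<mu> \<noteq> \<nu>"
    then show False using yavg_orthogonal[of \<nu> r \<mu>] yavg_square_nonzero[of \<mu> r] by simp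
  qed
  have "DS.independent (yavg r ` partitions r)"
  proof -
    have "u v = 0" if "(\<Sum>v\<in>yavg r ` partitions r. pm_scale (u v) v) = 0" "v \<in> yavg r ` partitions r" for u v
      using coeff[of "\<lambda>\<mu>. u (yavg r \<mu>)"] that by (auto simp: sum.reindex[OF inj])
    then show ?thesis using DS.dependent_finite[of "yavg r ` partitions r"] finite_partitions by blast
  qed
  \<comment> \<open>Together with 1 there would be more independent central elements than
    partitions, hence more than class sums.\<close>
  then have ind: "DS.independent (insert 1 (yavg r ` partitions r))"
    using no by (simp add: DS.independent_insert)
  let ?T = "(\<lambda>c. \<Sum>h\<in>c. gp h) ` conj_class r ` symg r"
  have "1 \<in> central r" using qsym_single[of 0 r 1] by (simp add: central_def)
  then have "insert 1 (yavg r ` partitions r) \<subseteq> DS.span ?T"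
    using central_span yavg_central by blast
  then have "card (insert 1 (yavg r ` partitions r)) \<le> card ?T"
    using DS.independent_span_bound[OF _ ind, of ?T] finite_sym by simp
  also have "\<dots> \<le> card (conj_class r ` symg r)" by (rule card_image_le) (simp add: finite_sym)
  also have "\<dots> \<le> card (partitions r)" by (rule card_conj_classes)
  also have "\<dots> = card (yavg r ` partitions r)" by (rule card_image[OF inj, symmetric])
  also have "\<dots> < card (insert 1 (yavg r ` partitions r))"
    using no DS.span_base[of 1 "yavg r ` partitions r"] finite_partitions
    by (subst card_insert_disjoint) (blast intro: finite_imageI, blast, simp)
  finally show False by simp
qed

section \<open>Idempotents of the group algebra\<close>

context carrier_algebra begin

text \<open>Murray-von Neumann equivalence, that is, isomorphism of the images in the Karoubi
  envelope of A. Being given by products, it passes through multiplicative maps.\<close>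

definition equivalent_idempotents :: "'a \<Rightarrow> 'a \<Rightarrow> bool" where
  "equivalent_idempotents z z' \<longleftrightarrow> (\<exists>u\<in>A. \<exists>v\<in>A. z \<odot> u = u \<and> u \<odot> z' = u \<and> z' \<odot> v = v \<and> v \<odot> z = v \<and>
     u \<odot> v = z \<and> v \<odot> u = z')"

lemma equivalent_idempotents_sym: "equivalent_idempotents z z' \<Longrightarrow> equivalent_idempotents z' z"
  unfolding equivalent_idempotents_def by blast

lemma equivalent_idempotents_trans:
  assumes "equivalent_idempotents z z'" "equivalent_idempotents z' z''" and A: "z \<in> A" "z' \<in> A" "z'' \<in> A"
  shows "equivalent_idempotents z z''"
proof -
  obtain u v where u: "u \<in> A" "v \<in> A" "z \<odot> u = u" "u \<odot> z' = u" "z' \<odot> v = v" "v \<odot> z = v" "u \<odot> v = z" "v \<odot> u = z'"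
    using assms(1) unfolding equivalent_idempotents_def by blast
  obtain p q where p: "p \<in> A" "q \<in> A" "z' \<odot> p = p" "p \<odot> z'' = p" "z'' \<odot> q = q" "q \<odot> z' = q" "p \<odot> q = z'" "q \<odot> p = z''"
    using assms(2) unfolding equivalent_idempotents_def by blast
  have 1: "z \<odot> (u \<odot> p) = u \<odot> p" "u \<odot> p \<odot> z'' = u \<odot> p" "z'' \<odot> (q \<odot> v) = q \<odot> v" "q \<odot> v \<odot> z = q \<odot> v"
    using u p A mul_assoc[of z u p] mul_assoc[of u p z''] mul_assoc[of z'' q v] mul_assoc[of q v z] by simp_all
  have 2: "u \<odot> p \<odot> (q \<odot> v) = z"
    using u p A mul_assoc[of u p "q \<odot> v"] mul_assoc[of p q v] by (simp add: mul_in)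
  have 3: "q \<odot> v \<odot> (u \<odot> p) = z''"
    using u p A mul_assoc[of q v "u \<odot> p"] mul_assoc[of v u p] by (simp add: mul_in)
  show ?thesis
    unfolding equivalent_idempotents_def
    by (rule bexI[of _ "u \<odot> p"], rule bexI[of _ "q \<odot> v"]) (use 1 2 3 u p in \<open>auto simp: mul_in\<close>)
qed

text \<open>A module map on the ideal of z is determined by the image u of z and equals right
  multiplication by u; u absorbs z on the left and z' on the right.\<close>

lemma left_ideals_isomorphic_iff:
  assumes z: "z \<in> A" "z \<odot> z = z" and z': "z' \<in> A" "z' \<odot> z' = z'"
  shows "left_ideals_isomorphic (\<odot>) A z z' \<longleftrightarrow> equivalent_idempotents z z'"
proof
  assume "left_ideals_isomorphic (\<odot>) A z z'"
  then obtain \<phi> where \<phi>: "bij_betw \<phi> ((\<lambda>a. a \<odot> z) ` A) ((\<lambda>a. a \<odot> z') ` A) \<and>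
      (\<forall>u\<in>(\<lambda>a. a \<odot> z) ` A. \<forall>v\<in>(\<lambda>a. a \<odot> z) ` A. \<phi> (u + v) = \<phi> u + \<phi> v) \<and>
      (\<forall>b\<in>A. \<forall>u\<in>(\<lambda>a. a \<odot> z) ` A. \<phi> (b \<odot> u) = b \<odot> \<phi> u)"
    unfolding left_ideals_isomorphic_def by (rule exE)
  then have bij: "bij_betw \<phi> ((\<lambda>a. a \<odot> z) ` A) ((\<lambda>a. a \<odot> z') ` A)" by (rule conjunct1)
  have lin: "\<phi> (b \<odot> u) = b \<odot> \<phi> u" if "b \<in> A" "u \<in> (\<lambda>a. a \<odot> z) ` A" for b u
    using \<phi> that by (elim conjE) (drule (1) bspec, drule (1) bspec)
  have zI: "z \<in> (\<lambda>a. a \<odot> z) ` A" using z by (intro image_eqI[of _ _ z]) auto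
  have z'I: "z' \<in> (\<lambda>a. a \<odot> z') ` A" using z' by (intro image_eqI[of _ _ z']) auto
  define u where "u = \<phi> z"
  have "u \<in> (\<lambda>a. a \<odot> z') ` A" using bij zI by (auto simp: u_def bij_betw_def)
  then have u: "u \<in> A" "u \<odot> z' = u" using z' by (auto simp: mul_in mul_assoc)
  have zu: "z \<odot> u = u" using lin[OF z(1) zI] z by (simp add: u_def)
  obtain x where x: "x \<in> (\<lambda>a. a \<odot> z) ` A" "\<phi> x = z'" using bij z'I by (metis bij_betw_def imageE)
  then have xA: "x \<in> A" "x \<odot> z = x" using z by (auto simp: mul_in mul_assoc)
  have xu: "x \<odot> u = z'" using lin[OF xA(1) zI] x xA by (simp add: u_def)
  \<comment> \<open>x is the preimage of z' under the isomorphism and already absorbs z on the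
    right; the factor z' makes it absorb z' on the left.\<close>
  define v where "v = z' \<odot> x"
  have v: "v \<in> A" "z' \<odot> v = v" "v \<odot> z = v" 
    using z z' xA mul_assoc[of z' z' x] mul_assoc[of z' x z] by (simp_all add: v_def mul_in)
  have vu: "v \<odot> u = z'" using u xu xA z' by (simp add: v_def mul_assoc)
  have uv: "u \<odot> v \<in> (\<lambda>a. a \<odot> z) ` A" using v u z by (intro image_eqI[of _ _ "u \<odot> v"]) (auto simp: mul_in mul_assoc)
  have "\<phi> (u \<odot> v) = \<phi> (u \<odot> v \<odot> z)" using u v z by (simp add: mul_assoc)
  also have "\<dots> = u \<odot> v \<odot> u" using lin[OF mul_in[OF u(1) v(1)] zI] by (simp add: u_def)
  also have "\<dots> = \<phi> z" using u v vu by (simp add: mul_assoc u_def[symmetric])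
  finally have "u \<odot> v = z" using bij uv zI by (auto simp: bij_betw_def dest: inj_onD)
  then show "equivalent_idempotents z z'"
    unfolding equivalent_idempotents_def using u v zu vu by blast
next
  assume "equivalent_idempotents z z'"
  then obtain u v where u: "u \<in> A" "v \<in> A" "z \<odot> u = u" "u \<odot> z' = u" "z' \<odot> v = v" "v \<odot> z = v" "u \<odot> v = z" "v \<odot> u = z'"
    unfolding equivalent_idempotents_def by blast
  have I: "x \<in> A \<and> x \<odot> z = x" if "x \<in> (\<lambda>a. a \<odot> z) ` A" for x
    using that z by (auto simp: mul_in mul_assoc)
  have I': "x \<in> A \<and> x \<odot> z' = x" if "x \<in> (\<lambda>a. a \<odot> z') ` A" for x
    using that z' by (auto simp: mul_in mul_assoc)
  have "bij_betw (\<lambda>x. x \<odot> u) ((\<lambda>a. a \<odot> z) ` A) ((\<lambda>a. a \<odot> z') ` A)"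
  proof (rule bij_betwI[where g = "\<lambda>x. x \<odot> v"])
    show "(\<lambda>x. x \<odot> u) \<in> (\<lambda>a. a \<odot> z) ` A \<rightarrow> (\<lambda>a. a \<odot> z') ` A"
    proof
      fix x assume "x \<in> (\<lambda>a. a \<odot> z) ` A"
      then have "x \<odot> u = x \<odot> u \<odot> z'" "x \<odot> u \<in> A" using I[of x] u z' mul_assoc[of x u z'] mul_in by simp_all
      then show "x \<odot> u \<in> (\<lambda>a. a \<odot> z') ` A" by blast
    qed
    show "(\<lambda>x. x \<odot> v) \<in> (\<lambda>a. a \<odot> z') ` A \<rightarrow> (\<lambda>a. a \<odot> z) ` A"
    proof
      fix x assume "x \<in> (\<lambda>a. a \<odot> z') ` A"
      then have "x \<odot> v = x \<odot> v \<odot> z" "x \<odot> v \<in> A" using I'[of x] u z mul_assoc[of x v z] mul_in by simp_all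
      then show "x \<odot> v \<in> (\<lambda>a. a \<odot> z) ` A" by blast
    qed
    show "x \<odot> u \<odot> v = x" if "x \<in> (\<lambda>a. a \<odot> z) ` A" for x
      using I[OF that] u(1,2,7) mul_assoc[of x u v] by simp
    show "x \<odot> v \<odot> u = x" if "x \<in> (\<lambda>a. a \<odot> z') ` A" for x
      using I'[OF that] u(1,2,8) mul_assoc[of x v u] by simp
  qed
  moreover have "(x + y) \<odot> u = x \<odot> u + y \<odot> u" if "x \<in> (\<lambda>a. a \<odot> z) ` A" "y \<in> (\<lambda>a. a \<odot> z) ` A" for x y
    using distrib_right I[OF that(1)] I[OF that(2)] u(1) by blast
  moreover have "b \<odot> x \<odot> u = b \<odot> (x \<odot> u)" if "b \<in> A" "x \<in> (\<lambda>a. a \<odot> z) ` A" for b x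
    using mul_assoc I[OF that(2)] that(1) u(1) by blast
  ultimately show "left_ideals_isomorphic (\<odot>) A z z'"
    unfolding left_ideals_isomorphic_def by (intro exI[of _ "\<lambda>x. x \<odot> u"] conjI ballI) auto
qed

end

text \<open>
  That the \<open>cy i\<close> generate \<open>A\<close> as an ideal replaces semisimplicity: it is used in the form that no
  nonzero element is annihilated by all of them, from either side.
\<close>

locale symmetrizer_family = carrier_algebra A mul one + vector_space scale
  for A :: "'a::ab_group_add set" and mul (infixl "\<odot>" 70) and one
    and scale :: "'k::field \<Rightarrow> 'a \<Rightarrow> 'a" (infixr "*s" 75) +
  fixes I :: "'i set" and cy :: "'i \<Rightarrow> 'a"
  assumes scale_in: "x \<in> A \<Longrightarrow> c *s x \<in> A"
    and mul_scale: "x \<in> A \<Longrightarrow> y \<in> A \<Longrightarrow> x \<odot> (c *s y) = c *s (x \<odot> y)"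
    and scale_mul: "x \<in> A \<Longrightarrow> y \<in> A \<Longrightarrow> (c *s x) \<odot> y = c *s (x \<odot> y)"
    and cy_in: "i \<in> I \<Longrightarrow> cy i \<in> A" and cy_nonzero: "i \<in> I \<Longrightarrow> cy i \<noteq> 0"
    and cy_square: "i \<in> I \<Longrightarrow> \<exists>q. q \<noteq> 0 \<and> cy i \<odot> cy i = q *s cy i"
    and cy_corner: "i \<in> I \<Longrightarrow> x \<in> A \<Longrightarrow> \<exists>q. cy i \<odot> x \<odot> cy i = q *s cy i"
    and cy_orthogonal: "i \<in> I \<Longrightarrow> j \<in> I \<Longrightarrow> i \<noteq> j \<Longrightarrow> x \<in> A \<Longrightarrow> cy i \<odot> x \<odot> cy j = 0"
    and cy_generate_left: "u \<in> A \<Longrightarrow> (\<And>i y. i \<in> I \<Longrightarrow> y \<in> A \<Longrightarrow> cy i \<odot> y \<odot> u = 0) \<Longrightarrow> u = 0"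
    and cy_generate_right: "u \<in> A \<Longrightarrow> (\<And>i y. i \<in> I \<Longrightarrow> y \<in> A \<Longrightarrow> u \<odot> y \<odot> cy i = 0) \<Longrightarrow> u = 0"
begin

text \<open>Rescaling makes \<open>cy i\<close> idempotent without changing its left ideal. Its
  corner consists of scalar multiples, so two orthogonal idempotents in it cannot both be
  nonzero.\<close>

lemma cy_idempotent:
  assumes i: "i \<in> I"
  obtains e c where "c \<noteq> 0" "e = c *s cy i" "e \<in> A" "e \<odot> e = e" "primitive_idempotent (\<odot>) A e"
    "(\<lambda>a. a \<odot> e) ` A = (\<lambda>a. a \<odot> cy i) ` A"
proof -
  obtain q where q: "q \<noteq> 0" "cy i \<odot> cy i = q *s cy i" using cy_square[OF i] by blast
  define e where "e = inverse q *s cy i"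
  have c: "cy i \<in> A" "cy i \<noteq> 0" "cy i = q *s e" using i cy_in cy_nonzero q by (auto simp: e_def)
  have "e \<odot> e = inverse q *s (inverse q *s (cy i \<odot> cy i))"
    using c(1) by (simp only: e_def scale_mul mul_scale scale_in)
  then have ee: "e \<odot> e = e" using q by (simp add: e_def)
  have e: "e \<in> A" "e \<odot> e = e" "e \<noteq> 0"
    using ee c(1,2) q(1) by (auto simp: scale_in e_def)
  have corner: "\<exists>s. a = s *s e" if "a \<in> A" "e \<odot> a = a" "a \<odot> e = a" for a
  proof -
    obtain s where s: "cy i \<odot> a \<odot> cy i = s *s cy i" using cy_corner[OF i \<open>a \<in> A\<close>] by blast
    have "a = e \<odot> a \<odot> e" using that by simp
    also have "\<dots> = (inverse q * inverse q) *s (cy i \<odot> a \<odot> cy i)"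
    proof -
      have "e \<odot> a = inverse q *s (cy i \<odot> a)" using c(1) that(1) by (simp only: e_def scale_mul)
      then have "e \<odot> a \<odot> e = inverse q *s (cy i \<odot> a \<odot> (inverse q *s cy i))"
        using c(1) that(1) by (simp only: e_def scale_mul mul_in scale_in)
      also have "cy i \<odot> a \<odot> (inverse q *s cy i) = inverse q *s (cy i \<odot> a \<odot> cy i)"
        using c(1) that(1) by (simp only: mul_scale mul_in)
      finally show ?thesis by simp
    qed
    also have "\<dots> = (inverse q * inverse q) *s (s *s (q *s e))" unfolding s by (simp only: c(3)[symmetric])
    also have "\<dots> = (inverse q * inverse q * s * q) *s e" by (simp add: mult.assoc)
    finally show ?thesis by blast
  qed
  have "\<not> (\<exists>a\<in>A. \<exists>b\<in>A. a \<noteq> 0 \<and> b \<noteq> 0 \<and> a \<odot> a = a \<and> b \<odot> b = b \<and> a \<odot> b = 0 \<and> b \<odot> a = 0 \<and> e = a + b)"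
  proof
    assume "\<exists>a\<in>A. \<exists>b\<in>A. a \<noteq> 0 \<and> b \<noteq> 0 \<and> a \<odot> a = a \<and> b \<odot> b = b \<and> a \<odot> b = 0 \<and> b \<odot> a = 0 \<and> e = a + b"
    then obtain a b where ab: "a \<in> A" "b \<in> A" "a \<noteq> 0" "b \<noteq> 0" "a \<odot> a = a" "b \<odot> b = b" "a \<odot> b = 0" "b \<odot> a = 0" "e = a + b"
      by blast
    have "e \<odot> a = a" "a \<odot> e = a" "e \<odot> b = b" "b \<odot> e = b" using ab by (auto simp: distrib_left distrib_right)
    then obtain s t where st: "a = s *s e" "b = t *s e" using corner ab by metis
    have "s *s (t *s e) = a \<odot> b" using st e by (simp add: scale_mul mul_scale scale_in)
    then have "s * t = 0" using ab(7) e(3) by simp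
    then show False using st ab(3,4) by auto
  qed
  then have "primitive_idempotent (\<odot>) A e" unfolding primitive_idempotent_def using e by blast
  moreover have "(\<lambda>a. a \<odot> e) ` A = (\<lambda>a. a \<odot> cy i) ` A"
  proof (intro equalityI subsetI)
    fix x assume "x \<in> (\<lambda>a. a \<odot> e) ` A"
    then obtain a where "a \<in> A" "x = a \<odot> e" by auto
    then show "x \<in> (\<lambda>a. a \<odot> cy i) ` A"
      using c(1) by (intro image_eqI[of _ _ "inverse q *s a"]) (simp_all only: e_def scale_in scale_mul mul_scale)
  next
    fix x assume "x \<in> (\<lambda>a. a \<odot> cy i) ` A"
    then obtain a where a: "a \<in> A" "x = a \<odot> cy i" by auto
    then have "x = a \<odot> (q *s e)" using c(3) by simp
    then have "x = (q *s a) \<odot> e" using a(1) e(1) by (simp only: scale_mul mul_scale)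
    then show "x \<in> (\<lambda>a. a \<odot> e) ` A"
      using scale_in[OF a(1)] by blast
  qed
  ultimately show thesis using q e by (intro that[of "inverse q" e]) (auto simp: e_def)
qed

lemma left_ideals_isomorphic_cy:
  assumes i: "i \<in> I" and e: "e \<in> A" "e \<odot> e = e" "(\<lambda>a. a \<odot> e) ` A = (\<lambda>a. a \<odot> cy i) ` A"
    and z: "z \<in> A" "z \<odot> z = z"
  shows "left_ideals_isomorphic (\<odot>) A z (cy i) \<longleftrightarrow> equivalent_idempotents z e"
  using left_ideals_isomorphic_iff[OF z e(1,2)] e(3) unfolding left_ideals_isomorphic_def by simp

definition is_simple_idempotent :: "'i \<Rightarrow> 'a \<Rightarrow> bool" where
  "is_simple_idempotent i z \<longleftrightarrow> primitive_idempotent (\<odot>) A z \<and> left_ideals_isomorphic (\<odot>) A z (cy i)"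

lemma simple_idempotent_exists:
  assumes i: "i \<in> I" obtains z where "is_simple_idempotent i z"
proof -
  obtain e c where e: "e \<in> A" "e \<odot> e = e" "primitive_idempotent (\<odot>) A e" "(\<lambda>a. a \<odot> e) ` A = (\<lambda>a. a \<odot> cy i) ` A"
    using cy_idempotent[OF i] by metis
  have "equivalent_idempotents e e" unfolding equivalent_idempotents_def using e by blast
  then show thesis using that[of e] left_ideals_isomorphic_cy[OF i e(1,2,4) e(1,2)] e by (auto simp: is_simple_idempotent_def)
qed

lemma simple_idempotents_equivalent:
  assumes i: "i \<in> I" and "is_simple_idempotent i z" "is_simple_idempotent i z'"
  shows "equivalent_idempotents z z'"
proof -
  obtain e c where e: "e \<in> A" "e \<odot> e = e" "(\<lambda>a. a \<odot> e) ` A = (\<lambda>a. a \<odot> cy i) ` A"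
    using cy_idempotent[OF i] by metis
  have z: "z \<in> A" "z \<odot> z = z" "z' \<in> A" "z' \<odot> z' = z'"
    using assms primitive_in by (auto simp: is_simple_idempotent_def)
  have "equivalent_idempotents z e" "equivalent_idempotents z' e"
    using assms left_ideals_isomorphic_cy[OF i e] z by (auto simp: is_simple_idempotent_def)
  then show ?thesis using equivalent_idempotents_trans equivalent_idempotents_sym e z by blast
qed

text \<open>An equivalence between idempotents proportional to \<open>cy i\<close> and
  \<open>cy j\<close> would pass through an element between them, and orthogonality makes that
  element zero.\<close>

lemma simple_idempotents_index:
  assumes i: "i \<in> I" and j: "j \<in> I" and zi: "is_simple_idempotent i z" and zj: "is_simple_idempotent j z'"
    and eqv: "equivalent_idempotents z z'"
  shows "i = j"
proof (rule ccontr)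
  assume ne: "i \<noteq> j"
  obtain e c where e: "e = c *s cy i" "e \<in> A" "e \<odot> e = e" "primitive_idempotent (\<odot>) A e" "(\<lambda>a. a \<odot> e) ` A = (\<lambda>a. a \<odot> cy i) ` A"
    using cy_idempotent[OF i] by metis
  obtain f d where f: "f = d *s cy j" "f \<in> A" "f \<odot> f = f" "(\<lambda>a. a \<odot> f) ` A = (\<lambda>a. a \<odot> cy j) ` A"
    using cy_idempotent[OF j] by metis
  have z: "z \<in> A" "z \<odot> z = z" "z' \<in> A" "z' \<odot> z' = z'"
    using zi zj primitive_in by (auto simp: is_simple_idempotent_def)
  have "equivalent_idempotents z e" "equivalent_idempotents z' f"
    using zi zj left_ideals_isomorphic_cy[OF i e(2,3,5)] left_ideals_isomorphic_cy[OF j f(2,3,4)] z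
    by (auto simp: is_simple_idempotent_def)
  then have "equivalent_idempotents e f"
    using eqv equivalent_idempotents_trans equivalent_idempotents_sym z e(2) f(2) by metis
  then obtain u v where u: "u \<in> A" "v \<in> A" "e \<odot> u = u" "u \<odot> f = u" "u \<odot> v = e"
    unfolding equivalent_idempotents_def by blast
  have "u = e \<odot> u \<odot> f" using u by simp
  also have "\<dots> = (c * d) *s (cy i \<odot> u \<odot> cy j)"
    using u(1) cy_in[OF i] cy_in[OF j] by (simp add: e(1) f(1) scale_mul mul_scale mul_in scale_in)
  also have "\<dots> = 0" using cy_orthogonal[OF i j ne u(1)] by simp
  finally have "e = 0" using u zero_mul by metis
  then show False using primitive_in(3)[OF e(4)] by simp
qed

text \<open>Generation from the right finds some \<open>cy i\<close> not killed by z. The idempotent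
  e proportional to it then factors through z, and as z is primitive the opposite composite is z
  itself.\<close>

lemma primitive_is_simple:
  assumes z: "primitive_idempotent (\<odot>) A z"
  obtains i where "i \<in> I" "is_simple_idempotent i z"
proof -
  note zA = primitive_in[OF z]
  obtain i y where i: "i \<in> I" and y: "y \<in> A" "z \<odot> y \<odot> cy i \<noteq> 0"
    using cy_generate_right[OF zA(1)] zA(3) by blast
  obtain e c where e: "c \<noteq> 0" "e = c *s cy i" "e \<in> A" "e \<odot> e = e" "primitive_idempotent (\<odot>) A e"
    "(\<lambda>a. a \<odot> e) ` A = (\<lambda>a. a \<odot> cy i) ` A"
    using cy_idempotent[OF i] by metis
  define u where "u = z \<odot> y \<odot> e"
  have "u = c *s (z \<odot> y \<odot> cy i)" using zA y cy_in[OF i] by (simp only: u_def e(2) mul_scale mul_in)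
  then have "u \<noteq> 0" using y e(1) by simp
  moreover have zy: "z \<odot> y \<in> A" using y zA mul_in by blast
  moreover have "z \<odot> u = u" using mul_assoc[of z "z \<odot> y" e] mul_assoc[of z z y] zy zA y(1) e(3) by (simp add: u_def)
  moreover have "u \<odot> e = u" using mul_assoc[of "z \<odot> y" e e] zy e by (simp add: u_def)
  ultimately have u: "u \<in> A" "u \<noteq> 0" "z \<odot> u = u" "u \<odot> e = u"
    using e(3) mul_in by (auto simp: u_def)
  \<comment> \<open>Generation from the left finds some \<open>cy j\<close> that does not kill u.
    Since u ends in e, orthogonality leaves only j = i, and the one-dimensional corner then makes
    \<open>t\<close> a nonzero multiple of e.\<close>
  obtain j w where j: "j \<in> I" and w: "w \<in> A" "cy j \<odot> w \<odot> u \<noteq> 0"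
    using cy_generate_left[OF u(1)] u(2) by blast
  have "j = i"
  proof (rule ccontr)
    assume "j \<noteq> i"
    have "cy j \<odot> w \<odot> u = cy j \<odot> (w \<odot> u) \<odot> e"
      using u w e cy_in[OF j] by (simp add: mul_assoc mul_in)
    also have "\<dots> = c *s (cy j \<odot> (w \<odot> u) \<odot> cy i)"
      using u w cy_in[OF i] cy_in[OF j] by (simp add: e(2) mul_scale mul_in)
    also have "\<dots> = 0" using cy_orthogonal[OF j i \<open>j \<noteq> i\<close>] u w by (simp add: mul_in)
    finally show False using w by simp
  qed
  define t where "t = e \<odot> w \<odot> u"
  have t_eq: "t = c *s (cy i \<odot> w \<odot> u)" using w u cy_in[OF i] by (simp add: t_def e(2) scale_mul mul_in)
  then have t0: "t \<noteq> 0" using w \<open>j = i\<close> e(1) by simp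
  obtain s where s: "t = s *s e"
  proof -
    obtain q where q: "cy i \<odot> (w \<odot> u) \<odot> cy i = q *s cy i" using cy_corner[OF i] w u by (metis mul_in)
    have "t = e \<odot> (w \<odot> u) \<odot> e" using u w e(3) by (simp add: t_def mul_assoc mul_in)
    also have "\<dots> = (c * c) *s (cy i \<odot> (w \<odot> u) \<odot> cy i)"
      using w u cy_in[OF i] by (simp add: e(2) scale_mul mul_scale mul_in scale_in)
    also have "\<dots> = (c * c * q * inverse c) *s e" using q e(1,2) by simp
    finally show ?thesis using that by blast
  qed
  have s0: "s \<noteq> 0" using t0 s by auto
  \<comment> \<open>Divided by s so that v u is e itself.\<close>
  define v where "v = inverse s *s (e \<odot> w \<odot> z)"
  have v: "v \<in> A" "e \<odot> v = v" "v \<odot> z = v"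
    using e w zA by (auto simp: v_def scale_in mul_in mul_scale scale_mul mul_assoc) (metis mul_assoc mul_in)
  have vu: "v \<odot> u = e"
  proof -
    have "v \<odot> u = inverse s *s t" using e w zA u by (simp add: v_def t_def scale_mul mul_in mul_assoc)
    then show ?thesis using s s0 by simp
  qed
  have "u \<odot> v \<odot> (u \<odot> v) = u \<odot> (v \<odot> u) \<odot> v" using u v by (simp add: mul_assoc mul_in)
  then have idem: "u \<odot> v \<odot> (u \<odot> v) = u \<odot> v" using vu u by simp
  have ne: "u \<odot> v \<noteq> 0"
  proof
    assume "u \<odot> v = 0"
    then have "u \<odot> v \<odot> u = 0" using zero_mul u by simp
    then have "u = 0" using u v vu by (simp add: mul_assoc)
    then show False using u by simp
  qed
  have "u \<odot> v = z"
    by (rule primitive_subidempotent[OF z _ idem _ _ ne]) (use u v zA in \<open>auto simp: mul_in mul_assoc mul_assoc[symmetric, of z u v]\<close>)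
  then have "equivalent_idempotents z e"
    unfolding equivalent_idempotents_def using u v vu by blast
  then have "is_simple_idempotent i z"
    using left_ideals_isomorphic_cy[OF i e(3,4,6)] zA z by (simp add: is_simple_idempotent_def)
  then show thesis using i that by blast
qed

end

section \<open>Transport to the Brauer algebra\<close>

text \<open>Extension of scalars from the rationals combined with the passage from permutations to
  diagrams. Coefficients outside \<open>symg r\<close> are dropped, so multiplicativity is stated on
  \<open>qsym r\<close>.\<close>

definition emb :: "nat \<Rightarrow> qring \<Rightarrow> (diagram \<Rightarrow>\<^sub>0 'k::field_char_0)" where
  "emb r x = (\<Sum>g\<in>symg r. Poly_Mapping.single (perm_diagram r (ap g)) (of_rat (Poly_Mapping.lookup x g)))"

lemma emb_add: "emb r (x + y) = emb r x + emb r y"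
  by (simp add: emb_def lookup_add of_rat_add single_add sum.distrib)

lemma emb_zero [simp]: "emb r 0 = 0"
  by (simp add: emb_def)

lemma emb_scale: "emb r (pm_scale q x) = pm_scale (of_rat q) (emb r x)"
  by (simp add: emb_def lookup_pm_scale of_rat_mult pm_scale_sum pm_scale_single)

lemma emb_gp:
  assumes "g \<in> symg r" shows "emb r (gp g) = Poly_Mapping.single (perm_diagram r (ap g)) 1"
proof -
  have "emb r (gp g) = (\<Sum>h\<in>symg r. if h = g then Poly_Mapping.single (perm_diagram r (ap g)) 1 else (0 :: diagram \<Rightarrow>\<^sub>0 'a))"
    unfolding emb_def by (rule sum.cong) (auto simp: lookup_single when_def)
  then show ?thesis using assms finite_sym by simp
qed

lemma emb_single:
  assumes "g \<in> symg r"
  shows "emb r (Poly_Mapping.single g q) = Poly_Mapping.single (perm_diagram r (ap g)) (of_rat q)"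
  unfolding single_eq_scale[of g q] emb_scale emb_gp[OF assms] by (simp add: pm_scale_single)

lemma emb_sum: "emb r (sum f I) = (\<Sum>i\<in>I. emb r (f i))"
  by (induction I rule: infinite_finite_induct) (auto simp: emb_add)

lemma emb_mult:
  assumes "x \<in> qsym r" "y \<in> qsym r"
  shows "emb r (x * y) = brauer_comp \<delta> (emb r x) (emb r y)"
  using assms(1)
proof (induction rule: qsym_induct)
  case (gp g p)
  show ?case
    using assms(2)
  proof (induction rule: qsym_induct)
    case (gp h q)
    have "star (perm_diagram r (ap g)) (perm_diagram r (ap h)) = perm_diagram r (ap g \<circ> ap h)"
      "loops (perm_diagram r (ap g)) (perm_diagram r (ap h)) = 0"
      using \<open>g \<in> symg r\<close> gp star_perm_diagram[of "ap g" r "ap h"] by (simp_all add: symg_def)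
    then have "emb r (gp (g + h)) = brauer_comp \<delta> (emb r (gp g)) (emb r (gp h))"
      by (simp add: emb_gp sym_plus gp \<open>g \<in> symg r\<close> brauer_comp_single)
    then show ?case
      by (simp only: emb_scale scale_mult_left scale_mult_right gp_mult brauer_comp_scale)
  qed (simp_all add: distrib_left emb_add brauer_comp_add_right)
qed (simp_all add: distrib_right emb_add brauer_comp_add_left)

lemma emb_one: "emb r 1 = Poly_Mapping.single (id_diagram r) 1"
  using emb_gp[of 0 r] by (simp add: id_diagram_perm)

lemma emb_in: "emb r x \<in> sym_group_algebra r"
proof -
  interpret carrier_algebra "sym_group_algebra r :: (diagram \<Rightarrow>\<^sub>0 'a) set" "brauer_comp 0" "Poly_Mapping.single (id_diagram r) 1"
    by (rule sym_group_carrier_algebra)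
  have "Poly_Mapping.single (perm_diagram r (ap g)) a \<in> sym_group_algebra r" if "g \<in> symg r" for g and a :: 'a
    using perm_diagram_in[of "ap g" r] that by (simp add: sym_group_algebra_def symg_def)
  then show ?thesis unfolding emb_def by (intro sum_in)
qed

lemma sym_group_algebra_scale: "a \<in> sym_group_algebra r \<Longrightarrow> pm_scale c a \<in> sym_group_algebra r"
  unfolding sym_group_algebra_def using subset_trans[OF keys_pm_scale] by blast

lemma finite_perm_diagrams: "finite (perm_diagrams r)"
  using finite_brauer_diagrams by (rule rev_finite_subset) (auto simp: perm_diagrams_def)

text \<open>Embedded group elements span the algebra over the field, so statements linear in one
  argument reduce to rational ones.\<close>

lemma sym_group_algebra_induct [consumes 1, case_names zero gp add]:
  fixes a :: "diagram \<Rightarrow>\<^sub>0 'k::field_char_0"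
  assumes "a \<in> sym_group_algebra r" "P 0" "\<And>g c. g \<in> symg r \<Longrightarrow> P (pm_scale c (emb r (gp g)))"
    "\<And>x y. x \<in> sym_group_algebra r \<Longrightarrow> y \<in> sym_group_algebra r \<Longrightarrow> P x \<Longrightarrow> P y \<Longrightarrow> P (x + y)"
  shows "P a"
proof (rule poly_mapping_support_induct[OF _ finite_perm_diagrams])
  show "Poly_Mapping.keys a \<subseteq> perm_diagrams r" using assms(1) by (simp add: sym_group_algebra_def)
  show "P (Poly_Mapping.single D c)" if D: "D \<in> perm_diagrams r" for D c
  proof -
    obtain \<sigma> where "\<sigma> permutes {1..r}" "D = perm_diagram r \<sigma>" using D by (auto simp: perm_diagrams_eq)
    then obtain g where "g \<in> symg r" "D = perm_diagram r (ap g)"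
      using ap_image_sym[of r] by (metis (mono_tags, lifting) imageE mem_Collect_eq)
    then show ?thesis using assms(3)[of g c] by (simp add: emb_gp pm_scale_single)
  qed
qed (use assms in \<open>auto simp: sym_group_algebra_def\<close>)

lemma perm_diagram_inj:
  assumes "\<sigma> permutes {1..r}" "\<tau> permutes {1..r}" "perm_diagram r \<sigma> = perm_diagram r \<tau>"
  shows "\<sigma> = \<tau>"
proof
  fix i
  show "\<sigma> i = \<tau> i"
  proof (cases "i \<in> {1..r}")
    case True
    then have "{Bot i, Top (\<sigma> i)} \<in> perm_diagram r \<sigma>" unfolding perm_diagram_eq by (rule imageI)
    then have "{Bot i, Top (\<sigma> i)} \<in> perm_diagram r \<tau>" using assms(3) by simp
    then obtain j where "{Bot i, Top (\<sigma> i)} = {Bot j, Top (\<tau> j)}" unfolding perm_diagram_eq by (rule imageE)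
    then show ?thesis by (auto simp: doubleton_eq_iff)
  next
    case False
    then show ?thesis using assms by (simp add: permutes_def)
  qed
qed

lemma lookup_emb:
  assumes "g \<in> symg r" shows "Poly_Mapping.lookup (emb r x) (perm_diagram r (ap g)) = of_rat (Poly_Mapping.lookup x g)"
proof -
  have "Poly_Mapping.lookup (emb r x) (perm_diagram r (ap g)) =
      (\<Sum>h\<in>symg r. if h = g then of_rat (Poly_Mapping.lookup x g) else 0)"
  proof -
    have "perm_diagram r (ap h) = perm_diagram r (ap g) \<longleftrightarrow> h = g" if "h \<in> symg r" for h
      using perm_diagram_inj[of "ap h" r "ap g"] that assms by (auto simp: symg_def ap_inject)
    then show ?thesis
      unfolding emb_def lookup_sum by (intro sum.cong) (auto simp: lookup_single when_def)
  qed
  then show ?thesis using assms finite_sym by simp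
qed

section \<open>Comparison with the Young symmetrizers of diagrams\<close>

lemma tableau_row_eq: "tableau_row \<mu> i = {x \<in> {1..sum_list \<mu>}. fst (pos \<mu> x) = i}"
proof (intro equalityI subsetI)
  fix x assume "x \<in> tableau_row \<mu> i"
  then obtain j where j: "x = tableau_entry \<mu> i j" "(i, j) \<in> young \<mu>" by (auto simp: tableau_row_def young_def)
  then have "x \<in> {1..sum_list \<mu>}" using bij_betwE[OF tableau_entry_bij[of \<mu>]] by fastforce
  then show "x \<in> {x \<in> {1..sum_list \<mu>}. fst (pos \<mu> x) = i}" using j pos_entry by auto
next
  fix x assume "x \<in> {x \<in> {1..sum_list \<mu>}. fst (pos \<mu> x) = i}"
  then have x: "x \<in> {1..sum_list \<mu>}" "fst (pos \<mu> x) = i" by auto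
  obtain y where y: "y \<in> young \<mu>" "x = (\<lambda>(i, j). tableau_entry \<mu> i j) y"
    using x(1) bij_betw_imp_surj_on[OF tableau_entry_bij[of \<mu>]] by (metis imageE)
  obtain i' j where ij: "y = (i', j)" by fastforce
  then have "pos \<mu> x = (i', j)" using y pos_entry by auto
  then show "x \<in> tableau_row \<mu> i" using x y ij by (auto simp: tableau_row_def young_def)
qed

lemma tableau_col_eq: "tableau_col \<mu> j = {x \<in> {1..sum_list \<mu>}. snd (pos \<mu> x) = j}"
proof (intro equalityI subsetI)
  fix x assume "x \<in> tableau_col \<mu> j"
  then obtain i where j: "x = tableau_entry \<mu> i j" "(i, j) \<in> young \<mu>" by (auto simp: tableau_col_def young_def)
  then have "x \<in> {1..sum_list \<mu>}" using bij_betwE[OF tableau_entry_bij[of \<mu>]] by fastforce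
  then show "x \<in> {x \<in> {1..sum_list \<mu>}. snd (pos \<mu> x) = j}" using j pos_entry by auto
next
  fix x assume "x \<in> {x \<in> {1..sum_list \<mu>}. snd (pos \<mu> x) = j}"
  then have x: "x \<in> {1..sum_list \<mu>}" "snd (pos \<mu> x) = j" by auto
  obtain y where y: "y \<in> young \<mu>" "x = (\<lambda>(i, j). tableau_entry \<mu> i j) y"
    using x(1) bij_betw_imp_surj_on[OF tableau_entry_bij[of \<mu>]] by (metis imageE)
  obtain i j' where ij: "y = (i, j')" by fastforce
  then have "pos \<mu> x = (i, j')" using y pos_entry by auto
  then show "x \<in> tableau_col \<mu> j" using x y ij by (auto simp: tableau_col_def young_def)
qed

text \<open>An injection of a finite fibre into itself is onto. This links the stabilisers of
  tableau rows and columns to \<open>fibre_group\<close>.\<close>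

lemma preserves_fibres_iff:
  assumes "\<sigma> permutes S" "finite S"
  shows "(\<forall>i. \<sigma> ` {x \<in> S. f x = i} = {x \<in> S. f x = i}) \<longleftrightarrow> (\<forall>x\<in>S. f (\<sigma> x) = f x)"
proof
  assume "\<forall>i. \<sigma> ` {x \<in> S. f x = i} = {x \<in> S. f x = i}"
  then show "\<forall>x\<in>S. f (\<sigma> x) = f x" by blast
next
  assume a: "\<forall>x\<in>S. f (\<sigma> x) = f x"
  show "\<forall>i. \<sigma> ` {x \<in> S. f x = i} = {x \<in> S. f x = i}"
  proof
    fix i
    show "\<sigma> ` {x \<in> S. f x = i} = {x \<in> S. f x = i}"
      by (rule endo_inj_surj) (use assms a in \<open>auto simp: permutes_in_image intro: inj_on_subset[OF permutes_inj]\<close>)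
  qed
qed

lemma fibre_group_image:
  "ap ` fibre_group r f = {\<sigma>. \<sigma> permutes {1..r} \<and> (\<forall>i. \<sigma> ` {x \<in> {1..r}. f x = i} = {x \<in> {1..r}. f x = i})}"
proof -
  have "ap ` fibre_group r f = {\<sigma> \<in> ap ` symg r. \<forall>x\<in>{1..r}. f (\<sigma> x) = f x}"
    by (auto simp: fibre_group_def)
  also have "\<dots> = {\<sigma>. \<sigma> permutes {1..r} \<and> (\<forall>x\<in>{1..r}. f (\<sigma> x) = f x)}"
    unfolding ap_image_sym by simp
  also have "\<dots> = {\<sigma>. \<sigma> permutes {1..r} \<and> (\<forall>i. \<sigma> ` {x \<in> {1..r}. f x = i} = {x \<in> {1..r}. f x = i})}"
    by (intro Collect_cong conj_cong refl preserves_fibres_iff[symmetric]) auto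
  finally show ?thesis .
qed

lemma young_symmetrizer_emb:
  fixes \<delta> :: "'k::field_char_0"
  shows "young_symmetrizer \<delta> \<mu> = emb (sum_list \<mu>) (ysym \<mu>)"
proof -
  let ?r = "sum_list \<mu>"
  have "(\<Sum>\<sigma> | \<sigma> permutes {1..?r} \<and> (\<forall>i. \<sigma> ` tableau_row \<mu> i = tableau_row \<mu> i). Poly_Mapping.single (perm_diagram ?r \<sigma>) (1 :: 'k)) =
    emb ?r (row_sym \<mu>)"
    unfolding tableau_row_eq fibre_group_image[symmetric] row_sym_def emb_sum
    by (subst sum.reindex) (auto simp: inj_on_def ap_inject emb_gp fibre_group_sym)
  moreover have "(\<Sum>\<tau> | \<tau> permutes {1..?r} \<and> (\<forall>j. \<tau> ` tableau_col \<mu> j = tableau_col \<mu> j).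
      Poly_Mapping.single (perm_diagram ?r \<tau>) (of_int (sign \<tau>) :: 'k)) = emb ?r (col_sym \<mu>)"
    unfolding tableau_col_eq fibre_group_image[symmetric] col_sym_def emb_sum
    by (subst sum.reindex) (auto simp: inj_on_def ap_inject emb_single fibre_group_sym psign_def pm_scale_single)
  ultimately show ?thesis
    unfolding young_symmetrizer_def Let_def ysym_def using emb_mult[OF row_sym_in col_sym_in, of \<mu> \<delta>] by simp
qed

text \<open>The axioms descend to the rational case: the corner and orthogonality by linearity and a
  check on group elements, generation by expanding 1 in conjugates of Young symmetrizers.\<close>

lemma sym_symmetrizer_family:
  fixes \<delta> :: "'k::field_char_0"
  shows "symmetrizer_family (sym_group_algebra r) (brauer_comp \<delta>) (Poly_Mapping.single (id_diagram r) 1)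
    pm_scale (partitions r) (young_symmetrizer \<delta>)"
proof -
  interpret carrier_algebra "sym_group_algebra r :: (diagram \<Rightarrow>\<^sub>0 'k) set" "brauer_comp \<delta>" "Poly_Mapping.single (id_diagram r) 1"
    by (rule sym_group_carrier_algebra)
  have ye: "young_symmetrizer \<delta> \<mu> = emb r (ysym \<mu>)" if "\<mu> \<in> partitions r" for \<mu>
    using young_symmetrizer_emb[of \<delta> \<mu>] that by (simp add: partitions_def)
  \<comment> \<open>Induction over the span of the central averages; membership in
    \<open>qsym r\<close> is carried along because it is a premise of the additive step.\<close>
  have span: "x \<in> DS.span (yavg r ` partitions r) \<Longrightarrow> x \<in> qsym r \<and> P x"
    if "P 0" "\<And>x y. x \<in> qsym r \<Longrightarrow> y \<in> qsym r \<Longrightarrow> P x \<Longrightarrow> P y \<Longrightarrow> P (x + y)"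
      "\<And>\<mu> q. \<mu> \<in> partitions r \<Longrightarrow> P (pm_scale q (yavg r \<mu>))" for x P
  proof (induction rule: DS.span_induct_alt)
    case (step c x y)
    then obtain \<mu> where \<mu>: "\<mu> \<in> partitions r" "x = yavg r \<mu>" by auto
    then have "pm_scale c x \<in> qsym r"
      using yavg_central[OF \<mu>(1)] subset_trans[OF keys_pm_scale, of x "symg r" c] by (simp add: central_def qsym_def)
    then show ?case using step that \<mu> by (simp add: qsym_add)
  qed (use that qsym_zero in auto)
  have yavg_emb: "emb r (yavg r \<mu>) = (\<Sum>g\<in>symg r. brauer_comp \<delta> (brauer_comp \<delta> (emb r (gp g)) (young_symmetrizer \<delta> \<mu>)) (emb r (gp (- g))))"
    if "\<mu> \<in> partitions r" for \<mu>
    using ysym_in[OF that] by (simp add: yavg_def emb_sum emb_mult[symmetric] ye[OF that] qsym_mult qsym_single sym_uminus)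
  show ?thesis
  proof unfold_locales
    fix \<mu> assume \<mu>: "\<mu> \<in> partitions r"
    show "young_symmetrizer \<delta> \<mu> \<in> sym_group_algebra r" using ye[OF \<mu>] emb_in by simp
    have "Poly_Mapping.lookup (young_symmetrizer \<delta> \<mu>) (perm_diagram r (ap 0)) = 1"
      using lookup_emb[of 0 r "ysym \<mu>"] lookup_ysym_zero ye[OF \<mu>] by simp
    then show "young_symmetrizer \<delta> \<mu> \<noteq> 0" by auto
    obtain q where "q \<noteq> 0" "ysym \<mu> * ysym \<mu> = pm_scale q (ysym \<mu>)" using ysym_square[OF \<mu>] .
    then show "\<exists>q. q \<noteq> 0 \<and> brauer_comp \<delta> (young_symmetrizer \<delta> \<mu>) (young_symmetrizer \<delta> \<mu>) = pm_scale q (young_symmetrizer \<delta> \<mu>)"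
      using ysym_in[OF \<mu>] by (intro exI[of _ "of_rat q"]) (simp add: ye[OF \<mu>] emb_mult[symmetric] emb_scale)
    fix x :: "diagram \<Rightarrow>\<^sub>0 'k" assume x: "x \<in> sym_group_algebra r"
    show "\<exists>q. brauer_comp \<delta> (brauer_comp \<delta> (young_symmetrizer \<delta> \<mu>) x) (young_symmetrizer \<delta> \<mu>) = pm_scale q (young_symmetrizer \<delta> \<mu>)"
      using x
    proof (induction rule: sym_group_algebra_induct)
      case zero
      show ?case by (rule exI[of _ 0]) simp
    next
      case (gp g c)
      obtain q where "ysym \<mu> * gp g * ysym \<mu> = pm_scale q (ysym \<mu>)" using ysym_corner[OF \<mu>, of "gp g"] gp qsym_single by blast
      then show ?case
        using ysym_in[OF \<mu>] gp by (intro exI[of _ "c * of_rat q"])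
          (simp add: ye[OF \<mu>] brauer_comp_scale emb_mult[symmetric] qsym_single qsym_mult emb_scale)
    next
      case (add x y)
      then obtain p q where "brauer_comp \<delta> (brauer_comp \<delta> (young_symmetrizer \<delta> \<mu>) x) (young_symmetrizer \<delta> \<mu>) = pm_scale p (young_symmetrizer \<delta> \<mu>)"
        "brauer_comp \<delta> (brauer_comp \<delta> (young_symmetrizer \<delta> \<mu>) y) (young_symmetrizer \<delta> \<mu>) = pm_scale q (young_symmetrizer \<delta> \<mu>)" by blast
      then show ?case
        by (intro exI[of _ "p + q"]) (simp add: brauer_comp_add_left brauer_comp_add_right DS.scale_left_distrib)
    qed
    fix \<nu> assume \<nu>: "\<nu> \<in> partitions r" "\<mu> \<noteq> \<nu>"
    show "brauer_comp \<delta> (brauer_comp \<delta> (young_symmetrizer \<delta> \<mu>) x) (young_symmetrizer \<delta> \<nu>) = 0"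
      using x
    proof (induction rule: sym_group_algebra_induct)
      case (gp g c)
      then show ?case
        using ysym_in[OF \<mu>] ysym_in[OF \<nu>(1)] ysym_orthogonal[OF \<nu>(1) \<mu> \<nu>(2), of "gp g"]
        by (simp add: ye[OF \<mu>] ye[OF \<nu>(1)] brauer_comp_scale emb_mult[symmetric] qsym_single qsym_mult)
    qed (simp_all add: brauer_comp_add_left brauer_comp_add_right)
  next
    fix u :: "diagram \<Rightarrow>\<^sub>0 'k" assume u: "u \<in> sym_group_algebra r"
      and z: "\<And>\<mu> y. \<mu> \<in> partitions r \<Longrightarrow> y \<in> sym_group_algebra r \<Longrightarrow> brauer_comp \<delta> (brauer_comp \<delta> (young_symmetrizer \<delta> \<mu>) y) u = 0"
    \<comment> \<open>Annihilating u is a linear condition, met by every conjugate of a Young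
      symmetrizer, and so it passes to 1.\<close>
    have "brauer_comp \<delta> (emb r 1) u = 0"
    proof (rule span[THEN conjunct2, OF _ _ _ one_in_span_yavg])
      fix \<mu> q assume \<mu>: "\<mu> \<in> partitions r"
      have "brauer_comp \<delta> (brauer_comp \<delta> (brauer_comp \<delta> (emb r (gp g)) (young_symmetrizer \<delta> \<mu>)) (emb r (gp (- g)))) u =
        brauer_comp \<delta> (emb r (gp g)) (brauer_comp \<delta> (brauer_comp \<delta> (young_symmetrizer \<delta> \<mu>) (emb r (gp (- g)))) u)" for g
        using u by (simp add: mul_assoc mul_in ye[OF \<mu>] emb_in)
      then show "brauer_comp \<delta> (emb r (pm_scale q (yavg r \<mu>))) u = 0"
        using z[OF \<mu> emb_in] by (simp add: emb_scale brauer_comp_scale yavg_emb[OF \<mu>] brauer_comp_sum_left)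
    qed (simp_all add: emb_add brauer_comp_add_left)
    then show "u = 0" using one_mul[OF u] by (simp add: emb_one)
  next
    fix u :: "diagram \<Rightarrow>\<^sub>0 'k" assume u: "u \<in> sym_group_algebra r"
      and z: "\<And>\<mu> y. \<mu> \<in> partitions r \<Longrightarrow> y \<in> sym_group_algebra r \<Longrightarrow> brauer_comp \<delta> (brauer_comp \<delta> u y) (young_symmetrizer \<delta> \<mu>) = 0"
    have "brauer_comp \<delta> u (emb r 1) = 0"
    proof (rule span[THEN conjunct2, OF _ _ _ one_in_span_yavg])
      fix \<mu> q assume \<mu>: "\<mu> \<in> partitions r"
      have "brauer_comp \<delta> u (brauer_comp \<delta> (brauer_comp \<delta> (emb r (gp g)) (young_symmetrizer \<delta> \<mu>)) (emb r (gp (- g)))) =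
        brauer_comp \<delta> (brauer_comp \<delta> (brauer_comp \<delta> u (emb r (gp g))) (young_symmetrizer \<delta> \<mu>)) (emb r (gp (- g)))" for g
        using u by (simp add: mul_assoc mul_in ye[OF \<mu>] emb_in)
      then show "brauer_comp \<delta> u (emb r (pm_scale q (yavg r \<mu>))) = 0"
        using z[OF \<mu> emb_in] by (simp add: emb_scale brauer_comp_scale yavg_emb[OF \<mu>] brauer_comp_sum_right)
    qed (simp_all add: emb_add brauer_comp_add_right)
    then show "u = 0" using mul_one[OF u] by (simp add: emb_one)
  qed (auto simp: sym_group_algebra_scale brauer_comp_scale)
qed

section \<open>Indecomposable objects\<close>

definition mat1 :: "'m::zero \<Rightarrow> nat \<Rightarrow> nat \<Rightarrow> 'm" where
  "mat1 u = (\<lambda>i j. if i = 0 \<and> j = 0 then u else 0)"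

lemma im_obj_mat1: "im_obj r e = ([r], mat1 e)"
  by (simp add: im_obj_def mat1_def)

lemma mat1_eq_iff [simp]: "mat1 u = mat1 v \<longleftrightarrow> u = v"
  by (auto simp: mat1_def fun_eq_iff split: if_splits)

lemma mat1_zero: "mat1 0 = 0"
  by (auto simp: mat1_def fun_eq_iff)

lemma mat1_add: "mat1 (u + v) = mat1 u + mat1 (v :: 'm::comm_monoid_add)"
  by (auto simp: mat1_def fun_eq_iff)

context preadditive_category begin

lemma mat1_hom: "mat1 u \<in> cat_hom add [x] [y] \<longleftrightarrow> u \<in> cat_hom C x y"
  by (auto simp: add_hom mat1_def)

lemma hom_mat1: "M \<in> cat_hom add [x] [y] \<Longrightarrow> M = mat1 (M 0 0) \<and> M 0 0 \<in> cat_hom C x y"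
  by (auto simp: add_hom mat1_def fun_eq_iff)

lemma mat1_comp: "cat_comp add [x] [y] [z] (mat1 g) (mat1 f) = mat1 (cat_comp C x y z g f)"
  by (auto simp: add_comp mat1_def fun_eq_iff)

lemma mat1_prim: "primitive_idempotent (cat_comp add [x] [x] [x]) (cat_hom add [x] [x]) (mat1 e) \<longleftrightarrow> prim x e"
proof -
  have img: "cat_hom add [x] [x] = mat1 ` cat_hom C x x"
    using hom_mat1 mat1_hom by blast
  have z: "(mat1 u = 0) = (u = 0)" for u :: 'm using mat1_eq_iff[of u 0] by (simp add: mat1_zero)
  show ?thesis
    unfolding primitive_idempotent_def img by (simp add: mat1_comp z image_iff mat1_add[symmetric])
qed

lemma mat1_isomorphic:
  "isomorphic (karoubi_envelope add) ([x], mat1 e) ([y], mat1 f) \<longleftrightarrow> isomorphic kar (x, e) (y, f)"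
proof -
  interpret A: preadditive_category add by (rule preadditive_add)
  show ?thesis
  proof
    assume "isomorphic (karoubi_envelope add) ([x], mat1 e) ([y], mat1 f)"
    then obtain U V where k: "A.kar_iso [x] (mat1 e) [y] (mat1 f) U V" unfolding A.isomorphic_kar by blast
    then have "U = mat1 (U 0 0)" "V = mat1 (V 0 0)" using hom_mat1 by (auto simp: A.kar_iso_def)
    then have "A.kar_iso [x] (mat1 e) [y] (mat1 f) (mat1 (U 0 0)) (mat1 (V 0 0))" using k by simp
    then have "kar_iso x e y f (U 0 0) (V 0 0)"
      unfolding A.kar_iso_def kar_iso_def mat1_comp mat1_hom mat1_eq_iff .
    then show "isomorphic kar (x, e) (y, f)" unfolding isomorphic_kar by blast
  next
    assume "isomorphic kar (x, e) (y, f)"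
    then obtain u v where "kar_iso x e y f u v" unfolding isomorphic_kar by blast
    then have "A.kar_iso [x] (mat1 e) [y] (mat1 f) (mat1 u) (mat1 v)"
      unfolding A.kar_iso_def kar_iso_def mat1_comp mat1_hom mat1_eq_iff .
    then show "isomorphic (karoubi_envelope add) ([x], mat1 e) ([y], mat1 f)" unfolding A.isomorphic_kar by blast
  qed
qed

end

text \<open>A matrix is the sum of its rows, each of which factors through a single summand;
  locality of the corner picks one of them.\<close>

lemma (in linear_category) prim_add_iso_single:
  assumes M: "primitive_idempotent (cat_comp add xs xs xs) (cat_hom add xs xs) M" and xs: "xs \<in> cat_ob add"
  obtains i e where "i < length xs" "prim (xs ! i) e" "isomorphic (karoubi_envelope add) (xs, M) ([xs ! i], mat1 e)"
proof -
  interpret A: linear_category add "\<lambda>c M i j. c *s M i j" by (rule linear_add)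
  \<comment> \<open>Row i of M as a morphism to the one-term sequence, followed below by the
    inclusion of that summand.\<close>
  define u where "u i = (\<lambda>(a :: nat) k. if a = 0 then M i k else 0)" for i
  define v where "v i = (\<lambda>a (b :: nat). if a = i \<and> b = 0 then cat_id C (xs ! i) else 0)" for i
  have MA: "M \<in> cat_hom add xs xs" using M by (simp add: primitive_idempotent_def)
  have ob: "xs ! i \<in> cat_ob C" if "i < length xs" for i using xs that by (simp add: add_ob)
  have comp: "cat_comp add xs [xs ! i] xs (v i) (u i) = (\<lambda>a k. if a = i then M i k else 0)" if i: "i < length xs" for i
  proof (intro ext)
    fix a k
    show "cat_comp add xs [xs ! i] xs (v i) (u i) a k = (if a = i then M i k else 0)"
    proof (cases "a < length xs \<and> k < length xs")
      case True
      have "M i k \<in> cat_hom C (xs ! k) (xs ! i)" using MA True i by (simp add: add_hom)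
      then show ?thesis
        using True i ob by (simp add: add_comp u_def v_def comp_id_left comp_zero_left)
    next
      case False
      then show ?thesis using MA i by (auto simp: add_comp add_hom)
    qed
  qed
  have "M = (\<Sum>i<length xs. cat_comp add xs [xs ! i] xs (v i) (u i))"
  proof (intro ext)
    fix a k
    have "(\<Sum>i<length xs. cat_comp add xs [xs ! i] xs (v i) (u i)) a k = (\<Sum>i<length xs. if i = a then M a k else 0)"
      unfolding sum_fun_apply by (rule sum.cong) (auto simp: comp)
    also have "\<dots> = M a k" using MA by (auto simp: sum.delta add_hom)
    finally show "M a k = (\<Sum>i<length xs. cat_comp add xs [xs ! i] xs (v i) (u i)) a k" by simp
  qed
  moreover have "[xs ! i] \<in> cat_ob add \<and> u i \<in> cat_hom add xs [xs ! i] \<and> v i \<in> cat_hom add [xs ! i] xs"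
    if "i \<in> {..<length xs}" for i
    using that ob MA by (auto simp: add_hom add_ob u_def v_def hom_id hom_zero)
  ultimately obtain i f where i: "i < length xs" and f: "A.idem [xs ! i] f" "isomorphic (karoubi_envelope add) (xs, M) ([xs ! i], f)"
    using A.prim_sum_factors[OF M xs, of "{..<length xs}" "\<lambda>i. [xs ! i]" u v] by auto
  have eq: "f = mat1 (f 0 0)" using hom_mat1[of f "xs ! i" "xs ! i"] f(1) by (simp add: A.idem_def)
  have "prim (xs ! i) (f 0 0)"
    using A.prim_isomorphic[OF M A.prim_idem[OF xs M] f(1,2)] eq mat1_prim by metis
  then show thesis using that i f(2) eq by metis
qed

section \<open>Primitive idempotents of Brauer algebras\<close>

context
  fixes \<delta> :: "'k::field_char_0"
begin

interpretation B: linear_category "brauer_category \<delta>" pm_scale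
  by (rule linear_brauer_category)

interpretation A: linear_category "additive_envelope (brauer_category \<delta>)" "\<lambda>c M i j. pm_scale c (M i j)"
  by (rule B.linear_add)

abbreviation (input) bc :: "(diagram \<Rightarrow>\<^sub>0 'k) \<Rightarrow> (diagram \<Rightarrow>\<^sub>0 'k) \<Rightarrow> diagram \<Rightarrow>\<^sub>0 'k" where
  "bc \<equiv> brauer_comp \<delta>"

text \<open>The projection is multiplicative, so the projection of every power of w fixes z;
  multiplying by z also covers exponent 0, where the power is the unit.\<close>

lemma sym_proj_pw_nonzero:
  assumes w: "w \<in> brauer_algebra \<delta> r" and z: "sym_proj r w = z" "bc z z = z" "z \<noteq> 0"
  shows "carrier_algebra.pw bc (Poly_Mapping.single (id_diagram r) 1) w n \<noteq> 0"
proof -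
  interpret E: carrier_algebra "brauer_algebra \<delta> r" bc "Poly_Mapping.single (id_diagram r) 1"
    using B.endomorphism_algebra[of r] by simp
  have zs: "z \<in> sym_group_algebra r" using z(1) sym_proj_in by blast
  have "bc (sym_proj r (E.pw w n)) z = z"
  proof (induction n)
    case 0
    have "(Poly_Mapping.single (id_diagram r) 1 :: diagram \<Rightarrow>\<^sub>0 'k) \<in> sym_group_algebra r"
      by (simp add: sym_group_algebra_def id_diagram_in)
    then show ?case
      using brauer_comp_id_left[OF sym_group_algebra_subset[OF zs], of \<delta>] by (simp add: sym_proj_id)
  next
    case (Suc n)
    have pn: "E.pw w n \<in> brauer_algebra \<delta> r" using E.pw_in w by blast
    have "sym_proj r (E.pw w (Suc n)) = bc z (sym_proj r (E.pw w n))"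
      using sym_proj_comp[of w r "E.pw w n" \<delta>] w pn z(1) by simp
    then have "bc (sym_proj r (E.pw w (Suc n))) z = bc z (bc (sym_proj r (E.pw w n)) z)"
      using brauer_comp_assoc[OF sym_group_algebra_subset[OF zs] sym_group_algebra_subset[OF sym_proj_in] sym_group_algebra_subset[OF zs]]
      by simp
    then show ?case using Suc z(2) by simp
  qed
  then show ?thesis using z(3) by auto
qed

lemma sym_proj_idempotent:
  assumes "B.idem r e" shows "bc (sym_proj r e) (sym_proj r e) = sym_proj r e"
  using sym_proj_comp[of e r e \<delta>] assms by (simp add: B.idem_def)

lemma prim_in: "B.prim r e \<Longrightarrow> Poly_Mapping.keys e \<subseteq> brauer_diagrams r r \<and> bc e e = e \<and> e \<noteq> 0 \<and> B.idem r e"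
  using B.prim_idem[of r e] by (simp add: primitive_idempotent_def B.idem_def)

text \<open>The witnesses u and v in the group algebra are compressed to the corners of e and f. The
  projection undoes the compression, so q p projects to the nonzero idempotent below e and cannot be
  nilpotent.\<close>

lemma prim_iso_of_equivalent:
  assumes e: "B.prim r e" "sym_proj r e \<noteq> 0" and f: "B.prim r f"
    and eqv: "carrier_algebra.equivalent_idempotents (sym_group_algebra r) bc (sym_proj r e) (sym_proj r f)"
  shows "isomorphic B.kar (r, e) (r, f)"
proof -
  interpret S: carrier_algebra "sym_group_algebra r :: (diagram \<Rightarrow>\<^sub>0 'k) set" bc "Poly_Mapping.single (id_diagram r) 1"
    by (rule sym_group_carrier_algebra)
  interpret E: carrier_algebra "brauer_algebra \<delta> r" bc "Poly_Mapping.single (id_diagram r) 1"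
    using B.endomorphism_algebra[of r] by simp
  let ?z = "sym_proj r e" and ?z' = "sym_proj r f"
  obtain u v where uv: "u \<in> sym_group_algebra r" "v \<in> sym_group_algebra r" "bc ?z u = u" "bc u ?z' = u"
      "bc ?z' v = v" "bc v ?z = v" "bc u v = ?z" "bc v u = ?z'"
    using eqv unfolding S.equivalent_idempotents_def by blast
  have in_e: "e \<in> brauer_algebra \<delta> r" "f \<in> brauer_algebra \<delta> r" "u \<in> brauer_algebra \<delta> r" "v \<in> brauer_algebra \<delta> r"
    using prim_in[OF e(1)] prim_in[OF f] uv sym_group_algebra_subset by auto
  have ee: "bc e e = e" "bc f f = f" using prim_in[OF e(1)] prim_in[OF f] by auto
  define p where "p = bc (bc f v) e"
  define q where "q = bc (bc e u) f"
  have p: "p \<in> brauer_algebra \<delta> r" "bc p e = p" "bc f p = p"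
    unfolding p_def using in_e ee E.mul_in E.mul_assoc[of "bc f v" e e] E.mul_assoc[of f "bc f v" e] E.mul_assoc[of f f v] by auto
  have q: "q \<in> brauer_algebra \<delta> r" "bc q f = q" "bc e q = q"
    unfolding q_def using in_e ee E.mul_in E.mul_assoc[of "bc e u" f f] E.mul_assoc[of e "bc e u" f] E.mul_assoc[of e e u] by auto
  have proj: "sym_proj r (bc a b) = bc (sym_proj r a) (sym_proj r b)"
    if "a \<in> brauer_algebra \<delta> r" "b \<in> brauer_algebra \<delta> r" for a b
    using that sym_proj_comp by simp
  have "sym_proj r p = bc (bc ?z' v) ?z" unfolding p_def using in_e uv by (simp add: proj E.mul_in sym_proj_id del: brauer_category_simps)
  then have pp: "sym_proj r p = v" using uv by simp
  have "sym_proj r q = bc (bc ?z u) ?z'" unfolding q_def using in_e uv by (simp add: proj E.mul_in sym_proj_id del: brauer_category_simps)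
  then have pq: "sym_proj r q = u" using uv by simp
  have "sym_proj r (bc q p) = ?z" using proj[OF q(1) p(1)] pp pq uv by simp
  then have "carrier_algebra.pw bc (Poly_Mapping.single (id_diagram r) 1) (bc q p) n \<noteq> 0" for n
    using sym_proj_pw_nonzero[OF E.mul_in[OF q(1) p(1)]] sym_proj_idempotent prim_in[OF e(1)] e(2) by blast
  then show ?thesis
    using B.prim_non_nilpotent_iso[of r e r f p q] e(1) f p q by simp
qed

text \<open>If the projection split as a + b, the compression of a to the corner of e would project
  to a. It is not nilpotent, since a is a nonzero idempotent; and if it were a unit, the projection
  would be a right multiple of a, which b kills from the left.\<close>

lemma sym_proj_primitive:
  assumes e: "B.prim r e" "sym_proj r e \<noteq> 0"
  shows "primitive_idempotent bc (sym_group_algebra r) (sym_proj r e)"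
proof -
  interpret S: carrier_algebra "sym_group_algebra r :: (diagram \<Rightarrow>\<^sub>0 'k) set" bc "Poly_Mapping.single (id_diagram r) 1"
    by (rule sym_group_carrier_algebra)
  obtain BB where "fd_algebra (brauer_algebra \<delta> r) bc (Poly_Mapping.single (id_diagram r) 1) pm_scale BB"
    using B.fd_endomorphism_algebra[of r] by auto
  then interpret E: fd_algebra "brauer_algebra \<delta> r" bc "Poly_Mapping.single (id_diagram r) 1" pm_scale BB .
  let ?z = "sym_proj r e"
  have zS: "?z \<in> sym_group_algebra r" by (rule sym_proj_in)
  have zz: "bc ?z ?z = ?z" using sym_proj_idempotent prim_in[OF e(1)] by blast
  have eB: "e \<in> brauer_algebra \<delta> r" "bc e e = e" "primitive_idempotent bc (brauer_algebra \<delta> r) e"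
    using prim_in[OF e(1)] e(1) by auto
  have "\<not> (\<exists>a\<in>sym_group_algebra r. \<exists>b\<in>sym_group_algebra r. a \<noteq> 0 \<and> b \<noteq> 0 \<and> bc a a = a \<and> bc b b = b \<and>
      bc a b = 0 \<and> bc b a = 0 \<and> ?z = a + b)"
  proof
    assume "\<exists>a\<in>sym_group_algebra r. \<exists>b\<in>sym_group_algebra r. a \<noteq> 0 \<and> b \<noteq> 0 \<and> bc a a = a \<and> bc b b = b \<and>
      bc a b = 0 \<and> bc b a = 0 \<and> ?z = a + b"
    then obtain a b where ab: "a \<in> sym_group_algebra r" "b \<in> sym_group_algebra r" "a \<noteq> 0" "b \<noteq> 0" "bc a a = a" "bc b b = b"
      "bc a b = 0" "bc b a = 0" "?z = a + b" by blast
    have za: "bc ?z a = a" "bc a ?z = a" "bc b ?z = b"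
      using ab by (auto simp: brauer_comp_add_left brauer_comp_add_right)
    have aB: "a \<in> brauer_algebra \<delta> r" using sym_group_algebra_subset[OF ab(1)] by simp
    define x where "x = bc (bc e a) e"
    have x: "x \<in> brauer_algebra \<delta> r" "bc e x = x" "bc x e = x"
      unfolding x_def using aB eB E.mul_in E.mul_assoc[of "bc e a" e e] E.mul_assoc[of e "bc e a" e] E.mul_assoc[of e e a] by auto
    have proj: "sym_proj r (bc c d) = bc (sym_proj r c) (sym_proj r d)"
      if "c \<in> brauer_algebra \<delta> r" "d \<in> brauer_algebra \<delta> r" for c d
      using that sym_proj_comp by simp
    have px: "sym_proj r x = a"
      unfolding x_def using aB eB za by (simp add: proj E.mul_in sym_proj_id[OF ab(1)] del: brauer_category_simps)
    show False
    proof (cases rule: E.corner_nilpotent_or_invertible[OF eB(3) x])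
      case (1 n)
      then show ?thesis using sym_proj_pw_nonzero[OF x(1) px ab(5,3)] by simp
    next
      case (2 y)
      have "?z = bc a (sym_proj r y)" using proj[OF x(1) 2(1)] 2(4) px by simp
      then have "bc b ?z = bc (bc b a) (sym_proj r y)" using S.mul_assoc[OF ab(2,1) sym_proj_in] by simp
      then show ?thesis using ab za by simp
    qed
  qed
  then show ?thesis unfolding primitive_idempotent_def using zS zz e(2) by blast
qed

text \<open>The pieces of a decomposition of z project to orthogonal idempotents with sum z;
  primitivity of z leaves exactly one nonzero projection, equal to z.\<close>

lemma is_e_exists:
  assumes \<mu>: "is_z \<delta> \<mu> z"
  shows "\<exists>e. is_e \<delta> \<mu> e \<and> sym_proj (sum_list \<mu>) e = z"
proof -
  let ?r = "sum_list \<mu>"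
  interpret S: carrier_algebra "sym_group_algebra ?r :: (diagram \<Rightarrow>\<^sub>0 'k) set" bc "Poly_Mapping.single (id_diagram ?r) 1"
    by (rule sym_group_carrier_algebra)
  have zp: "primitive_idempotent bc (sym_group_algebra ?r) z" using \<mu> by (simp add: is_z_def)
  note z = S.primitive_in[OF zp]
  have "B.idem ?r z" using z sym_group_algebra_subset by (simp add: B.idem_def)
  then obtain T where T: "finite T" "\<And>a. a \<in> T \<Longrightarrow> B.prim ?r a" "\<And>a b. a \<in> T \<Longrightarrow> b \<in> T \<Longrightarrow> a \<noteq> b \<Longrightarrow> bc a b = 0" "\<Sum>T = z"
    using B.prim_decomposition[of ?r z] by (metis brauer_category_simps(4))
  have proj: "sym_proj ?r (bc c d) = bc (sym_proj ?r c) (sym_proj ?r d)" if "c \<in> T" "d \<in> T" for c d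
    using sym_proj_comp prim_in[OF T(2)] that by blast
  have sum: "(\<Sum>a\<in>T. sym_proj ?r a) = z"
    using sym_proj_sum[of ?r "\<lambda>a. a" T] T(4) sym_proj_id[OF z(1)] by simp
  have z_of: "sym_proj ?r a = z" if a: "a \<in> T" "sym_proj ?r a \<noteq> 0" for a
  proof (rule S.primitive_subidempotent[OF zp sym_proj_in _ _ _ a(2)])
    show aa: "bc (sym_proj ?r a) (sym_proj ?r a) = sym_proj ?r a"
      using sym_proj_idempotent prim_in[OF T(2)] a by blast
    have "bc z (sym_proj ?r a) = (\<Sum>b\<in>T. bc (sym_proj ?r b) (sym_proj ?r a))" by (simp add: sum[symmetric] brauer_comp_sum_left)
    also have "\<dots> = (\<Sum>b\<in>T. if b = a then sym_proj ?r a else 0)"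
      using a(1) aa T(3) by (intro sum.cong refl) (auto simp: proj[symmetric])
    finally show "bc z (sym_proj ?r a) = sym_proj ?r a" using a(1) T(1) by simp
    have "bc (sym_proj ?r a) z = (\<Sum>b\<in>T. bc (sym_proj ?r a) (sym_proj ?r b))" by (simp add: sum[symmetric] brauer_comp_sum_right)
    also have "\<dots> = (\<Sum>b\<in>T. if b = a then sym_proj ?r a else 0)"
      using a(1) aa T(3) by (intro sum.cong refl) (auto simp: proj[symmetric])
    finally show "bc (sym_proj ?r a) z = sym_proj ?r a" using a(1) T(1) by simp
  qed
  obtain e where e: "e \<in> T" "sym_proj ?r e \<noteq> 0"
    using sum z(3) by (metis sum.neutral)
  have uniq: "a = e" if "a \<in> T" "sym_proj ?r a \<noteq> 0" for a
  proof (rule ccontr)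
    assume "a \<noteq> e"
    then have "bc (sym_proj ?r a) (sym_proj ?r e) = 0" using proj[OF that(1) e(1)] T(3) that(1) e(1) by simp
    then have "bc z z = 0" using z_of[OF that] z_of[OF e] by simp
    then show False using z by simp
  qed
  obtain es where es: "set es = T" "distinct es" using finite_distinct_list[OF T(1)] by blast
  obtain i where i: "i < length es" "es ! i = e" using e(1) es by (metis in_set_conv_nth)
  have "sum_list es = z" using es T(4) by (metis sum_list_distinct_conv_sum_set[of es "\<lambda>x. x"] map_ident)
  moreover have "bc (es ! j) (es ! k) = 0" if "j < length es" "k < length es" "j \<noteq> k" for j k
    using that es T(3) nth_mem by (metis nth_eq_iff_index_eq)
  moreover have "sym_proj ?r (es ! j) \<noteq> 0 \<longleftrightarrow> j = i" if "j < length es" for j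
    using that i e es uniq nth_mem by (metis nth_eq_iff_index_eq)
  moreover have "primitive_idempotent bc (brauer_algebra \<delta> ?r) a" if "a \<in> set es" for a
    using T(2) that es by simp
  ultimately have "is_e \<delta> \<mu> e" unfolding is_e_def using \<mu> i by blast
  then show ?thesis using z_of e by blast
qed

text \<open>All other pieces project to zero, so the surviving one projects to the chosen z
  itself.\<close>

lemma is_e_props:
  assumes "is_e \<delta> \<mu> e"
  shows "B.prim (sum_list \<mu>) e" "is_z \<delta> \<mu> (sym_proj (sum_list \<mu>) e)" "sym_proj (sum_list \<mu>) e \<noteq> 0"
proof -
  let ?r = "sum_list \<mu>"
  obtain z es i where z: "is_z \<delta> \<mu> z"
    and es: "\<forall>a \<in> set es. primitive_idempotent bc (brauer_algebra \<delta> ?r) a" "sum_list es = z" "i < length es"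
      "\<forall>j < length es. sym_proj ?r (es ! j) \<noteq> 0 \<longleftrightarrow> j = i" "e = es ! i"
    using assms unfolding is_e_def by blast
  show "B.prim ?r e" using es by simp
  have "z \<in> sym_group_algebra ?r" using z by (simp add: is_z_def primitive_idempotent_def)
  then have "z = sym_proj ?r (\<Sum>j<length es. es ! j)"
    using sym_proj_id es(2) by (metis sum_list_sum_nth atLeast0LessThan)
  also have "\<dots> = (\<Sum>j<length es. if j = i then sym_proj ?r e else 0)"
    unfolding sym_proj_sum using es(4,5) by (intro sum.cong) auto
  also have "\<dots> = sym_proj ?r e" using es(3) by simp
  finally have "z = sym_proj ?r e" .
  then show "is_z \<delta> \<mu> (sym_proj ?r e)" using z by simp
  show "sym_proj ?r e \<noteq> 0" using es by blast
qed

text \<open>Two choices of z for one partition are equivalent in the group algebra, and equivalence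
  lifts. Allowing any primitive f with a suitable projection also covers the idempotent reached from
  an arbitrary indecomposable object.\<close>

lemma is_e_unique:
  assumes \<mu>: "is_partition \<mu>" and e: "is_e \<delta> \<mu> e" and f: "B.prim (sum_list \<mu>) f" "is_z \<delta> \<mu> (sym_proj (sum_list \<mu>) f)"
  shows "isomorphic B.kar (sum_list \<mu>, e) (sum_list \<mu>, f)"
proof -
  let ?r = "sum_list \<mu>"
  interpret S: symmetrizer_family "sym_group_algebra ?r :: (diagram \<Rightarrow>\<^sub>0 'k) set" bc "Poly_Mapping.single (id_diagram ?r) 1"
    pm_scale "partitions ?r" "young_symmetrizer \<delta>"
    by (rule sym_symmetrizer_family)
  have "\<mu> \<in> partitions ?r" using \<mu> by (simp add: partitions_def)
  then have "S.equivalent_idempotents (sym_proj ?r e) (sym_proj ?r f)"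
    using S.simple_idempotents_equivalent is_e_props(2)[OF e] f(2) by (simp add: S.is_simple_idempotent_def is_z_def)
  then show ?thesis using prim_iso_of_equivalent is_e_props[OF e] f(1) by blast
qed

text \<open>
  A primitive idempotent killed by the projection lies in the ideal of diagrams with fewer than
  \<open>r\<close> through strands, so its image is a direct summand of an object \<open>s < r\<close>.
\<close>

lemma prim_reduce:
  assumes "B.prim r e"
  shows "\<exists>s f. B.prim s f \<and> sym_proj s f \<noteq> 0 \<and> isomorphic B.kar (r, e) (s, f)"
  using assms
proof (induction r arbitrary: e rule: less_induct)
  case (less r)
  note e = prim_in[OF less.prems]
  show ?case
  proof (cases "sym_proj r e = 0")
    case False
    then show ?thesis using less.prems B.isomorphic_kar_refl e by blast
  next
    case True
    obtain s u v where suv: "\<And>D. D \<in> Poly_Mapping.keys e \<Longrightarrow> s D < r \<and> Poly_Mapping.keys (u D) \<subseteq> brauer_diagrams r (s D) \<and>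
        Poly_Mapping.keys (v D) \<subseteq> brauer_diagrams (s D) r"
      and sum: "e = (\<Sum>D\<in>Poly_Mapping.keys e. bc (v D) (u D))"
      using kernel_factors[of e r \<delta>] e True by blast
    obtain D f where D: "D \<in> Poly_Mapping.keys e" and f: "B.idem (s D) f" "isomorphic B.kar (r, e) (s D, f)"
      using B.prim_sum_factors[OF less.prems, of "Poly_Mapping.keys e" s u v] suv sum by auto
    have pf: "B.prim (s D) f" using B.prim_isomorphic[OF less.prems _ f] e by blast
    obtain t g where t: "B.prim t g" "sym_proj t g \<noteq> 0" "isomorphic B.kar (s D, f) (t, g)"
      using less.IH[OF _ pf] suv[OF D] by blast
    then have "isomorphic B.kar (r, e) (t, g)"
      using B.isomorphic_kar_trans[OF f(2) t(3)] e f(1) prim_in[OF t(1)] by blast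
    then show ?thesis using t by blast
  qed
qed

text \<open>An isomorphism factors f through r, and a composite through fewer than s points projects
  to zero.\<close>

lemma kar_iso_rank_le:
  assumes "isomorphic B.kar (r, e) (s, f)" "sym_proj s f \<noteq> 0" shows "s \<le> r"
proof (rule ccontr)
  assume "\<not> s \<le> r"
  obtain u v where "B.kar_iso r e s f u v" using assms(1) unfolding B.isomorphic_kar by blast
  then have "Poly_Mapping.keys v \<subseteq> brauer_diagrams s r" "Poly_Mapping.keys u \<subseteq> brauer_diagrams r s" "bc u v = f"
    by (auto simp: B.kar_iso_def)
  then show False using sym_proj_factor_zero[of v s r u \<delta>] assms(2) \<open>\<not> s \<le> r\<close> by simp
qed

text \<open>Multiplicativity of the projection turns the defining equations of an isomorphism into
  those of an equivalence.\<close>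

lemma kar_iso_equivalent:
  assumes "isomorphic B.kar (r, e) (r, f)"
  shows "carrier_algebra.equivalent_idempotents (sym_group_algebra r) bc (sym_proj r e) (sym_proj r f)"
proof -
  interpret S: carrier_algebra "sym_group_algebra r :: (diagram \<Rightarrow>\<^sub>0 'k) set" bc "Poly_Mapping.single (id_diagram r) 1"
    by (rule sym_group_carrier_algebra)
  obtain u v where "B.kar_iso r e r f u v" using assms unfolding B.isomorphic_kar by blast
  then have uv: "Poly_Mapping.keys u \<subseteq> brauer_diagrams r r" "Poly_Mapping.keys v \<subseteq> brauer_diagrams r r"
    "bc u e = u" "bc f u = u" "bc v f = v" "bc e v = v" "bc v u = e" "bc u v = f"
    by (auto simp: B.kar_iso_def)
  have k: "Poly_Mapping.keys e \<subseteq> brauer_diagrams r r" "Poly_Mapping.keys f \<subseteq> brauer_diagrams r r"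
    using brauer_comp_in[OF uv(1,2)] brauer_comp_in[OF uv(2,1)] uv(7,8) by metis+
  let ?\<pi> = "sym_proj r"
  have "bc (?\<pi> u) (?\<pi> e) = ?\<pi> u" "bc (?\<pi> f) (?\<pi> u) = ?\<pi> u" "bc (?\<pi> v) (?\<pi> f) = ?\<pi> v" "bc (?\<pi> e) (?\<pi> v) = ?\<pi> v"
    "bc (?\<pi> v) (?\<pi> u) = ?\<pi> e" "bc (?\<pi> u) (?\<pi> v) = ?\<pi> f"
    using uv k by (simp_all add: sym_proj_comp[symmetric])
  then show ?thesis
    unfolding S.equivalent_idempotents_def
    by (intro bexI[of _ "?\<pi> v"] bexI[of _ "?\<pi> u"] conjI) (simp_all add: sym_proj_in)
qed

section \<open>Transfer to \<open>Rep_O\<close> and assembly of the bijection\<close>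

lemma Rep_O_kar: "Rep_O \<delta> = A.kar"
  by (simp add: Rep_O_def)

lemma im_obj_idem: "B.prim r e \<Longrightarrow> A.prim [r] (mat1 e) \<and> A.idem [r] (mat1 e)"
proof -
  assume e: "B.prim r e"
  have "[r] \<in> cat_ob (additive_envelope (brauer_category \<delta>))" by (simp add: B.add_ob)
  then show ?thesis using e B.mat1_prim[of r e] A.prim_idem by blast
qed

lemma iso_class_im_obj_eq:
  assumes "B.prim r e" "B.prim s f"
  shows "iso_class (Rep_O \<delta>) (im_obj r e) = iso_class (Rep_O \<delta>) (im_obj s f) \<longleftrightarrow> isomorphic B.kar (r, e) (s, f)"
  unfolding im_obj_mat1 Rep_O_kar
  using A.iso_class_kar_eq_iff[of "[r]" "mat1 e" "[s]" "mat1 f"] im_obj_idem assms B.mat1_isomorphic by simp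

text \<open>All choices of the idempotent have isomorphic images, so the union is a single class; it
  is nonempty by \<open>is_e_exists\<close>.\<close>

lemma R_class_eq:
  assumes \<mu>: "is_partition \<mu>" and f: "B.prim (sum_list \<mu>) f" "is_z \<delta> \<mu> (sym_proj (sum_list \<mu>) f)"
  shows "R_class \<delta> \<mu> = iso_class (Rep_O \<delta>) (im_obj (sum_list \<mu>) f)"
proof -
  have "iso_class (Rep_O \<delta>) (im_obj (sum_list \<mu>) e) = iso_class (Rep_O \<delta>) (im_obj (sum_list \<mu>) f)" if "is_e \<delta> \<mu> e" for e
    using iso_class_im_obj_eq[OF is_e_props(1)[OF that] f(1)] is_e_unique[OF \<mu> that f] by simp
  moreover have "\<exists>e. is_e \<delta> \<mu> e" using is_e_exists[OF f(2)] by blast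
  ultimately show ?thesis unfolding R_class_def by auto
qed

lemma R_class_representative:
  assumes \<mu>: "is_partition \<mu>"
  obtains e where "B.prim (sum_list \<mu>) e" "is_z \<delta> \<mu> (sym_proj (sum_list \<mu>) e)" "sym_proj (sum_list \<mu>) e \<noteq> 0"
    "R_class \<delta> \<mu> = iso_class (Rep_O \<delta>) (im_obj (sum_list \<mu>) e)"
proof -
  let ?r = "sum_list \<mu>"
  interpret S: symmetrizer_family "sym_group_algebra ?r :: (diagram \<Rightarrow>\<^sub>0 'k) set" bc "Poly_Mapping.single (id_diagram ?r) 1"
    pm_scale "partitions ?r" "young_symmetrizer \<delta>"
    by (rule sym_symmetrizer_family)
  have "\<mu> \<in> partitions ?r" using \<mu> by (simp add: partitions_def)
  then obtain z where "S.is_simple_idempotent \<mu> z" using S.simple_idempotent_exists by blast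
  then have "is_z \<delta> \<mu> z" by (simp add: S.is_simple_idempotent_def is_z_def)
  then obtain e where "is_e \<delta> \<mu> e" using is_e_exists by blast
  then show thesis using is_e_props R_class_eq[OF \<mu>] that by blast
qed

lemma R_class_bij:
  "bij_betw (R_class \<delta>) {\<mu>. is_partition \<mu>}
     {iso_class (Rep_O \<delta>) X | X.
        X \<in> cat_ob (Rep_O \<delta>) \<and> \<not> zero_object (Rep_O \<delta>) X \<and> indecomposable (Rep_O \<delta>) X}"
proof (rule bij_betw_imageI)
  show "inj_on (R_class \<delta>) {\<mu>. is_partition \<mu>}"
  proof (rule inj_onI)
    fix \<mu> \<nu> assume "\<mu> \<in> {\<mu>. is_partition \<mu>}" "\<nu> \<in> {\<mu>. is_partition \<mu>}" and eq: "R_class \<delta> \<mu> = R_class \<delta> \<nu>"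
    then have p: "is_partition \<mu>" "is_partition \<nu>" by auto
    obtain e where e: "B.prim (sum_list \<mu>) e" "is_z \<delta> \<mu> (sym_proj (sum_list \<mu>) e)" "sym_proj (sum_list \<mu>) e \<noteq> 0"
      "R_class \<delta> \<mu> = iso_class (Rep_O \<delta>) (im_obj (sum_list \<mu>) e)" using R_class_representative[OF p(1)] .
    obtain f where f: "B.prim (sum_list \<nu>) f" "is_z \<delta> \<nu> (sym_proj (sum_list \<nu>) f)" "sym_proj (sum_list \<nu>) f \<noteq> 0"
      "R_class \<delta> \<nu> = iso_class (Rep_O \<delta>) (im_obj (sum_list \<nu>) f)" using R_class_representative[OF p(2)] .
    have iso: "isomorphic B.kar (sum_list \<mu>, e) (sum_list \<nu>, f)"
      using iso_class_im_obj_eq[OF e(1) f(1)] eq e(4) f(4) by simp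
    \<comment> \<open>The rank inequality applies in both directions because both idempotents
      survive the projection.\<close>
    have r: "sum_list \<nu> = sum_list \<mu>"
      using kar_iso_rank_le[OF iso f(3)] kar_iso_rank_le[OF B.isomorphic_kar_sym[OF iso] e(3)] by simp
    let ?r = "sum_list \<mu>"
    interpret S: symmetrizer_family "sym_group_algebra ?r :: (diagram \<Rightarrow>\<^sub>0 'k) set" bc "Poly_Mapping.single (id_diagram ?r) 1"
      pm_scale "partitions ?r" "young_symmetrizer \<delta>"
      by (rule sym_symmetrizer_family)
    have "\<mu> \<in> partitions ?r" "\<nu> \<in> partitions ?r" using p r by (simp_all add: partitions_def)
    moreover have "S.is_simple_idempotent \<mu> (sym_proj ?r e)" "S.is_simple_idempotent \<nu> (sym_proj ?r f)"
      using e(2) f(2) r by (simp_all add: S.is_simple_idempotent_def is_z_def)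
    moreover have "S.equivalent_idempotents (sym_proj ?r e) (sym_proj ?r f)"
      using kar_iso_equivalent[of ?r e f] iso r by simp
    ultimately show "\<mu> = \<nu>" by (rule S.simple_idempotents_index)
  qed
  show "R_class \<delta> ` {\<mu>. is_partition \<mu>} = {iso_class (Rep_O \<delta>) X | X.
        X \<in> cat_ob (Rep_O \<delta>) \<and> \<not> zero_object (Rep_O \<delta>) X \<and> indecomposable (Rep_O \<delta>) X}"
  proof (intro equalityI subsetI)
    fix c assume "c \<in> R_class \<delta> ` {\<mu>. is_partition \<mu>}"
    then obtain \<mu> where \<mu>: "is_partition \<mu>" "c = R_class \<delta> \<mu>" by auto
    obtain e where e: "B.prim (sum_list \<mu>) e" "R_class \<delta> \<mu> = iso_class (Rep_O \<delta>) (im_obj (sum_list \<mu>) e)"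
      using R_class_representative[OF \<mu>(1)] by blast
    let ?X = "im_obj (sum_list \<mu>) e"
    note i = im_obj_idem[OF e(1)]
    have "mat1 e \<noteq> 0" using prim_in[OF e(1)] mat1_eq_iff[of e 0] by (simp add: mat1_zero)
    then have "?X \<in> cat_ob (Rep_O \<delta>) \<and> \<not> zero_object (Rep_O \<delta>) ?X \<and> indecomposable (Rep_O \<delta>) ?X"
      using i A.zero_object_kar A.indecomposable_kar unfolding im_obj_mat1 Rep_O_kar A.kar_ob by blast
    then show "c \<in> {iso_class (Rep_O \<delta>) X | X.
        X \<in> cat_ob (Rep_O \<delta>) \<and> \<not> zero_object (Rep_O \<delta>) X \<and> indecomposable (Rep_O \<delta>) X}"
      using \<mu>(2) e(2) by blast
  next
    fix c assume "c \<in> {iso_class (Rep_O \<delta>) X | X.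
        X \<in> cat_ob (Rep_O \<delta>) \<and> \<not> zero_object (Rep_O \<delta>) X \<and> indecomposable (Rep_O \<delta>) X}"
    then obtain xs M where X: "(xs, M) \<in> cat_ob (Rep_O \<delta>)" "\<not> zero_object (Rep_O \<delta>) (xs, M)"
      "indecomposable (Rep_O \<delta>) (xs, M)" and c: "c = iso_class (Rep_O \<delta>) (xs, M)" by auto
    have idem: "A.idem xs M" using X(1) by (simp add: Rep_O_kar A.kar_ob)
    then have "M \<noteq> 0" using X(2) A.zero_object_kar by (simp add: Rep_O_kar)
    then have M: "A.prim xs M" using A.indecomposable_kar[OF idem] X(3) by (simp add: Rep_O_kar)
    have xs: "xs \<in> cat_ob (additive_envelope (brauer_category \<delta>))" using idem by (simp add: A.idem_def)
    \<comment> \<open>The matrix idempotent is replaced by one on a single summand, then by one on a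
      number of strands where it survives the projection.\<close>
    obtain i e where e: "B.prim (xs ! i) e" "isomorphic A.kar (xs, M) ([xs ! i], mat1 e)"
      using B.prim_add_iso_single[OF M xs] by blast
    obtain s f where f: "B.prim s f" "sym_proj s f \<noteq> 0" "isomorphic B.kar (xs ! i, e) (s, f)"
      using prim_reduce[OF e(1)] by blast
    have "c = iso_class (Rep_O \<delta>) (im_obj (xs ! i) e)"
      unfolding c Rep_O_kar im_obj_mat1 using A.iso_class_kar_eq_iff idem im_obj_idem[OF e(1)] e(2) by blast
    also have "\<dots> = iso_class (Rep_O \<delta>) (im_obj s f)" using iso_class_im_obj_eq[OF e(1) f(1)] f(3) by simp
    finally have cf: "c = iso_class (Rep_O \<delta>) (im_obj s f)" .
    interpret S: symmetrizer_family "sym_group_algebra s :: (diagram \<Rightarrow>\<^sub>0 'k) set" bc "Poly_Mapping.single (id_diagram s) 1"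
      pm_scale "partitions s" "young_symmetrizer \<delta>"
      by (rule sym_symmetrizer_family)
    obtain \<mu> where \<mu>: "\<mu> \<in> partitions s" "S.is_simple_idempotent \<mu> (sym_proj s f)"
      using S.primitive_is_simple[OF sym_proj_primitive[OF f(1,2)]] by blast
    then have m: "is_partition \<mu>" "sum_list \<mu> = s" by (simp_all add: partitions_def)
    have "is_z \<delta> \<mu> (sym_proj s f)" using \<mu>(2) m by (simp add: S.is_simple_idempotent_def is_z_def)
    then have "R_class \<delta> \<mu> = c" using R_class_eq[OF m(1), of f] m f(1) cf by simp
    then show "c \<in> R_class \<delta> ` {\<mu>. is_partition \<mu>}" using m(1) by auto
  qed
qed

end

theorem theorem3p5:
  fixes \<delta> :: "'k::field_char_0"
  shows "bij_betw (R_class \<delta>)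
           {\<mu>. is_partition \<mu>}
           {iso_class (Rep_O \<delta>) X | X.
              X \<in> cat_ob (Rep_O \<delta>) \<and> \<not> zero_object (Rep_O \<delta>) X \<and> indecomposable (Rep_O \<delta>) X}"
  by (rule R_class_bij)

end
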